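(* Let $q$ be a prime power, $n\geq 3$ an odd integer, and let $F=\mathbb{F}_{q^{2n}}(x,y)$ with $$y^{q^n+1}=(x^q+x)\left((x^q+x)^{q-1}-1\right)^{q+1}.$$ Let $\alpha_1,\dots,\alpha_q\in\mathbb{F}_{q^{2n}}$ be the (distinct) roots of $x^q+x$, and for $1\leq k\leq q$ let $Q_k$ be the unique place of $F$ over the zero of $x-\alpha_k$. Let $m=(q^n+1)/(q+1)$ and $$2\leq s\leq\min\left\{q,\ \max_{1\leq i\leq q^n}\left\{q+(q^2-q)\left\lceil\frac{i}{m}\right\rceil-\left\lfloor\frac{iq^3}{q^n+1}\right\rfloor\right\}\right\}.$$ Then $\Gamma(Q_1,\dots,Q_s)$ equals $$\left\{\big((q^n+1)j_1+i,\dots,(q^n+1)j_s+i\big)\;\Big|\;1\leq i\leq q^n,\ j_k\geq 0\ (1\leq k\leq s),\ \sum_{k=1}^s j_k=q-s+(q^2-q)\left\lceil\frac{i}{m}\right\rceil-\left\lfloor\frac{iq^3}{q^n+1}\right\rfloor\right\},$$ where $i,j_1,\dots,j_s$ are integers.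
   Context: $\mathbb{N}=\{1,2,\dots\}$, $\mathbb{N}_0=\mathbb{N}\cup\{0\}$, and $(z)_\infty$ denotes the pole divisor of $z$. The places $Q_k$ are totally ramified over $\mathbb{F}_{q^{2n}}(x)$ and rational. For $t\geq2$ distinct rational (degree one) places $R_1,\dots,R_t$ of $F$, $H(R_1,\dots,R_t)=\{(n_1,\dots,n_t)\in\mathbb{N}_0^t:\exists z\in F,\ (z)_\infty=\sum n_iR_i\}$. With the componentwise partial order $\preceq$ on $\mathbb{N}_0^t$ (an element $\mathbf a$ of a set $S$ is minimal in $S$ if $\mathbf b\not\preceq\mathbf a$ for all $\mathbf b\in S\setminus\{\mathbf a\}$), $\Gamma(R_1,\dots,R_t)$ is the set of all $\mathbf a=(a_1,\dots,a_t)\in\mathbb{N}^t$ such that, for some $1\leq i\leq t$, $\mathbf a$ is minimal in $\{\mathbf n\in H(R_1,\dots,R_t): n_i=a_i\}$. *)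

theory Defs
  imports
    Complex_Main
    "HOL-Computational_Algebra.Polynomial"
    "HOL-Number_Theory.Prime_Powers"
begin

definition subring_set :: "'a::field set \<Rightarrow> bool" where
  "subring_set R \<longleftrightarrow> 1 \<in> R \<and> (\<forall>a\<in>R. \<forall>b\<in>R. a - b \<in> R \<and> a * b \<in> R)"

definition subfield_set :: "'a::field set \<Rightarrow> bool" where
  "subfield_set K \<longleftrightarrow> subring_set K \<and> (\<forall>a\<in>K. inverse a \<in> K)"

definition adjoin :: "'a::field set \<Rightarrow> 'a set \<Rightarrow> 'a set" where
  "adjoin K S = subfield_set hull (K \<union> S)"

definition transcendental_over :: "'a::field set \<Rightarrow> 'a \<Rightarrow> bool" where
  "transcendental_over K x \<longleftrightarrow> (\<forall>p. p \<noteq> 0 \<and> (\<forall>i. coeff p i \<in> K) \<longrightarrow> poly p x \<noteq> 0)"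

definition ideal_of :: "'a::field set \<Rightarrow> 'a set \<Rightarrow> bool" where
  "ideal_of V I \<longleftrightarrow> I \<subseteq> V \<and> 0 \<in> I \<and> (\<forall>a\<in>I. \<forall>b\<in>I. a + b \<in> I) \<and> (\<forall>r\<in>V. \<forall>a\<in>I. r * a \<in> I)"

definition maximal_ideal_of :: "'a::field set \<Rightarrow> 'a set \<Rightarrow> bool" where
  "maximal_ideal_of V P \<longleftrightarrow>
     ideal_of V P \<and> P \<noteq> V \<and> (\<forall>I. ideal_of V I \<and> P \<subseteq> I \<longrightarrow> I = P \<or> I = V)"

text \<open>
  Below, \<open>L / K\<close> is an algebraic function field, with \<open>L\<close> a subfield of the ambient field.
  Valuation rings and places are those of Stichtenoth, \<open>Algebraic Function Fields and Codes\<close>: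
  the field of constants and \<open>L\<close> are excluded as valuation rings, and a place is the maximal ideal
  of a valuation ring.  The convention \<open>inverse 0 = 0\<close> is harmless, as \<open>0 \<in> V\<close>.
\<close>

definition valuation_ring :: "'a::field set \<Rightarrow> 'a set \<Rightarrow> 'a set \<Rightarrow> bool" where
  "valuation_ring K L V \<longleftrightarrow>
     subring_set V \<and> K \<subset> V \<and> V \<subset> L \<and> (\<forall>z\<in>L. z \<in> V \<or> inverse z \<in> V)"

definition place :: "'a::field set \<Rightarrow> 'a set \<Rightarrow> 'a set \<Rightarrow> bool" where
  "place K L P \<longleftrightarrow> (\<exists>V. valuation_ring K L V \<and> maximal_ideal_of V P)"

text \<open>The valuation ring is determined by the place, namely as \<open>{z \<in> L. z = 0 \<or> inverse z \<notin> P}\<close>.\<close>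

definition place_ring :: "'a::field set \<Rightarrow> 'a set \<Rightarrow> 'a set \<Rightarrow> 'a set" where
  "place_ring K L P = (THE V. valuation_ring K L V \<and> maximal_ideal_of V P)"

text \<open>
  The normalized discrete valuation: \<open>k\<close> with \<open>z = t\<^sup>k u\<close>, where \<open>t\<close> generates \<open>P\<close> and \<open>u\<close> is a
  unit of the valuation ring.  It is meaningful only for \<open>z \<noteq> 0\<close>.
\<close>

definition place_val :: "'a::field set \<Rightarrow> 'a set \<Rightarrow> 'a set \<Rightarrow> 'a \<Rightarrow> int" where
  "place_val K L P z =
     (THE k. \<exists>t u. P = (\<lambda>w. t * w) ` place_ring K L P \<and>
        u \<noteq> 0 \<and> u \<in> place_ring K L P \<and> inverse u \<in> place_ring K L P \<and> z = t powi k * u)"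

definition is_zero_of :: "'a::field set \<Rightarrow> 'a set \<Rightarrow> 'a set \<Rightarrow> 'a \<Rightarrow> bool" where
  "is_zero_of K L P z \<longleftrightarrow> place K L P \<and> z \<noteq> 0 \<and> place_val K L P z > 0"

text \<open>
  Extension of places in \<open>L' / L\<close> with the same constant field \<open>K\<close>: \<open>P'\<close> lies over \<open>P\<close>
  iff \<open>P \<subseteq> P'\<close>.
\<close>

definition lies_over :: "'a::field set \<Rightarrow> 'a set \<Rightarrow> 'a set \<Rightarrow> 'a set \<Rightarrow> 'a set \<Rightarrow> bool" where
  "lies_over K L L' P' P \<longleftrightarrow> place K L' P' \<and> place K L P \<and> P \<subseteq> P'"

text \<open>
  Effective divisors are represented by their coefficient functions, which vanish off the places.
  The function \<open>0\<close> (which has valuation \<open>\<infinity>\<close> everywhere) has no poles; since nonzero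
  constants have no poles either, allowing it in the set below is harmless.
\<close>

definition pole_divisor :: "'a::field set \<Rightarrow> 'a set \<Rightarrow> 'a \<Rightarrow> 'a set \<Rightarrow> nat" where
  "pole_divisor K L z = (\<lambda>P. if place K L P \<and> z \<noteq> 0 then nat (- place_val K L P z) else 0)"

definition divisor_sum :: "'a set list \<Rightarrow> nat list \<Rightarrow> 'a set \<Rightarrow> nat" where
  "divisor_sum Rs ns = (\<lambda>P. \<Sum>i<length Rs. if P = Rs ! i then ns ! i else 0)"

text \<open>Tuples in \<open>\<nat>\<^sub>0\<^sup>t\<close> are lists of length \<open>t\<close>; entry \<open>n\<^sub>i\<close> is \<open>ns ! (i - 1)\<close>.\<close>

definition weierstrass_semigroup :: "'a::field set \<Rightarrow> 'a set \<Rightarrow> 'a set list \<Rightarrow> nat list set" where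
  "weierstrass_semigroup K L Rs =
     {ns. length ns = length Rs \<and> (\<exists>z\<in>L. pole_divisor K L z = divisor_sum Rs ns)}"

definition minimal_in :: "nat list set \<Rightarrow> nat list \<Rightarrow> bool" where
  "minimal_in S a \<longleftrightarrow> a \<in> S \<and> (\<forall>b \<in> S - {a}. \<not> list_all2 (\<le>) b a)"

definition minimal_generating_set :: "'a::field set \<Rightarrow> 'a set \<Rightarrow> 'a set list \<Rightarrow> nat list set" where
  "minimal_generating_set K L Rs =
     {a. length a = length Rs \<and> (\<forall>i<length Rs. 1 \<le> a ! i) \<and>
         (\<exists>i<length Rs. minimal_in {ns \<in> weierstrass_semigroup K L Rs. ns ! i = a ! i} a)}"

end

theory Submission
  imports Defs
begin

text \<open>
  Put \<open>t = 1 / y\<close> and \<open>N = q\<^sup>n + 1\<close>.  Every function is uniquely \<open>\<Sum>i<N. a\<^sub>i t\<^sup>i\<close> with \<open>a\<^sub>i\<close> rational in \<open>x\<close>.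
  The automorphisms \<open>t \<mapsto> \<zeta> t\<close> with \<open>\<zeta>\<^sup>N = 1\<close> fix the totally ramified places \<open>Q\<^sub>k\<close>, so averaging over
  them shows that a function without poles outside \<open>Q\<^sub>1, \<dots>, Q\<^sub>s\<close> has components \<open>a\<^sub>i t\<^sup>i\<close> with the same
  property; and at each \<open>Q\<^sub>k\<close> the orders of the components are distinct modulo \<open>N\<close>, so the pole order of
  the function is the largest one among the components.  As the right-hand side of the equation is a product of powers
  of \<open>x - c\<close> with \<open>c\<close> in the field of \<open>q\<^sup>2\<close> elements, comparing zeros and poles of \<open>a\<^sub>i\<close> shows that \<open>a\<^sub>i t\<^sup>i\<close>
  with pole orders \<open>N j\<^sub>k + i\<close> exists iff \<open>\<Sum>k. j\<^sub>k\<close> is at least the bound in the statement.  The minimal vectors are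
  those where the bound is attained: otherwise some \<open>j\<^sub>k\<close> can be lowered (a negative \<open>j\<^sub>k\<close> means no pole).
\<close>

section \<open>Subfields and polynomials with coefficients in a subfield\<close>

text \<open>One computation yields the independence of the powers of \<open>t\<close>, total
  ramification and the uniqueness of each \<open>Q\<^sub>k\<close>. At a place over a root \<alpha>
  of \<open>x^q + x\<close> the equation gives \<open>v (x - \<alpha>) = N * v y\<close>, so a
  nonzero term \<open>a t^i\<close> has order \<open>v y * (N * r - i)\<close> with an integer
  \<open>r\<close> that depends on \<open>a\<close> and \<alpha> but not on the place. Terms with
  different \<open>i\<close> never have equal orders, so a sum vanishes only if all terms do; every
  order is a multiple of \<open>v y\<close>, hence \<open>v y = 1\<close>; and two places over
  \<alpha> give all functions the same orders, hence coincide. The obstacle before this is that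
  \<open>place_val\<close> is a definite description, meaningful only once the valuation ring is
  known to be discrete. Discreteness is derived for all valuation rings at once, from the bound
  \<open>N\<close> on the degree over K(x) that is common to all elements. The places at which a
  component is tested come from a maximality argument. Orders are recorded only at points of the
  field with \<open>q^2\<close> elements; a Bezout relation controls what remains of numerator and
  denominator.\<close>

lemma subring_set_minus: "subring_set R \<Longrightarrow> a \<in> R \<Longrightarrow> b \<in> R \<Longrightarrow> a - b \<in> R"
  and subring_set_mult: "subring_set R \<Longrightarrow> a \<in> R \<Longrightarrow> b \<in> R \<Longrightarrow> a * b \<in> R"
  and subring_set_one: "subring_set R \<Longrightarrow> 1 \<in> R"
  by (auto simp: subring_set_def)

lemma subring_set_zero: "subring_set R \<Longrightarrow> 0 \<in> R"
  using subring_set_minus[of R 1 1] subring_set_one by fastforce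

lemma subring_set_uminus: "subring_set R \<Longrightarrow> a \<in> R \<Longrightarrow> - a \<in> R"
  using subring_set_minus[of R 0 a] subring_set_zero by fastforce

lemma subring_set_add: "subring_set R \<Longrightarrow> a \<in> R \<Longrightarrow> b \<in> R \<Longrightarrow> a + b \<in> R"
  using subring_set_minus[of R a "- b"] subring_set_uminus by fastforce

lemma subring_set_power: "subring_set R \<Longrightarrow> a \<in> R \<Longrightarrow> a ^ k \<in> R"
  by (induction k) (auto simp: subring_set_one subring_set_mult)

lemma subring_set_sum: "subring_set R \<Longrightarrow> (\<And>i. i \<in> I \<Longrightarrow> f i \<in> R) \<Longrightarrow> sum f I \<in> R"
  by (induction I rule: infinite_finite_induct) (auto simp: subring_set_zero subring_set_add)

lemma subring_set_prod: "subring_set R \<Longrightarrow> (\<And>i. i \<in> I \<Longrightarrow> f i \<in> R) \<Longrightarrow> prod f I \<in> R"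
  by (induction I rule: infinite_finite_induct) (auto simp: subring_set_one subring_set_mult)

lemmas subring_set_closed =
  subring_set_minus subring_set_mult subring_set_one subring_set_zero subring_set_uminus
  subring_set_add subring_set_power

lemma subfield_setD: "subfield_set K \<Longrightarrow> subring_set K"
  by (auto simp: subfield_set_def)

lemma subfield_set_inverse: "subfield_set K \<Longrightarrow> a \<in> K \<Longrightarrow> inverse a \<in> K"
  by (auto simp: subfield_set_def)

lemma subfield_set_divide: "subfield_set K \<Longrightarrow> a \<in> K \<Longrightarrow> b \<in> K \<Longrightarrow> a / b \<in> K"
  by (auto simp: divide_inverse subfield_set_inverse subring_set_mult subfield_setD)

lemma subfield_set_powi: "subfield_set K \<Longrightarrow> a \<in> K \<Longrightarrow> a powi k \<in> K"
  by (cases "k \<ge> 0") (auto simp: power_int_def subfield_set_inverse subring_set_power subfield_setD)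

lemmas subfield_set_closed = subring_set_closed[OF subfield_setD] subfield_set_inverse
  subfield_set_divide subfield_set_powi subring_set_sum[OF subfield_setD] subring_set_prod[OF subfield_setD]

lemma subfield_set_UNIV: "subfield_set UNIV"
  by (auto simp: subfield_set_def subring_set_def)

lemma subfield_set_Inter: "(\<And>k. k \<in> T \<Longrightarrow> subfield_set k) \<Longrightarrow> subfield_set (\<Inter>T)"
  by (auto simp: subfield_set_def subring_set_def)

lemma subfield_set_adjoin: "subfield_set (adjoin K S)"
  unfolding adjoin_def by (rule hull_in) (auto intro: subfield_set_Inter)

lemma adjoin_subset: "K \<union> S \<subseteq> adjoin K S"
  unfolding adjoin_def by (rule hull_subset)

lemma adjoin_minimal: "K \<union> S \<subseteq> L \<Longrightarrow> subfield_set L \<Longrightarrow> adjoin K S \<subseteq> L"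
  unfolding adjoin_def by (rule hull_minimal)

section \<open>Division, gcd and root multiplicities for polynomials over a subfield\<close>

definition polys_over :: "'a::comm_ring_1 set \<Rightarrow> 'a poly set" where
  "polys_over R = {p. \<forall>i. coeff p i \<in> R}"

lemma coeff_polys_over: "p \<in> polys_over R \<Longrightarrow> coeff p i \<in> R"
  by (auto simp: polys_over_def)

context
  fixes R :: "'a::field set"
  assumes R: "subring_set R"
begin

lemma polys_over_0: "0 \<in> polys_over R"
  and polys_over_add: "p \<in> polys_over R \<Longrightarrow> r \<in> polys_over R \<Longrightarrow> p + r \<in> polys_over R"
  and polys_over_minus: "p \<in> polys_over R \<Longrightarrow> r \<in> polys_over R \<Longrightarrow> p - r \<in> polys_over R"
  and polys_over_smult: "a \<in> R \<Longrightarrow> p \<in> polys_over R \<Longrightarrow> smult a p \<in> polys_over R"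
  and polys_over_monom: "a \<in> R \<Longrightarrow> monom a k \<in> polys_over R"
  by (auto simp: polys_over_def subring_set_closed[OF R])

lemma polys_over_pCons: "a \<in> R \<Longrightarrow> p \<in> polys_over R \<Longrightarrow> pCons a p \<in> polys_over R"
  by (auto simp: polys_over_def coeff_pCons split: nat.splits)

lemma polys_over_1: "1 \<in> polys_over R"
  using polys_over_pCons[OF _ polys_over_0, of 1] subring_set_one[OF R] by (simp add: pCons_one)

lemma polys_over_mult: "p \<in> polys_over R \<Longrightarrow> r \<in> polys_over R \<Longrightarrow> p * r \<in> polys_over R"
  by (auto simp: polys_over_def coeff_mult intro!: subring_set_sum[OF R] subring_set_mult[OF R])

lemma polys_over_sum: "(\<And>i. i \<in> I \<Longrightarrow> f i \<in> polys_over R) \<Longrightarrow> sum f I \<in> polys_over R"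
  by (induction I rule: infinite_finite_induct) (auto simp: polys_over_0 polys_over_add)

lemma polys_over_prod: "(\<And>i. i \<in> I \<Longrightarrow> f i \<in> polys_over R) \<Longrightarrow> prod f I \<in> polys_over R"
  by (induction I rule: infinite_finite_induct) (auto simp: polys_over_1 polys_over_mult)

lemma polys_over_power: "p \<in> polys_over R \<Longrightarrow> p ^ k \<in> polys_over R"
  by (induction k) (auto simp: polys_over_1 polys_over_mult)

lemma poly_polys_over_in:
  assumes "p \<in> polys_over R" "R \<subseteq> V" "subring_set V" "z \<in> V"
  shows "poly p z \<in> V"
  unfolding poly_altdef using assms
  by (intro subring_set_sum subring_set_mult subring_set_power) (auto simp: polys_over_def)

lemma subring_set_poly_image: "subring_set ((\<lambda>p. poly p z) ` polys_over R)"
  unfolding subring_set_def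
proof (intro conjI ballI)
  show "1 \<in> (\<lambda>p. poly p z) ` polys_over R" using polys_over_1 by force
  fix a b assume "a \<in> (\<lambda>p. poly p z) ` polys_over R" "b \<in> (\<lambda>p. poly p z) ` polys_over R"
  then obtain p r where pr: "p \<in> polys_over R" "r \<in> polys_over R" "a = poly p z" "b = poly r z" by auto
  show "a - b \<in> (\<lambda>p. poly p z) ` polys_over R"
    using pr polys_over_minus[of p r] by (intro image_eqI[of _ _ "p - r"]) auto
  show "a * b \<in> (\<lambda>p. poly p z) ` polys_over R"
    using pr polys_over_mult[of p r] by (intro image_eqI[of _ _ "p * r"]) auto
qed

end

lemma polys_over_div_mod:
  fixes K :: "'a::field set"
  assumes K: "subfield_set K" and A: "A \<in> polys_over K" and p: "p \<in> polys_over K" "p \<noteq> 0"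
  shows "\<exists>s\<in>polys_over K. \<exists>r\<in>polys_over K. A = p * s + r \<and> (r = 0 \<or> degree r < degree p)"
  using A
proof (induction "degree A" arbitrary: A rule: less_induct)
  case less
  note R = subfield_setD[OF K]
  show ?case
  proof (cases "A = 0 \<or> degree A < degree p")
    case True
    then show ?thesis using less.prems polys_over_0[OF R] by (intro bexI[of _ 0] bexI[of _ A]) auto
  next
    case False
    define c where "c = lead_coeff A / lead_coeff p"
    define M where "M = monom c (degree A - degree p)"
    have c: "c \<in> K" unfolding c_def using less.prems p K
      by (intro subfield_set_divide) (auto simp: polys_over_def)
    have M: "M \<in> polys_over K" unfolding M_def using polys_over_monom[OF R c] .
    have c0: "c \<noteq> 0" using False p by (auto simp: c_def)
    define A' where "A' = A - p * M"
    have A': "A' \<in> polys_over K" unfolding A'_def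
      by (intro polys_over_minus polys_over_mult R less.prems p M)
    have dM: "degree (p * M) = degree A" using False p c0
      by (subst degree_mult_eq) (auto simp: M_def degree_monom_eq)
    have lc: "coeff (p * M) (degree A) = lead_coeff A"
      using lead_coeff_mult[of p M] dM p c0 by (simp add: M_def c_def degree_monom_eq)
    show ?thesis
    proof (cases "A' = 0")
      case True
      then have "A = p * M + 0" by (simp add: A'_def)
      then show ?thesis using M polys_over_0[OF R] by blast
    next
      case nz: False
      \<comment> \<open>Cancelling the leading term lowers the degree only if it is positive,
        because \<open>degree 0 = 0\<close>. For constants the cancellation already leaves zero,
        against \<open>nz\<close>.\<close>
      show ?thesis
      proof (cases "degree A = 0")
        case True
        then have dp: "degree p = 0" using False by auto
        have "degree A' \<le> 0" using True dM unfolding A'_def by (metis degree_diff_le le_refl)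
        moreover have "coeff A' 0 = 0" using lc True by (simp add: A'_def)
        ultimately have "A' = 0" by (metis le_zero_eq leading_coeff_0_iff)
        then show ?thesis using nz by simp
      next
        case dA: False
        have "degree A' < degree A"
        proof (rule degree_lessI)
          show "A' \<noteq> 0 \<or> 0 < degree A" using nz by simp
          show "\<forall>k\<ge>degree A. coeff A' k = 0"
          proof (intro allI impI)
            fix k assume k: "k \<ge> degree A"
            show "coeff A' k = 0"
            proof (cases "k = degree A")
              case True
              then show ?thesis using lc by (simp add: A'_def)
            next
              case False
              then have "k > degree A" using k by simp
              then show ?thesis using dM by (simp add: A'_def coeff_eq_0)
            qed
          qed
        qed
        from less.hyps[OF this A'] obtain s r where sr: "s \<in> polys_over K" "r \<in> polys_over K"
          "A' = p * s + r" "r = 0 \<or> degree r < degree p" by blast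
        have "A = p * (s + M) + r" using sr(3) by (simp add: A'_def algebra_simps)
        then show ?thesis using sr polys_over_add[OF R sr(1) M] by blast
      qed
    qed
  qed
qed

text \<open>A common divisor of minimal degree among the combinations \<open>U A + W B\<close> plays the role of the
  gcd, which is not available over a subset of a type.\<close>

lemma polys_over_gcd:
  fixes K :: "'a::field set"
  assumes K: "subfield_set K" and A: "A \<in> polys_over K" and B: "B \<in> polys_over K" "B \<noteq> 0"
  obtains A' B' U W where "A' \<in> polys_over K" "B' \<in> polys_over K" "U \<in> polys_over K" "W \<in> polys_over K"
    "B' \<noteq> 0" "U * A' + W * B' = 1" "A * B' = A' * B"
proof -
  note R = subfield_setD[OF K]
  define I where "I = {U * A + W * B | U W. U \<in> polys_over K \<and> W \<in> polys_over K}"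
  have IK: "I \<subseteq> polys_over K" unfolding I_def using A B
    by (auto intro!: polys_over_add[OF R] polys_over_mult[OF R])
  have AI: "A \<in> I" unfolding I_def using polys_over_0[OF R] polys_over_1[OF R]
    by (intro CollectI exI[of _ 1] exI[of _ 0]) auto
  have BI: "B \<in> I" unfolding I_def using polys_over_0[OF R] polys_over_1[OF R]
    by (intro CollectI exI[of _ 0] exI[of _ 1]) auto
  have comb: "C - G * S \<in> I" if "C \<in> I" "G \<in> I" "S \<in> polys_over K" for C G S
  proof -
    from that obtain U W U' W' where *: "U \<in> polys_over K" "W \<in> polys_over K"
      "U' \<in> polys_over K" "W' \<in> polys_over K" "C = U * A + W * B" "G = U' * A + W' * B"
      by (auto simp: I_def)
    have "C - G * S = (U - U' * S) * A + (W - W' * S) * B" by (simp add: * algebra_simps)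
    then show ?thesis using * that(3) unfolding I_def
      by (blast intro: polys_over_minus[OF R] polys_over_mult[OF R])
  qed
  obtain G where G: "G \<in> I" "G \<noteq> 0" and min: "\<And>H. H \<in> I \<Longrightarrow> H \<noteq> 0 \<Longrightarrow> degree G \<le> degree H"
    using ex_has_least_nat[of "\<lambda>G. G \<in> I \<and> G \<noteq> 0" B degree] BI B by blast
  have dvd: "\<exists>S\<in>polys_over K. C = G * S" if C: "C \<in> I" for C
  proof -
    obtain s r where sr: "s \<in> polys_over K" "r \<in> polys_over K" "C = G * s + r" "r = 0 \<or> degree r < degree G"
      using polys_over_div_mod[OF K subsetD[OF IK C] subsetD[OF IK G(1)] G(2)] by blast
    have "C - G * s = r" using sr(3) by (metis add_diff_cancel_left')
    then have "r \<in> I" using comb[OF C G(1) sr(1)] by metis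
    then have "r = 0" using min sr(4) by (meson not_le)
    then show ?thesis using sr(1,3) by auto
  qed
  obtain A' B' where AB: "A' \<in> polys_over K" "B' \<in> polys_over K" "A = G * A'" "B = G * B'"
    using dvd[OF AI] dvd[OF BI] by blast
  obtain U W where UW: "U \<in> polys_over K" "W \<in> polys_over K" "G = U * A + W * B"
    using G by (auto simp: I_def)
  have "G * (U * A' + W * B') = G * 1" using UW AB by (simp add: algebra_simps)
  then have "U * A' + W * B' = 1" using G(2) by simp
  moreover have "B' \<noteq> 0" using B AB by auto
  moreover have "A * B' = A' * B" using AB by simp
  ultimately show ?thesis using that AB UW by blast
qed

lemma polys_over_root_factor:
  fixes K :: "'a::field set"
  assumes K: "subfield_set K" and A: "A \<in> polys_over K" and c: "c \<in> K" "poly A c = 0"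
  shows "\<exists>B\<in>polys_over K. A = [:- c, 1:] * B"
proof -
  note R = subfield_setD[OF K]
  have X: "[:- c, 1:] \<in> polys_over K"
    using c by (intro polys_over_pCons[OF R] polys_over_0[OF R] subring_set_uminus[OF R] subring_set_one[OF R])
  obtain s r where sr: "s \<in> polys_over K" "A = [:- c, 1:] * s + r" "r = 0 \<or> degree r < degree [:- c, 1:]"
    using polys_over_div_mod[OF K A X] by auto
  have d: "degree r = 0" using sr(3) by auto
  have "poly r c = 0" using c(2) sr(2) by simp
  then have "r = 0" using d by (metis degree_0_id poly_pCons poly_0 mult_zero_right add_0_right pCons_0_0)
  then show ?thesis using sr by auto
qed

text \<open>Roots are split off one at a time until none is left in \<open>T\<close>; the cofactor
  will then be a unit at every place over a point of \<open>T\<close>.\<close>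

lemma polys_over_roots_factor:
  fixes K :: "'a::field set"
  assumes K: "subfield_set K" and A: "A \<in> polys_over K" "A \<noteq> 0" and T: "finite T" "T \<subseteq> K"
  shows "\<exists>r. \<exists>B\<in>polys_over K. A = (\<Prod>c\<in>T. [:- c, 1:] ^ r c) * B \<and> (\<forall>c\<in>T. poly B c \<noteq> 0)"
  using A
proof (induction "degree A" arbitrary: A rule: less_induct)
  case less
  show ?case
  proof (cases "\<forall>c\<in>T. poly A c \<noteq> 0")
    case True
    then show ?thesis using less.prems by (intro exI[of _ "\<lambda>_. 0"] bexI[of _ A]) auto
  next
    case False
    then obtain c where c: "c \<in> T" "poly A c = 0" by blast
    then obtain A' where A': "A' \<in> polys_over K" "A = [:- c, 1:] * A'"
      using polys_over_root_factor[OF K less.prems(1)] T by blast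
    have nz: "A' \<noteq> 0" using A' less.prems by auto
    then have "degree A' < degree A" using A' by (simp add: degree_mult_eq del: mult_pCons_left)
    from less.hyps[OF this A'(1) nz] obtain r B where rB: "B \<in> polys_over K"
      "A' = (\<Prod>c\<in>T. [:- c, 1:] ^ r c) * B" "\<forall>c\<in>T. poly B c \<noteq> 0" by blast
    have "(\<Prod>d\<in>T. [:- d, 1:] ^ (r(c := Suc (r c))) d) = [:- c, 1:] * (\<Prod>d\<in>T. [:- d, 1:] ^ r d)"
    proof -
      have "(\<Prod>d\<in>T - {c}. [:- d, 1:] ^ (r(c := Suc (r c))) d) = (\<Prod>d\<in>T - {c}. [:- d, 1:] ^ r d)"
        by (intro prod.cong) auto
      then show ?thesis using T(1) c(1)
        by (subst (1 2) prod.remove[of T c]) (auto simp: mult_ac simp del: mult_pCons_left)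
    qed
    then have "A = (\<Prod>d\<in>T. [:- d, 1:] ^ (r(c := Suc (r c))) d) * B"
      using A'(2) rB(2) by (simp only: mult.assoc)
    then show ?thesis using rB by blast
  qed
qed

section \<open>Linear dependence over a subfield\<close>

lemma homogeneous_system_nontrivial_solution:
  fixes k :: "'a::field set" and c :: "nat \<Rightarrow> nat \<Rightarrow> 'a"
  assumes k: "subfield_set k" and c: "\<And>i j. i < n \<Longrightarrow> j \<le> n \<Longrightarrow> c i j \<in> k"
  shows "\<exists>l. (\<forall>j\<le>n. l j \<in> k) \<and> (\<exists>j\<le>n. l j \<noteq> 0) \<and> (\<forall>i<n. (\<Sum>j\<le>n. c i j * l j) = 0)"
  using c
proof (induction n arbitrary: c)
  case 0
  then show ?case using subfield_set_closed(3)[OF k] by (intro exI[of _ "\<lambda>_. 1"]) auto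
next
  case (Suc n)
  note cl = subfield_set_closed[OF k]
  show ?case
  proof (cases "\<forall>j\<le>Suc n. c n j = 0")
    case True
    have "\<exists>l. (\<forall>j\<le>n. l j \<in> k) \<and> (\<exists>j\<le>n. l j \<noteq> 0) \<and> (\<forall>i<n. (\<Sum>j\<le>n. c i j * l j) = 0)"
      by (rule Suc.IH) (simp add: Suc.prems)
    then obtain l where l: "\<forall>j\<le>n. l j \<in> k" "\<exists>j\<le>n. l j \<noteq> 0" "\<forall>i<n. (\<Sum>j\<le>n. c i j * l j) = 0"
      by blast
    define l' where "l' = (\<lambda>j. if j \<le> n then l j else 0)"
    have "(\<Sum>j\<le>Suc n. c i j * l' j) = 0" if "i < Suc n" for i
    proof (cases "i = n")
      case True2: True
      then show ?thesis using True by (intro sum.neutral) auto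
    next
      case False
      then show ?thesis using l(3) that by (simp add: l'_def)
    qed
    moreover have "\<forall>j\<le>Suc n. l' j \<in> k" using l(1) cl(4) by (auto simp: l'_def)
    moreover have "\<exists>j\<le>Suc n. l' j \<noteq> 0" using l(2) by (auto simp: l'_def)
    ultimately show ?thesis by blast
  next
    case False
    then obtain p where p: "p \<le> Suc n" "c n p \<noteq> 0" by blast
    \<comment> \<open>\<open>s\<close> enumerates the columns other than the pivot column
      \<open>p\<close> of the last row \<open>n\<close>.\<close>
    define s where "s j = (if j < p then j else Suc j)" for j
    have s: "s j \<le> Suc n" "s j \<noteq> p" if "j \<le> n" for j using that by (auto simp: s_def)
    have bij: "bij_betw s {..n} ({..Suc n} - {p})"
    proof (rule bij_betw_byWitness[where f' = "\<lambda>j. if j < p then j else j - 1"])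
    qed (use p(1) in \<open>auto simp: s_def split: if_splits\<close>)
    define d where "d i j = c i (s j) - c i p * (c n (s j) / c n p)" for i j
    have "\<exists>l. (\<forall>j\<le>n. l j \<in> k) \<and> (\<exists>j\<le>n. l j \<noteq> 0) \<and> (\<forall>i<n. (\<Sum>j\<le>n. d i j * l j) = 0)"
    proof (rule Suc.IH)
      fix i j assume "i < n" "j \<le> n"
      then show "d i j \<in> k" unfolding d_def using p s Suc.prems
        by (intro cl(1) cl(2) cl(9)) auto
    qed
    then obtain l where l: "\<forall>j\<le>n. l j \<in> k" "\<exists>j\<le>n. l j \<noteq> 0" "\<forall>i<n. (\<Sum>j\<le>n. d i j * l j) = 0" by blast
    \<comment> \<open>The value that row \<open>n\<close> forces on the eliminated unknown.\<close>
    define e where "e = - (\<Sum>j\<le>n. c n (s j) / c n p * l j)"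
    define l' where "l' j = (if j = p then e else l (the_inv_into {..n} s j))" for j
    have inj: "inj_on s {..n}" using bij by (auto simp: bij_betw_def)
    have l's: "l' (s j) = l j" if "j \<le> n" for j
      using s[OF that] that the_inv_into_f_f[OF inj, of j] by (auto simp: l'_def)
    have split: "(\<Sum>j\<le>Suc n. c i j * l' j) = c i p * e + (\<Sum>j\<le>n. c i (s j) * l j)" for i
    proof -
      have "(\<Sum>j\<le>Suc n. c i j * l' j) = c i p * l' p + (\<Sum>j\<in>{..Suc n} - {p}. c i j * l' j)"
        using p(1) by (subst sum.remove[of _ p]) auto
      also have "(\<Sum>j\<in>{..Suc n} - {p}. c i j * l' j) = (\<Sum>j\<le>n. c i (s j) * l' (s j))"
        using sum.reindex_bij_betw[OF bij, of "\<lambda>j. c i j * l' j"] by simp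
      finally show ?thesis using l's by (simp add: l'_def)
    qed
    have "e \<in> k" unfolding e_def using l(1) p s Suc.prems
      by (intro cl(5) cl(11) cl(2) cl(9)) auto
    have "l' j \<in> k" if "j \<le> Suc n" for j
    proof (cases "j = p")
      case True
      then show ?thesis using \<open>e \<in> k\<close> by (simp add: l'_def)
    next
      case False
      then have "j \<in> s ` {..n}" using bij that by (simp add: bij_betw_def)
      then obtain j' where "j' \<le> n" "j = s j'" by auto
      then show ?thesis using l(1) l's by auto
    qed
    moreover have "\<exists>j\<le>Suc n. l' j \<noteq> 0" using l(2) l's s by metis
    moreover have "(\<Sum>j\<le>Suc n. c i j * l' j) = 0" if "i < Suc n" for i
    proof (cases "i = n")
      case True
      then show ?thesis unfolding split e_def using p(2) by (simp add: sum_distrib_left mult.assoc)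
    next
      case False
      then have "0 = (\<Sum>j\<le>n. d i j * l j)" using l(3) that by auto
      also have "\<dots> = (\<Sum>j\<le>n. c i (s j) * l j) + c i p * e"
        unfolding d_def e_def by (simp add: algebra_simps sum_subtractf sum_distrib_left)
      finally show ?thesis unfolding split by (simp add: add.commute)
    qed
    ultimately show ?thesis by blast
  qed
qed

text \<open>The coordinates of the \<open>w j\<close> form a homogeneous system of \<open>n\<close>
  equations in \<open>n + 1\<close> unknowns.\<close>

lemma span_linear_dependence:
  fixes k :: "'a::field set"
  assumes k: "subfield_set k"
    and w: "\<And>j. j \<le> (n::nat) \<Longrightarrow> \<exists>c. (\<forall>i<n. c i \<in> k) \<and> w j = (\<Sum>i<n. c i * b i)"
  shows "\<exists>l. (\<forall>j\<le>n. l j \<in> k) \<and> (\<exists>j\<le>n. l j \<noteq> 0) \<and> (\<Sum>j\<le>n. l j * w j) = 0"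
proof -
  obtain c where c: "\<And>j i. j \<le> n \<Longrightarrow> i < n \<Longrightarrow> c j i \<in> k" "\<And>j. j \<le> n \<Longrightarrow> w j = (\<Sum>i<n. c j i * b i)"
    using w by metis
  obtain l where l: "\<forall>j\<le>n. l j \<in> k" "\<exists>j\<le>n. l j \<noteq> 0" "\<forall>i<n. (\<Sum>j\<le>n. c j i * l j) = 0"
    using homogeneous_system_nontrivial_solution[OF k, of n "\<lambda>i j. c j i"] c(1) by blast
  have "(\<Sum>j\<le>n. l j * w j) = (\<Sum>j\<le>n. \<Sum>i<n. c j i * l j * b i)"
    by (intro sum.cong refl) (auto simp: c(2) sum_distrib_left mult_ac)
  also have "\<dots> = (\<Sum>i<n. (\<Sum>j\<le>n. c j i * l j) * b i)"
    by (subst sum.swap) (simp add: sum_distrib_right)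
  also have "\<dots> = 0" using l(3) by auto
  finally show ?thesis using l by blast
qed

text \<open>A ring that is finitely generated as a vector space over a field is a field: a polynomial
  relation of minimal order satisfied by \<open>z\<close> exhibits its inverse.\<close>

lemma inverse_in_of_relation:
  fixes S :: "'a::field set"
  assumes k: "subfield_set k" and S: "subring_set S" "k \<subseteq> S" and z: "z \<in> S" "z \<noteq> 0"
    and l: "\<forall>j\<le>n. l j \<in> k" "\<exists>j\<le>n. l j \<noteq> 0" "(\<Sum>j\<le>n. l j * z ^ j) = 0"
  shows "inverse z \<in> S"
  using l
proof (induction n arbitrary: l)
  case 0
  then show ?case by simp
next
  case (Suc n)
  have split: "(\<Sum>j\<le>Suc n. l j * z ^ j) = l 0 + z * (\<Sum>j\<le>n. l (Suc j) * z ^ j)"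
    by (subst sum.atMost_Suc_shift) (simp add: sum_distrib_left mult_ac)
  show ?case
  proof (cases "l 0 = 0")
    case True
    then have "\<exists>j\<le>n. l (Suc j) \<noteq> 0" using Suc.prems(2) by (metis Suc_le_mono not0_implies_Suc)
    moreover have "(\<Sum>j\<le>n. l (Suc j) * z ^ j) = 0" using Suc.prems(3) True z split by simp
    ultimately show ?thesis using Suc.IH[of "\<lambda>j. l (Suc j)"] Suc.prems(1) by auto
  next
    case False
    let ?u = "\<Sum>j\<le>n. l (Suc j) * z ^ j"
    have l0: "- (z * ?u) = l 0"
      using Suc.prems(3) unfolding split by (rule eq_neg_iff_add_eq_0[THEN iffD2, symmetric])
    have "z * (- ?u * inverse (l 0)) = - (z * ?u) * inverse (l 0)"
      by (simp only: mult_minus_left mult_minus_right mult.assoc)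
    also have "\<dots> = 1" unfolding l0 using False by simp
    finally have "z * (- ?u * inverse (l 0)) = 1" .
    then have eq: "inverse z = - ?u * inverse (l 0)" by (rule inverse_unique)
    have "?u \<in> S" using Suc.prems(1) S z
      by (intro subring_set_sum[OF S(1)] subring_set_mult[OF S(1)] subring_set_power[OF S(1)]) auto
    moreover have "inverse (l 0) \<in> S" using Suc.prems(1) S subfield_set_inverse[OF k] by auto
    ultimately show ?thesis unfolding eq by (intro subring_set_mult[OF S(1)] subring_set_uminus[OF S(1)])
  qed
qed

section \<open>Valuation rings and normalized valuations\<close>

text \<open>The maximal ideal of a valuation ring. Zero is listed separately because
  \<open>inverse 0 = 0\<close> lies in \<open>V\<close>.\<close>

definition nonunits :: "'a::field set \<Rightarrow> 'a set" where
  "nonunits V = {z \<in> V. z = 0 \<or> inverse z \<notin> V}"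

definition unit_in :: "'a::field set \<Rightarrow> 'a \<Rightarrow> bool" where
  "unit_in V u \<longleftrightarrow> u \<noteq> 0 \<and> u \<in> V \<and> inverse u \<in> V"

locale valued_field =
  fixes K L V :: "'a::field set"
  assumes K: "subfield_set K" and L: "subfield_set L" and V: "valuation_ring K L V"
begin

lemma V_subring: "subring_set V" and K_sub_V: "K \<subseteq> V" and V_sub_L: "V \<subseteq> L" and V_neq_L: "V \<noteq> L"
  and V_cases: "z \<in> L \<Longrightarrow> z \<in> V \<or> inverse z \<in> V"
  using V by (auto simp: valuation_ring_def)

lemmas V_closed = subring_set_closed[OF V_subring] subring_set_sum[OF V_subring] subring_set_prod[OF V_subring]
lemmas L_closed = subfield_set_closed[OF L]

lemma unit_in_mult: "unit_in V u \<Longrightarrow> unit_in V w \<Longrightarrow> unit_in V (u * w)"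
  and unit_in_inverse: "unit_in V u \<Longrightarrow> unit_in V (inverse u)"
  and unit_in_1: "unit_in V 1"
  by (auto simp: unit_in_def V_closed)

lemma unit_in_power: "unit_in V u \<Longrightarrow> unit_in V (u ^ k)"
  by (induction k) (auto simp: unit_in_1 unit_in_mult)

lemma unit_in_powi: "unit_in V u \<Longrightarrow> unit_in V (u powi k)"
  by (cases "k \<ge> 0") (auto simp: power_int_def unit_in_power unit_in_inverse)

lemma unit_in_divide: "unit_in V u \<Longrightarrow> unit_in V w \<Longrightarrow> unit_in V (u / w)"
  by (simp add: divide_inverse unit_in_mult unit_in_inverse)

lemma unit_in_K: "c \<in> K \<Longrightarrow> c \<noteq> 0 \<Longrightarrow> unit_in V c"
  using K_sub_V subfield_set_inverse[OF K] by (auto simp: unit_in_def)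

lemma nonunits_iff: "z \<in> nonunits V \<longleftrightarrow> z \<in> V \<and> \<not> unit_in V z"
  by (auto simp: nonunits_def unit_in_def)

lemma not_in_V: "z \<in> L \<Longrightarrow> z \<notin> V \<Longrightarrow> inverse z \<in> nonunits V"
  using V_cases[of z] V_closed(4) by (auto simp: nonunits_def)

lemma nonunits_mult: "a \<in> V \<Longrightarrow> b \<in> nonunits V \<Longrightarrow> a * b \<in> nonunits V"
proof -
  assume a: "a \<in> V" and b: "b \<in> nonunits V"
  have "a * b \<in> V" using a b V_closed(2) by (auto simp: nonunits_def)
  moreover have "inverse (a * b) \<notin> V" if "a * b \<noteq> 0"
  proof
    have "a * inverse (a * b) = inverse b" using that by (simp add: field_simps)
    moreover assume "inverse (a * b) \<in> V"
    ultimately have "inverse b \<in> V" using V_closed(2)[OF a] by metis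
    then show False using b that by (auto simp: nonunits_def)
  qed
  ultimately show ?thesis by (auto simp: nonunits_def)
qed

text \<open>Of \<open>a / b\<close> and \<open>b / a\<close> one lies in \<open>V\<close>, so the
  sum is a multiple of one of the summands.\<close>

lemma nonunits_add:
  assumes a: "a \<in> nonunits V" and b: "b \<in> nonunits V"
  shows "a + b \<in> nonunits V"
proof -
  have *: "a + b \<in> nonunits V" if "a \<in> nonunits V" "b \<in> nonunits V" "b \<noteq> 0" "a / b \<in> V" for a b
  proof -
    have "(a / b + 1) * b = a + b" using that by (simp add: field_simps)
    then show ?thesis using nonunits_mult[of "a / b + 1" b] that V_closed by metis
  qed
  show ?thesis
  proof (cases "a = 0 \<or> b = 0")
    case True
    then show ?thesis using a b by auto
  next
    case False
    have "a / b \<in> L" using a b V_sub_L by (auto simp: nonunits_def intro!: L_closed(9))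
    then have "a / b \<in> V \<or> b / a \<in> V" using V_cases[of "a / b"] by (simp add: inverse_eq_divide)
    then show ?thesis using *[of a b] *[of b a] a b False by (auto simp: add.commute)
  qed
qed

lemma nonunits_0: "0 \<in> nonunits V" and one_notin_nonunits: "1 \<notin> nonunits V"
  by (auto simp: nonunits_def V_closed)

lemma nonunits_sum: "(\<And>i. i \<in> I \<Longrightarrow> f i \<in> nonunits V) \<Longrightarrow> sum f I \<in> nonunits V"
  by (induction I rule: infinite_finite_induct) (auto simp: nonunits_0 nonunits_add)

lemma nonunits_uminus: "a \<in> nonunits V \<Longrightarrow> - a \<in> nonunits V"
  using nonunits_mult[of "- 1" a] V_closed by auto

lemma unit_in_add_nonunit:
  assumes u: "unit_in V u" and a: "a \<in> nonunits V"
  shows "unit_in V (u + a)"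
proof (rule ccontr)
  have uV: "u \<in> V" and aV: "a \<in> V" using u a by (auto simp: unit_in_def nonunits_def)
  assume "\<not> unit_in V (u + a)"
  then have "u + a \<in> nonunits V" using V_closed(6)[OF uV aV] by (simp add: nonunits_iff)
  then have "(u + a) + - a \<in> nonunits V" using a by (rule nonunits_add[OF _ nonunits_uminus])
  then show False using u by (simp add: nonunits_iff)
qed

lemma nonunits_power_cancel: "z ^ k \<in> nonunits V \<Longrightarrow> z \<in> V \<Longrightarrow> z \<in> nonunits V"
  using unit_in_power by (auto simp: nonunits_iff)

text \<open>A case of integral closedness: if \<open>inverse z\<close> were a nonunit, so would be
  \<open>z ^ k * inverse z ^ k = 1\<close>.\<close>

lemma power_in_V: "z ^ k \<in> V \<Longrightarrow> k > 0 \<Longrightarrow> z \<in> L \<Longrightarrow> z \<in> V"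
proof (rule ccontr)
  assume *: "z ^ k \<in> V" "k > 0" "z \<in> L" "z \<notin> V"
  have nu: "inverse z \<in> nonunits V" using not_in_V * by blast
  have z: "z \<noteq> 0" using * V_closed(4) by auto
  have "inverse z ^ k \<in> nonunits V"
    using nonunits_mult[of "inverse z ^ (k - 1)" "inverse z"] nu * V_closed(7)[of "inverse z" "k - 1"]
    by (metis mult.commute nonunits_iff power_minus_mult)
  then have "z ^ k * inverse z ^ k \<in> nonunits V" using * by (intro nonunits_mult)
  moreover have "z ^ k * inverse z ^ k = 1" using z by (simp add: power_inverse)
  ultimately show False using one_notin_nonunits by simp
qed

lemma ideal_nonunits: "ideal_of V (nonunits V)"
  by (auto simp: ideal_of_def nonunits_0 nonunits_add nonunits_mult) (auto simp: nonunits_def)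

text \<open>An ideal containing a unit is everything, so each proper ideal lies in
  \<open>nonunits V\<close>. This turns the maximal ideal in \<open>place\<close> into an explicit
  set.\<close>

lemma maximal_ideal_iff: "maximal_ideal_of V P \<longleftrightarrow> P = nonunits V"
proof -
  have sub: "I \<subseteq> nonunits V" if "ideal_of V I" "I \<noteq> V" for I
  proof
    fix z assume z: "z \<in> I"
    show "z \<in> nonunits V"
    proof (rule ccontr)
      assume "z \<notin> nonunits V"
      then have u: "unit_in V z" using z that by (auto simp: ideal_of_def nonunits_iff)
      have "w \<in> I" if w: "w \<in> V" for w
      proof -
        have "(w * inverse z) * z \<in> I" using \<open>ideal_of V I\<close> u w z V_closed(2)[of w "inverse z"]
          unfolding ideal_of_def unit_in_def by blast
        then show ?thesis using u by (simp add: unit_in_def mult.assoc)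
      qed
      then show False using that by (auto simp: ideal_of_def)
    qed
  qed
  have "nonunits V \<noteq> V" using one_notin_nonunits V_closed(3) by auto
  then show ?thesis using sub ideal_nonunits unfolding maximal_ideal_of_def by blast
qed

text \<open>For \<open>z\<close> outside \<open>V\<close> the inverse is a nonunit. Hence the ideal
  determines the ring, as the definite description in \<open>place_ring\<close> requires.\<close>

lemma V_eq_of_nonunits: "V = {z \<in> L. z = 0 \<or> inverse z \<notin> nonunits V}"
proof (intro equalityI subsetI)
  fix z assume "z \<in> V"
  then show "z \<in> {z \<in> L. z = 0 \<or> inverse z \<notin> nonunits V}" using V_sub_L by (auto simp: nonunits_def)
next
  fix z assume "z \<in> {z \<in> L. z = 0 \<or> inverse z \<notin> nonunits V}"
  then show "z \<in> V" using not_in_V[of z] V_closed(4) by auto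
qed

lemma place_nonunits: "place K L (nonunits V)"
  unfolding place_def using V maximal_ideal_iff by blast

text \<open>The strict triangle equality in multiplicative form, usable before any integer-valued
  order is available.\<close>

lemma sum_dominated:
  assumes I: "finite I" "i \<in> I" and z: "z i \<noteq> 0" "\<And>j. j \<in> I - {i} \<Longrightarrow> z j / z i \<in> nonunits V"
  shows "\<exists>u. unit_in V u \<and> sum z I = z i * u"
proof (intro exI conjI)
  show "unit_in V (1 + (\<Sum>j\<in>I - {i}. z j / z i))"
    using z by (intro unit_in_add_nonunit unit_in_1 nonunits_sum) auto
  have "z i * (1 + (\<Sum>j\<in>I - {i}. z j / z i)) = z i + (\<Sum>j\<in>I - {i}. z i * (z j / z i))"
    by (simp add: distrib_left sum_distrib_left)
  also have "\<dots> = z i + sum z (I - {i})" using z by simp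
  also have "\<dots> = sum z I" using I by (simp add: sum.remove[of I i])
  finally show "sum z I = z i * (1 + (\<Sum>j\<in>I - {i}. z j / z i))" by simp
qed

lemma exists_dominating:
  assumes "finite I" "I \<noteq> {}" "\<And>i. i \<in> I \<Longrightarrow> z i \<in> L" "\<And>i. i \<in> I \<Longrightarrow> z i \<noteq> 0"
  shows "\<exists>i\<in>I. \<forall>j\<in>I. z j / z i \<in> V"
  using assms
proof (induction I rule: finite_ne_induct)
  case (singleton i)
  then show ?case using V_closed(3) by auto
next
  case (insert a I)
  then obtain i where i: "i \<in> I" "\<forall>j\<in>I. z j / z i \<in> V" by auto
  have "z a / z i \<in> L" using insert.prems i by (intro L_closed(9)) auto
  then have "z a / z i \<in> V \<or> z i / z a \<in> V" using V_cases[of "z a / z i"] by (simp add: inverse_eq_divide)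
  then show ?case
  proof
    assume "z a / z i \<in> V"
    then show ?thesis using i by auto
  next
    assume *: "z i / z a \<in> V"
    have "z j / z a \<in> V" if "j \<in> I" for j
    proof -
      have "z j / z i * (z i / z a) = z j / z a" using insert.prems i by simp
      then show ?thesis using V_closed(2)[of "z j / z i" "z i / z a"] * i that by auto
    qed
    moreover have "z a / z a \<in> V" using insert.prems V_closed(3) by auto
    ultimately show ?thesis by auto
  qed
qed

text \<open>Some term divides all others in the sense of \<open>V\<close>; if no other were
  associated to it, it would dominate strictly and the sum could not vanish.\<close>

lemma vanishing_sum_associated:
  assumes I: "finite I" "I \<noteq> {}" and z: "\<And>i. i \<in> I \<Longrightarrow> z i \<in> L" "\<And>i. i \<in> I \<Longrightarrow> z i \<noteq> 0" and s: "sum z I = 0"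
  shows "\<exists>i\<in>I. \<exists>j\<in>I. i \<noteq> j \<and> unit_in V (z j / z i)"
proof (rule ccontr)
  assume H: "\<not> ?thesis"
  obtain i where i: "i \<in> I" "\<forall>j\<in>I. z j / z i \<in> V" using exists_dominating[of I z] I z by blast
  have "z j / z i \<in> nonunits V" if "j \<in> I - {i}" for j
    using i that H by (auto simp: nonunits_iff)
  then obtain u where "unit_in V u" "sum z I = z i * u" using sum_dominated[of I i z] I z i by blast
  then show False using s z i by (auto simp: unit_in_def)
qed

end

lemma place_cases:
  assumes "subfield_set K" "subfield_set L" "place K L P"
  obtains V where "valued_field K L V" "P = nonunits V"
  using assms valued_field.maximal_ideal_iff unfolding place_def
  by (metis valued_field.intro)

lemma (in valued_field) place_ring_nonunits: "place_ring K L (nonunits V) = V"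
  unfolding place_ring_def
proof (rule the_equality)
  show "valuation_ring K L V \<and> maximal_ideal_of V (nonunits V)" using V maximal_ideal_iff by auto
  fix W assume W: "valuation_ring K L W \<and> maximal_ideal_of W (nonunits V)"
  then interpret W: valued_field K L W using K L by unfold_locales auto
  have "nonunits V = nonunits W" using W W.maximal_ideal_iff by auto
  then show "W = V" using V_eq_of_nonunits W.V_eq_of_nonunits by simp
qed

definition uniformizer :: "'a::field set \<Rightarrow> 'a set \<Rightarrow> 'a \<Rightarrow> bool" where
  "uniformizer L V t \<longleftrightarrow> t \<in> nonunits V \<and> t \<noteq> 0 \<and>
     (\<forall>z\<in>L. z \<noteq> 0 \<longrightarrow> (\<exists>k u. unit_in V u \<and> z = t powi k * u))"

section \<open>Discrete valuation rings and the laws of the normalized order\<close>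

locale discretely_valued_field = valued_field +
  assumes ex_uniformizer: "\<exists>t. uniformizer L V t"
begin

abbreviation "val \<equiv> place_val K L (nonunits V)"

lemma powi_unit_in_V_iff:
  assumes t: "t \<in> nonunits V" "t \<noteq> 0" and u: "unit_in V u"
  shows "t powi k * u \<in> V \<longleftrightarrow> k \<ge> 0"
proof
  assume "k \<ge> 0"
  then show "t powi k * u \<in> V" using t u
    by (auto simp: power_int_def nonunits_def unit_in_def intro!: V_closed)
next
  assume *: "t powi k * u \<in> V"
  show "k \<ge> 0"
  proof (rule ccontr)
    assume k: "\<not> k \<ge> 0"
    \<comment> \<open>For negative \<open>k\<close> this factor lies in \<open>V\<close>; with one
      more \<open>t\<close> the product of powers is 1, which would then be a nonunit.\<close>
    have "t powi (- k - 1) \<in> V" using k t by (auto simp: power_int_def nonunits_def intro!: V_closed)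
    then have "t powi (- k - 1) * (t powi k * u) * inverse u \<in> V"
      using * u by (auto simp: unit_in_def intro!: V_closed)
    then have "(t powi (- k - 1) * (t powi k * u) * inverse u) * t \<in> nonunits V"
      using t by (intro nonunits_mult)
    also have "(t powi (- k - 1) * (t powi k * u) * inverse u) * t = t powi ((- k - 1) + k + 1)"
      using t u unfolding power_int_add[OF disjI1[OF t(2)]] by (simp add: unit_in_def)
    finally show False using one_notin_nonunits by simp
  qed
qed

lemma uniformizer_image:
  assumes t: "uniformizer L V t"
  shows "nonunits V = (\<lambda>w. t * w) ` V"
proof (intro equalityI subsetI)
  fix z assume "z \<in> (\<lambda>w. t * w) ` V"
  then show "z \<in> nonunits V" using nonunits_mult t by (auto simp: uniformizer_def mult.commute[of t])
next
  fix z assume z: "z \<in> nonunits V"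
  show "z \<in> (\<lambda>w. t * w) ` V"
  proof (cases "z = 0")
    case True
    then show ?thesis using V_closed(4) by (intro image_eqI[of _ _ 0]) auto
  next
    case False
    have zL: "z \<in> L" using z V_sub_L by (auto simp: nonunits_def)
    then obtain k u where u: "unit_in V u" and eq: "z = t powi k * u"
      using t False unfolding uniformizer_def by blast
    have t': "t \<in> nonunits V" "t \<noteq> 0" using t by (auto simp: uniformizer_def)
    have "k \<noteq> 0" using z u eq by (auto simp: nonunits_iff)
    moreover have "k \<ge> 0" using powi_unit_in_V_iff[OF t' u] z eq by (auto simp: nonunits_def)
    ultimately have "t powi (k - 1) * u \<in> V" using powi_unit_in_V_iff[OF t' u] by auto
    moreover have "z = t * (t powi (k - 1) * u)" using t'
      by (simp add: eq power_int_diff field_simps)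
    ultimately show ?thesis by blast
  qed
qed

text \<open>\<open>place_val\<close> ranges over all generators of the ideal, so the exponent must
  not depend on the generator: two generators differ by a unit.\<close>

lemma place_val_unique:
  assumes t: "uniformizer L V t" and u: "unit_in V u" and z: "z = t powi k * u"
  shows "val z = k"
  unfolding place_val_def place_ring_nonunits
proof (rule the_equality)
  show "\<exists>t u. nonunits V = (\<lambda>w. t * w) ` V \<and> u \<noteq> 0 \<and> u \<in> V \<and> inverse u \<in> V \<and> z = t powi k * u"
    using uniformizer_image[OF t] u z by (auto simp: unit_in_def)
next
  have t': "t \<in> nonunits V" "t \<noteq> 0" using t by (auto simp: uniformizer_def)
  fix k' assume "\<exists>t u. nonunits V = (\<lambda>w. t * w) ` V \<and> u \<noteq> 0 \<and> u \<in> V \<and> inverse u \<in> V \<and> z = t powi k' * u"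
  then obtain t1 u1 where 1: "nonunits V = (\<lambda>w. t1 * w) ` V" "unit_in V u1" "z = t1 powi k' * u1"
    by (auto simp: unit_in_def)
  have "t1 * 1 \<in> nonunits V" unfolding 1(1) using V_closed(3) by blast
  then obtain w where w: "w \<in> V" "t1 = t * w" using uniformizer_image[OF t] by auto
  obtain w1 where w1: "w1 \<in> V" "t = t1 * w1" using t' 1(1) by auto
  have nz: "w \<noteq> 0" "w1 \<noteq> 0" "t1 \<noteq> 0" using w w1 t' by auto
  have "t * (w * w1) = t1 * w1" by (simp only: w(2) mult.assoc)
  also have "\<dots> = t * 1" by (simp only: w1(2)[symmetric] mult_1_right)
  finally have "t * (w * w1) = t * 1" .
  then have "w * w1 = 1" using t'(2) mult_cancel_left by blast
  then have "inverse w = w1" using inverse_unique by blast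
  then have wu: "unit_in V w" using w w1 nz by (auto simp: unit_in_def)
  have "t powi k * u = t powi k' * (w powi k' * u1)"
    using z 1(3) w(2) by (simp add: power_int_mult_distrib mult_ac)
  then have "t powi (k - k') * (u / (w powi k' * u1)) = 1"
    using t' nz u 1(2) by (simp add: power_int_diff unit_in_def field_simps)
  moreover have "unit_in V (u / (w powi k' * u1))" (is "unit_in V ?e")
    using u wu 1(2) by (intro unit_in_divide unit_in_mult unit_in_powi)
  ultimately have "k - k' \<ge> 0" "- (k - k') \<ge> 0"
  proof -
    assume e: "t powi (k - k') * ?e = 1" and ue: "unit_in V ?e"
    show "k - k' \<ge> 0" using powi_unit_in_V_iff[OF t' ue, of "k - k'"] e V_closed(3) by auto
    have "t powi (- (k - k')) * inverse ?e = inverse (t powi (k - k') * ?e)"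
      by (simp only: power_int_minus inverse_mult_distrib)
    then have "t powi (- (k - k')) * inverse ?e = 1" using e by simp
    then show "- (k - k') \<ge> 0" using powi_unit_in_V_iff[OF t' unit_in_inverse[OF ue], of "- (k - k')"] V_closed(3)
      by auto
  qed
  then show "k' = k" by simp
qed

lemma val_factor:
  assumes "uniformizer L V t" "z \<in> L" "z \<noteq> 0"
  obtains u where "unit_in V u" "z = t powi (val z) * u"
  using assms place_val_unique unfolding uniformizer_def by metis

lemma val_mult:
  assumes z: "z \<in> L" "z \<noteq> 0" and w: "w \<in> L" "w \<noteq> 0"
  shows "val (z * w) = val z + val w"
proof -
  obtain t where t: "uniformizer L V t" using ex_uniformizer by blast
  obtain u1 where 1: "unit_in V u1" "z = t powi (val z) * u1" using val_factor[OF t z] .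
  obtain u2 where 2: "unit_in V u2" "w = t powi (val w) * u2" using val_factor[OF t w] .
  have tnz: "t \<noteq> 0" using t by (auto simp: uniformizer_def)
  have "z * w = (t powi (val z) * u1) * (t powi (val w) * u2)" using 1 2 by metis
  also have "\<dots> = t powi (val z + val w) * (u1 * u2)" using tnz by (simp add: power_int_add mult_ac)
  finally show ?thesis using place_val_unique[OF t unit_in_mult[OF 1(1) 2(1)]] by blast
qed

lemma val_nonneg_iff:
  assumes z: "z \<in> L" "z \<noteq> 0"
  shows "val z \<ge> 0 \<longleftrightarrow> z \<in> V"
proof -
  obtain t where t: "uniformizer L V t" using ex_uniformizer by blast
  obtain u1 where 1: "unit_in V u1" "z = t powi (val z) * u1" using val_factor[OF t z] .
  show ?thesis using powi_unit_in_V_iff[of t u1 "val z"] 1 t by (auto simp: uniformizer_def)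
qed

lemma val_one: "val 1 = 0"
  using val_mult[of 1 1] L_closed(3) by simp

lemma val_inverse: "z \<in> L \<Longrightarrow> z \<noteq> 0 \<Longrightarrow> val (inverse z) = - val z"
  using val_mult[of z "inverse z"] val_one L_closed(8)[of z] by simp

lemma val_divide: "z \<in> L \<Longrightarrow> z \<noteq> 0 \<Longrightarrow> w \<in> L \<Longrightarrow> w \<noteq> 0 \<Longrightarrow> val (z / w) = val z - val w"
  by (simp add: divide_inverse val_mult val_inverse L_closed)

lemma val_unit_iff: "z \<in> L \<Longrightarrow> z \<noteq> 0 \<Longrightarrow> unit_in V z \<longleftrightarrow> val z = 0"
  using val_nonneg_iff[of z] val_nonneg_iff[of "inverse z"] val_inverse[of z] L_closed(8)[of z]
  by (auto simp: unit_in_def)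

lemma val_pos_iff: "z \<in> L \<Longrightarrow> z \<noteq> 0 \<Longrightarrow> val z > 0 \<longleftrightarrow> z \<in> nonunits V"
  using val_unit_iff[of z] val_nonneg_iff[of z] by (auto simp: nonunits_iff)

lemma val_power: "z \<in> L \<Longrightarrow> z \<noteq> 0 \<Longrightarrow> val (z ^ k) = int k * val z"
  by (induction k) (auto simp: val_one val_mult L_closed algebra_simps)

lemma val_powi: "z \<in> L \<Longrightarrow> z \<noteq> 0 \<Longrightarrow> val (z powi k) = k * val z"
  by (cases "k \<ge> 0") (auto simp: power_int_def val_power val_inverse L_closed)

lemma val_prod: "(\<And>i. i \<in> I \<Longrightarrow> f i \<in> L \<and> f i \<noteq> 0) \<Longrightarrow> val (prod f I) = (\<Sum>i\<in>I. val (f i))"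
proof (induction I rule: infinite_finite_induct)
  case (insert i I)
  then show ?case using val_mult[of "f i" "prod f I"] L_closed(12)[of I f] by auto
qed (auto simp: val_one)

lemma val_const: "c \<in> K \<Longrightarrow> c \<noteq> 0 \<Longrightarrow> val c = 0"
  using val_unit_iff[of c] unit_in_K[of c] K_sub_V V_sub_L by auto

lemma ex_val_1: "\<exists>t\<in>L. t \<noteq> 0 \<and> val t = 1"
proof -
  obtain t where t: "uniformizer L V t" using ex_uniformizer by blast
  have "val t = 1" using place_val_unique[OF t unit_in_1, of t 1] by simp
  then show ?thesis using t V_sub_L by (auto simp: uniformizer_def nonunits_def)
qed

text \<open>Vanishing summands are exempt from the comparison of orders because \<open>val 0\<close>
  is meaningless.\<close>

lemma val_sum_dominated:
  assumes I: "finite I" "i \<in> I" and z: "\<And>j. j \<in> I \<Longrightarrow> z j \<in> L" "z i \<noteq> 0"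
    and lt: "\<And>j. j \<in> I \<Longrightarrow> j \<noteq> i \<Longrightarrow> z j \<noteq> 0 \<Longrightarrow> val (z i) < val (z j)"
  shows "sum z I \<noteq> 0" "val (sum z I) = val (z i)"
proof -
  have "z j / z i \<in> nonunits V" if "j \<in> I - {i}" for j
  proof (cases "z j = 0")
    case True
    then show ?thesis by (simp add: nonunits_0)
  next
    case False
    then have "val (z j / z i) > 0" using that z I lt[of j] val_divide[of "z j" "z i"] by auto
    then show ?thesis using val_pos_iff[of "z j / z i"] False that z I L_closed(9) by auto
  qed
  then obtain u where u: "unit_in V u" "sum z I = z i * u" using sum_dominated[of I i z] I z by blast
  have "u \<in> L" "u \<noteq> 0" using u V_sub_L by (auto simp: unit_in_def)
  moreover from this have "val u = 0" using val_unit_iff u by blast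
  ultimately show "sum z I \<noteq> 0" "val (sum z I) = val (z i)" using u z I val_mult[of "z i" u] by auto
qed

end

section \<open>Valuation rings of algebraic function fields are discrete\<close>

lemma subfield_set_fractions:
  assumes R: "subring_set R"
  shows "subfield_set {a / b | a b. a \<in> R \<and> b \<in> R \<and> b \<noteq> (0::'a::field)}" (is "subfield_set ?Q")
  unfolding subfield_set_def subring_set_def
proof (intro conjI ballI)
  note cl = subring_set_closed[OF R]
  show "1 \<in> ?Q" using cl(3) by (intro CollectI exI[of _ 1]) auto
  fix z assume z: "z \<in> ?Q"
  then obtain a b where ab: "z = a / b" "a \<in> R" "b \<in> R" "b \<noteq> 0" by auto
  show "inverse z \<in> ?Q"
  proof (cases "a = 0")
    case True
    then show ?thesis using z ab by simp
  next
    case False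
    then show ?thesis using ab by (intro CollectI exI[of _ b] exI[of _ a]) auto
  qed
  fix w assume "w \<in> ?Q"
  then obtain c d where cd: "w = c / d" "c \<in> R" "d \<in> R" "d \<noteq> 0" by auto
  have "z - w = (a * d - c * b) / (b * d)" using ab cd by (simp add: field_simps)
  then show "z - w \<in> ?Q" using ab cd
    by (intro CollectI exI[of _ "a * d - c * b"] exI[of _ "b * d"]) (auto intro!: cl)
  have "z * w = (a * c) / (b * d)" using ab cd by simp
  then show "z * w \<in> ?Q" using ab cd
    by (intro CollectI exI[of _ "a * c"] exI[of _ "b * d"]) (auto intro!: cl)
qed

lemma adjoin_rational_function:
  assumes K: "subfield_set K" and z: "z \<in> adjoin K {x}"
  obtains A B where "A \<in> polys_over K" "B \<in> polys_over K" "poly B x \<noteq> 0" "z = poly A x / poly B x"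
proof -
  note R = subfield_setD[OF K]
  let ?R = "(\<lambda>p. poly p x) ` polys_over K"
  let ?Q = "{a / b | a b. a \<in> ?R \<and> b \<in> ?R \<and> b \<noteq> 0}"
  have R1: "1 \<in> ?R" using polys_over_1[OF R] by force
  have "a / 1 \<in> ?Q" if "a \<in> ?R" for a using that R1 by (intro CollectI exI[of _ a] exI[of _ 1]) auto
  then have RQ: "?R \<subseteq> ?Q" by auto
  have "K \<subseteq> ?R"
  proof
    fix c assume "c \<in> K"
    then have "[:c:] \<in> polys_over K" by (intro polys_over_pCons[OF R] polys_over_0[OF R])
    then show "c \<in> ?R" by (intro image_eqI[of _ _ "[:c:]"]) auto
  qed
  moreover have "[:0, 1:] \<in> polys_over K"
    by (intro polys_over_pCons[OF R] polys_over_0[OF R] subring_set_zero[OF R] subring_set_one[OF R])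
  then have "x \<in> ?R" by (intro image_eqI[of _ _ "[:0, 1:]"]) auto
  ultimately have "K \<union> {x} \<subseteq> ?Q" using RQ by blast
  then have "adjoin K {x} \<subseteq> ?Q"
    by (intro adjoin_minimal subfield_set_fractions subring_set_poly_image[OF R])
  then show ?thesis using z that by blast
qed

text \<open>Allows \<open>x\<close> to be replaced by its inverse when \<open>x\<close> is not in
  the valuation ring.\<close>

lemma adjoin_inverse: "adjoin K {inverse x} = adjoin K {x}"
proof -
  have "adjoin K {inverse x} \<subseteq> adjoin K {x}" for x
    using adjoin_subset[of K "{x}"] subfield_set_inverse[OF subfield_set_adjoin[of K "{x}"], of x]
    by (intro adjoin_minimal subfield_set_adjoin) auto
  from this[of x] this[of "inverse x"] show ?thesis by auto
qed

text \<open>\<open>d\<close> only bounds the degree: the coefficient of \<open>z ^ d\<close> may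
  vanish.\<close>

definition algebraic_of_degree :: "'a::field set \<Rightarrow> nat \<Rightarrow> 'a \<Rightarrow> bool" where
  "algebraic_of_degree k d z \<longleftrightarrow>
     (\<exists>l. (\<forall>j\<le>d. l j \<in> k) \<and> (\<exists>j\<le>d. l j \<noteq> 0) \<and> (\<Sum>j\<le>d. l j * z ^ j) = 0)"

context valued_field
begin

text \<open>In an algebraic relation for \<open>z\<close>, two nonzero terms must have the same valuation.\<close>

lemma power_associated:
  assumes k: "subfield_set k" "k \<subseteq> L" and z: "z \<in> L" "z \<noteq> 0" and alg: "algebraic_of_degree k d z"
  shows "\<exists>e\<in>{1..d}. \<exists>c\<in>k. c \<noteq> 0 \<and> unit_in V (z ^ e * c)"
proof -
  obtain l where l: "\<forall>j\<le>d. l j \<in> k" "\<exists>j\<le>d. l j \<noteq> 0" "(\<Sum>j\<le>d. l j * z ^ j) = 0"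
    using alg by (auto simp: algebraic_of_degree_def)
  define I where "I = {j. j \<le> d \<and> l j \<noteq> 0}"
  have "(\<Sum>j\<in>I. l j * z ^ j) = (\<Sum>j\<le>d. l j * z ^ j)"
    by (intro sum.mono_neutral_left) (auto simp: I_def)
  then have "\<exists>i\<in>I. \<exists>j\<in>I. i \<noteq> j \<and> unit_in V (l j * z ^ j / (l i * z ^ i))"
    using l z k by (intro vanishing_sum_associated) (auto simp: I_def intro!: L_closed)
  then obtain i j where ij: "i \<in> I" "j \<in> I" "i \<noteq> j" "unit_in V (l j * z ^ j / (l i * z ^ i))" by blast
  have *: ?thesis if "i \<in> I" "j \<in> I" "i < j" "unit_in V (l j * z ^ j / (l i * z ^ i))" for i j
  proof -
    have "z ^ j = z ^ (j - i) * z ^ i" using that by (simp flip: power_add)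
    then have "l j * z ^ j / (l i * z ^ i) = z ^ (j - i) * (l j / l i)" using z by simp
    moreover have "l j / l i \<in> k" using that l by (intro subfield_set_divide[OF k(1)]) (auto simp: I_def)
    ultimately show ?thesis using that
      by (intro bexI[of _ "j - i"] bexI[of _ "l j / l i"]) (auto simp: I_def)
  qed
  have "unit_in V (l i * z ^ i / (l j * z ^ j))" using unit_in_inverse[OF ij(4)] by simp
  then show ?thesis using *[of i j] *[of j i] ij by (cases "i < j") auto
qed

lemma poly_in_V: "p \<in> polys_over K \<Longrightarrow> u \<in> V \<Longrightarrow> poly p u \<in> V"
  using poly_polys_over_in[OF subfield_setD[OF K]] K_sub_V V_subring by blast

text \<open>Discreteness on K(x). Let \<open>u\<close> be whichever of \<open>x\<close> and its
  inverse lies in \<open>V\<close>. A polynomial of least degree whose value at \<open>u\<close> is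
  a nonzero nonunit acts as the prime: remainders modulo it vanish at \<open>u\<close> or are units
  there, so repeated division yields the order.\<close>

lemma exists_parameter:
  assumes x: "x \<in> L" and alg: "\<And>z. z \<in> L \<Longrightarrow> algebraic_of_degree (adjoin K {x}) d z"
  shows "\<exists>\<pi>\<in>nonunits V. \<pi> \<noteq> 0 \<and>
    (\<forall>c\<in>adjoin K {x}. c \<noteq> 0 \<longrightarrow> (\<exists>r u. unit_in V u \<and> c = \<pi> powi r * u))"
proof -
  note R = subfield_setD[OF K]
  obtain u where u: "u \<in> V" "adjoin K {x} = adjoin K {u}"
    using V_cases[OF x] adjoin_inverse[of K x] by metis
  have uL: "adjoin K {u} \<subseteq> L" using u V_sub_L K_sub_V by (intro adjoin_minimal L) auto
  have "\<exists>p. p \<in> polys_over K \<and> poly p u \<in> nonunits V \<and> poly p u \<noteq> 0"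
  proof (rule ccontr)
    \<comment> \<open>If all nonzero polynomial values were units, so would be all nonzero elements
      of K(x); then every \<open>z\<close> in \<open>L\<close> would have a power in
      \<open>V\<close>, so \<open>V = L\<close>.\<close>
    assume "\<nexists>p. p \<in> polys_over K \<and> poly p u \<in> nonunits V \<and> poly p u \<noteq> 0"
    then have unit: "unit_in V (poly p u)" if "p \<in> polys_over K" "poly p u \<noteq> 0" for p
      using that poly_in_V[OF that(1) u(1)] by (auto simp: nonunits_iff)
    have unitk: "unit_in V c" if "c \<in> adjoin K {u}" "c \<noteq> 0" for c
      using adjoin_rational_function[OF K that(1)] that(2) unit unit_in_divide
      by (metis divide_eq_0_iff)
    obtain z where z: "z \<in> L" "z \<notin> V" using V_sub_L V_neq_L by blast
    have z0: "z \<noteq> 0" using z V_closed(4) by auto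
    obtain e c where ec: "e \<in> {1..d}" "c \<in> adjoin K {u}" "c \<noteq> 0" "unit_in V (z ^ e * c)"
      using power_associated[OF subfield_set_adjoin uL z(1) z0 alg[OF z(1), unfolded u(2)]] by blast
    have "unit_in V ((z ^ e * c) / c)" by (intro unit_in_divide ec unitk)
    then have "z ^ e \<in> V" using ec by (simp add: unit_in_def)
    then show False using power_in_V[of z e] ec z by auto
  qed
  then obtain p where p: "p \<in> polys_over K" "poly p u \<in> nonunits V" "poly p u \<noteq> 0"
    and min: "\<And>r. r \<in> polys_over K \<Longrightarrow> poly r u \<in> nonunits V \<Longrightarrow> poly r u \<noteq> 0 \<Longrightarrow> degree p \<le> degree r"
    using ex_has_least_nat[of "\<lambda>p. p \<in> polys_over K \<and> poly p u \<in> nonunits V \<and> poly p u \<noteq> 0" _ degree]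
    by blast
  have p0: "p \<noteq> 0" using p by auto
  have dp: "degree p > 0"
  proof (rule ccontr)
    assume "\<not> degree p > 0"
    then obtain c where c: "p = [:c:]" using degree_eq_zeroE by blast
    then have "c \<in> K" "c \<noteq> 0" using coeff_polys_over[OF p(1), of 0] p by auto
    then show False using unit_in_K p c by (auto simp: nonunits_iff)
  qed
  have val: "\<exists>r w. unit_in V w \<and> poly A u = poly p u ^ r * w"
    if "A \<in> polys_over K" "poly A u \<noteq> 0" for A
    using that
  proof (induction "degree A" arbitrary: A rule: less_induct)
    case less
    obtain s r where sr: "s \<in> polys_over K" "r \<in> polys_over K" "A = p * s + r" "r = 0 \<or> degree r < degree p"
      using polys_over_div_mod[OF K less.prems(1) p(1) p0] by blast
    have Au: "poly A u = poly r u + poly s u * poly p u" using sr(3) by (simp add: algebra_simps)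
    show ?case
    proof (cases "poly r u = 0")
      case True
      then have su: "poly s u \<noteq> 0" using less.prems(2) Au by auto
      then have s0: "s \<noteq> 0" by auto
      have "degree A = degree (p * s)" unfolding sr(3)
      proof (cases "r = 0")
        case False
        then have "degree r < degree (p * s)" using sr(4) p0 s0 by (simp add: degree_mult_eq)
        then show "degree (p * s + r) = degree (p * s)" by (rule degree_add_eq_left)
      qed simp
      then have "degree s < degree A" using p0 s0 dp by (simp add: degree_mult_eq)
      then obtain m w where "unit_in V w" "poly s u = poly p u ^ m * w"
        using less.hyps[OF _ sr(1) su] by blast
      then show ?thesis using True Au by (intro exI[of _ "Suc m"] exI[of _ w]) (auto simp: mult_ac)
    next
      case False
      then have "degree r < degree p" using sr(4) by auto
      then have "poly r u \<notin> nonunits V" using min[OF sr(2) _ False] by auto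
      then have "unit_in V (poly r u)" using poly_in_V[OF sr(2) u(1)] by (simp add: nonunits_iff)
      then have "unit_in V (poly A u)" unfolding Au
        by (intro unit_in_add_nonunit nonunits_mult poly_in_V sr u p)
      then show ?thesis by (intro exI[of _ 0] exI[of _ "poly A u"]) auto
    qed
  qed
  have "\<exists>r w. unit_in V w \<and> c = poly p u powi r * w" if c: "c \<in> adjoin K {u}" "c \<noteq> 0" for c
  proof -
    obtain A B where AB: "A \<in> polys_over K" "B \<in> polys_over K" "poly B u \<noteq> 0" "c = poly A u / poly B u"
      using adjoin_rational_function[OF K c(1)] .
    obtain m w where 1: "unit_in V w" "poly A u = poly p u ^ m * w" using val[OF AB(1)] c(2) AB by auto
    obtain m' w' where 2: "unit_in V w'" "poly B u = poly p u ^ m' * w'" using val[OF AB(2,3)] by auto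
    have "c = poly p u powi (int m - int m') * (w / w')" unfolding AB(4) 1(2) 2(2) using p(3)
      by (simp add: power_int_diff)
    then show ?thesis using unit_in_divide[OF 1(1) 2(1)] by blast
  qed
  then show ?thesis unfolding u(2) using p by blast
qed

text \<open>The map \<open>r\<close> with \<open>z\<^sup>d\<^sup>! = \<pi>\<^sup>r * unit\<close> identifies the value group with a subgroup of \<open>\<int>\<close>.\<close>

lemma algebraic_imp_uniformizer:
  assumes x: "x \<in> L" and alg: "\<And>z. z \<in> L \<Longrightarrow> algebraic_of_degree (adjoin K {x}) d z"
  shows "\<exists>t. uniformizer L V t"
proof -
  obtain \<pi> where \<pi>: "\<pi> \<in> nonunits V" "\<pi> \<noteq> 0"
    and kval: "\<And>c. c \<in> adjoin K {x} \<Longrightarrow> c \<noteq> 0 \<Longrightarrow> \<exists>r u. unit_in V u \<and> c = \<pi> powi r * u"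
    using exists_parameter[OF assms] by blast
  have xL: "adjoin K {x} \<subseteq> L" using x V_sub_L K_sub_V by (intro adjoin_minimal L) auto
  define P where "P z r \<longleftrightarrow> (\<exists>u. unit_in V u \<and> z ^ fact d = \<pi> powi r * u)" for z r
  have exP: "\<exists>r. P z r" if z: "z \<in> L" "z \<noteq> 0" for z
  proof -
    obtain e c where ec: "e \<in> {1..d}" "c \<in> adjoin K {x}" "c \<noteq> 0" "unit_in V (z ^ e * c)"
      using power_associated[OF subfield_set_adjoin xL z alg[OF z(1)]] by blast
    obtain r u where u: "unit_in V u" "c = \<pi> powi r * u" using kval ec by blast
    \<comment> \<open>Every exponent \<open>e \<le> d\<close> divides \<open>fact d\<close>, so a
      single power serves all \<open>z\<close>; this uses that \<open>d\<close> is the same for all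
      of them.\<close>
    have "e dvd fact d" using ec by (intro dvd_fact) auto
    then obtain m where m: "fact d = e * m" by (auto simp: dvd_def)
    define w where "w = (z ^ e * c) / u"
    have w: "unit_in V w" unfolding w_def using ec u by (intro unit_in_divide)
    have "z ^ e = \<pi> powi (- r) * w"
      unfolding w_def using u ec \<pi> by (simp add: power_int_minus unit_in_def field_simps)
    then have "z ^ fact d = (\<pi> powi (- r) * w) ^ m" using m by (simp add: power_mult)
    also have "\<dots> = \<pi> powi (- r * int m) * w ^ m"
      by (simp only: power_mult_distrib power_int_mult power_int_of_nat)
    finally show ?thesis using unit_in_power[OF w] unfolding P_def by blast
  qed
  have Pmult: "P (z * w) (r + s)" if "P z r" "P w s" for z w r s
  proof -
    obtain u u' where "unit_in V u" "z ^ fact d = \<pi> powi r * u" "unit_in V u'" "w ^ fact d = \<pi> powi s * u'"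
      using \<open>P z r\<close> \<open>P w s\<close> by (auto simp: P_def)
    then show ?thesis using \<pi> unfolding P_def
      by (intro exI[of _ "u * u'"]) (auto simp: unit_in_mult power_mult_distrib power_int_add mult_ac)
  qed
  have Ppowi: "P (z powi k) (k * r)" if "P z r" for z k r
  proof -
    obtain u where u: "unit_in V u" "z ^ fact d = \<pi> powi r * u" using \<open>P z r\<close> by (auto simp: P_def)
    have "(z powi k) ^ fact d = (z ^ fact d) powi k"
      by (simp only: power_int_mult[symmetric] power_int_of_nat[symmetric] mult.commute[of k])
    also have "\<dots> = \<pi> powi (k * r) * u powi k"
      by (simp only: u(2) power_int_mult_distrib power_int_mult mult.commute[of k])
    finally show ?thesis using unit_in_powi[OF u(1)] unfolding P_def by blast
  qed
  have Punit: "unit_in V z" if "P z 0" "z \<in> L" "z \<noteq> 0" for z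
  proof -
    have "unit_in V (z ^ fact d)" using that by (auto simp: P_def)
    then have "z ^ fact d \<in> V" "inverse z ^ fact d \<in> V" by (auto simp: unit_in_def power_inverse)
    then show ?thesis using power_in_V[of z "fact d"] power_in_V[of "inverse z" "fact d"] that L_closed(8)[of z]
      by (auto simp: unit_in_def)
  qed
  have "\<pi> \<in> L" using \<pi> V_sub_L by (auto simp: nonunits_def)
  have "P \<pi> (int (fact d))" unfolding P_def by (intro exI[of _ 1]) (auto simp: unit_in_1 simp del: of_nat_fact)
  \<comment> \<open>The least positive exponent \<open>n\<close> will generate all exponents;
    \<open>\<pi>\<close> itself shows that positive ones occur.\<close>
  then have "\<exists>n t. n > 0 \<and> t \<in> L \<and> t \<noteq> 0 \<and> P t (int n)" using \<pi> \<open>\<pi> \<in> L\<close> fact_gt_zero by blast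
  then obtain n where "\<exists>t. n > 0 \<and> t \<in> L \<and> t \<noteq> 0 \<and> P t (int n)"
    and min: "\<And>m. m < n \<Longrightarrow> \<not> (\<exists>t. m > 0 \<and> t \<in> L \<and> t \<noteq> 0 \<and> P t (int m))"
    using exists_least_iff[of "\<lambda>n. \<exists>t. n > 0 \<and> t \<in> L \<and> t \<noteq> 0 \<and> P t (int n)"] by blast
  then obtain t where t: "n > 0" "t \<in> L" "t \<noteq> 0" "P t (int n)" by blast
  obtain u where u: "unit_in V u" "t ^ fact d = \<pi> powi int n * u" using t by (auto simp: P_def)
  have "u * \<pi> ^ (n - 1) \<in> V" using u \<pi> by (intro V_closed) (auto simp: unit_in_def nonunits_def)
  then have "(u * \<pi> ^ (n - 1)) * \<pi> \<in> nonunits V" using \<pi> by (intro nonunits_mult)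
  also have "(u * \<pi> ^ (n - 1)) * \<pi> = t ^ fact d" unfolding u(2) using t(1)
    by (cases n) (simp_all add: mult_ac power_int_of_nat del: of_nat_Suc)
  finally have tn: "t ^ fact d \<in> nonunits V" .
  then have "t \<in> V" using power_in_V[of t "fact d"] t by (auto simp: nonunits_def)
  then have "t \<in> nonunits V" using nonunits_power_cancel tn by blast
  moreover have "\<exists>k u. unit_in V u \<and> z = t powi k * u" if z: "z \<in> L" "z \<noteq> 0" for z
  proof -
    obtain s where s: "P z s" using exP z by blast
    \<comment> \<open>Division of the exponent of \<open>z\<close> by \<open>n\<close>: the
      remainder belongs to \<open>w\<close> and vanishes by minimality of \<open>n\<close>.\<close>
    define k where "k = s div int n"
    define w where "w = z * t powi (- k)"
    have wL: "w \<in> L" "w \<noteq> 0" using z t by (auto simp: w_def intro!: L_closed)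
    have "P w (s + - k * int n)" unfolding w_def using Pmult[OF s Ppowi[OF t(4)]] .
    moreover have "s + - k * int n = s mod int n" by (simp add: k_def minus_div_mult_eq_mod)
    ultimately have Pw: "P w (s mod int n)" by simp
    have "s mod int n = 0"
    proof (rule ccontr)
      assume "s mod int n \<noteq> 0"
      then have "nat (s mod int n) > 0" "nat (s mod int n) < n" "int (nat (s mod int n)) = s mod int n"
        using t(1) pos_mod_sign[of "int n" s] pos_mod_bound[of "int n" s] by linarith+
      then show False using min[of "nat (s mod int n)"] wL Pw by auto
    qed
    then have "unit_in V w" using Punit Pw wL by simp
    moreover have "z = t powi k * w" using t by (simp add: w_def power_int_minus)
    ultimately show ?thesis by blast
  qed
  ultimately show ?thesis using t unfolding uniformizer_def by blast
qed

end

section \<open>Existence of valuation rings\<close>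

text \<open>The relation in \<open>inverse z\<close>, multiplied by \<open>z ^ n\<close>, reads
  \<open>z ^ n * (inverse \<pi> - b) = poly S z\<close> with \<open>degree S < n\<close>.
  Multiplying the relation in \<open>z\<close> by \<open>1 - \<pi> * b\<close> therefore turns its
  leading term \<open>c * z ^ n\<close> into \<open>\<pi> * c * poly S z\<close> and its value into
  \<open>inverse \<pi> - b\<close>; adding \<open>b\<close> gives \<open>p'\<close>.\<close>

lemma inverse_elimination_step:
  fixes V :: "'a::field set"
  assumes V: "subring_set V" and \<pi>: "\<pi> \<in> V" "\<pi> \<noteq> 0" "inverse \<pi> \<notin> V" and z: "z \<noteq> 0"
    and p: "p \<in> polys_over V" "inverse \<pi> = poly p z" and r: "r \<in> polys_over V" "inverse \<pi> = poly r (inverse z)"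
    and le: "degree r \<le> degree p"
  shows "\<exists>p'\<in>polys_over V. inverse \<pi> = poly p' z \<and> degree p' < degree p"
proof -
  define n where "n = degree p"
  define c where "c = coeff p n"
  define b where "b = coeff r 0"
  define S where "S = (\<Sum>i=1..degree r. monom (coeff r i) (n - i))"
  define p' where "p' = [:b:] + smult (1 - \<pi> * b) (p - monom c n) + smult (\<pi> * c) S"
  have cb: "c \<in> V" "b \<in> V" using p r by (auto simp: c_def b_def polys_over_def)
  have n0: "n > 0"
  proof (rule ccontr)
    assume "\<not> n > 0"
    then have "degree p = 0" by (simp add: n_def)
    then obtain a where "p = [:a:]" by (rule degree_eq_zeroE)
    then have "inverse \<pi> = a" "a \<in> V" using p coeff_polys_over[OF p(1), of 0] by auto
    then show False using \<pi> by simp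
  qed
  have "S \<in> polys_over V" unfolding S_def
    using r by (intro polys_over_sum[OF V] polys_over_monom[OF V]) (auto simp: polys_over_def)
  then have "p' \<in> polys_over V" unfolding p'_def using p cb \<pi>
    by (intro polys_over_add[OF V] polys_over_smult[OF V] polys_over_minus[OF V] polys_over_monom[OF V]
        polys_over_pCons[OF V] polys_over_0[OF V] subring_set_closed[OF V])
  moreover have "inverse \<pi> = poly p' z"
  proof -
    have "inverse \<pi> = (\<Sum>i\<le>degree r. coeff r i * inverse z ^ i)" using r(2) by (simp add: poly_altdef)
    also have "\<dots> = b + (\<Sum>i=1..degree r. coeff r i * inverse z ^ i)"
      unfolding atMost_atLeast0 by (subst sum.atLeast_Suc_atMost) (auto simp: b_def)
    finally have "z ^ n * (inverse \<pi> - b) = (\<Sum>i=1..degree r. coeff r i * (z ^ n * inverse z ^ i))"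
      by (simp add: sum_distrib_left algebra_simps)
    also have "\<dots> = (\<Sum>i=1..degree r. coeff r i * z ^ (n - i))"
    proof (intro sum.cong refl)
      fix i assume "i \<in> {1..degree r}"
      then have "n = (n - i) + i" using le by (auto simp: n_def)
      then have "z ^ n = z ^ (n - i) * z ^ i" by (metis power_add)
      then show "coeff r i * (z ^ n * inverse z ^ i) = coeff r i * z ^ (n - i)"
        using z by (simp add: power_inverse)
    qed
    also have "\<dots> = poly S z" unfolding S_def by (simp add: poly_sum poly_monom)
    finally have S: "poly S z = z ^ n * (inverse \<pi> - b)" ..
    have "poly p' z = b + (1 - \<pi> * b) * (inverse \<pi> - c * z ^ n) + \<pi> * c * (z ^ n * (inverse \<pi> - b))"
      unfolding p'_def by (simp add: poly_monom p(2)[symmetric] S)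
    also have "\<dots> = inverse \<pi>" using \<pi>(2) by (simp add: field_simps)
    finally show ?thesis ..
  qed
  moreover have "degree p' < degree p"
  proof -
    have "degree (p - monom c n) \<le> n - 1"
    proof (rule degree_le, intro allI impI)
      fix i assume i: "i > n - 1"
      show "coeff (p - monom c n) i = 0"
        using i n0 by (cases "i = n") (auto simp: c_def n_def coeff_eq_0)
    qed
    moreover have "degree S \<le> n - 1" unfolding S_def
      by (intro degree_sum_le) (auto intro!: order_trans[OF degree_monom_le])
    ultimately have "degree p' \<le> n - 1" unfolding p'_def
      by (intro degree_add_le) (auto intro!: order_trans[OF degree_smult_le])
    then show ?thesis using n0 by (simp add: n_def)
  qed
  ultimately show ?thesis by blast
qed

text \<open>Descent: the elimination step lowers the larger of the two degrees, and it is symmetric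
  in \<open>z\<close> and \<open>inverse z\<close>.\<close>

lemma inverse_elimination:
  fixes V :: "'a::field set"
  assumes V: "subring_set V" and \<pi>: "\<pi> \<in> V" "\<pi> \<noteq> 0" "inverse \<pi> \<notin> V" and z: "z \<noteq> 0"
    and p: "p \<in> polys_over V" "inverse \<pi> = poly p z" and r: "r \<in> polys_over V" "inverse \<pi> = poly r (inverse z)"
  shows False
  using p r
proof (induction "degree p + degree r" arbitrary: p r rule: less_induct)
  case less
  show ?case
  proof (cases "degree r \<le> degree p")
    case True
    then obtain p' where "p' \<in> polys_over V" "inverse \<pi> = poly p' z" "degree p' < degree p"
      using inverse_elimination_step[OF V \<pi> z less.prems] by blast
    then show ?thesis using less.hyps[of p' r] less.prems by simp
  next
    case False
    then obtain r' where "r' \<in> polys_over V" "inverse \<pi> = poly r' (inverse z)" "degree r' < degree r"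
      using inverse_elimination_step[OF V \<pi>, of "inverse z" r p] less.prems z by auto
    then show ?thesis using less.hyps[of p r'] less.prems by simp
  qed
qed

text \<open>A subring that is maximal among those not containing \<open>1 / \<pi>\<close> is a valuation ring.\<close>

lemma exists_valuation_ring:
  fixes K R :: "'a::field set"
  assumes K: "subfield_set K" and R: "subring_set R" "K \<subseteq> R" and \<pi>: "\<pi> \<in> R" "\<pi> \<noteq> 0" "inverse \<pi> \<notin> R"
  shows "\<exists>V. valuation_ring K UNIV V \<and> R \<subseteq> V \<and> \<pi> \<in> nonunits V"
proof -
  define F where "F = {S. subring_set S \<and> R \<subseteq> S \<and> inverse \<pi> \<notin> S}"
  have "\<exists>M\<in>F. \<forall>X\<in>F. M \<subseteq> X \<longrightarrow> X = M"
  proof (rule subset_Zorn_nonempty)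
    show "F \<noteq> {}" using R \<pi> by (auto simp: F_def)
    fix C assume C: "C \<noteq> {}" "subset.chain F C"
    have CF: "C \<subseteq> F" using C(2) by (auto simp: subset.chain_def)
    have "subring_set (\<Union>C)" unfolding subring_set_def
    proof (intro conjI ballI)
      show "1 \<in> \<Union>C" using C CF by (auto simp: F_def subring_set_def)
      fix a b assume "a \<in> \<Union>C" "b \<in> \<Union>C"
      then obtain A B where AB: "A \<in> C" "B \<in> C" "a \<in> A" "b \<in> B" by blast
      then have "A \<subseteq> B \<or> B \<subseteq> A" using C(2) unfolding subset.chain_def by blast
      then obtain D where D: "D \<in> C" "a \<in> D" "b \<in> D" using AB by blast
      then have "subring_set D" using CF by (auto simp: F_def)
      then show "a - b \<in> \<Union>C" "a * b \<in> \<Union>C" using D subring_set_closed by blast+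
    qed
    then show "\<Union>C \<in> F" using C CF by (auto simp: F_def)
  qed
  then obtain V where VF: "V \<in> F" and max: "\<And>X. X \<in> F \<Longrightarrow> V \<subseteq> X \<Longrightarrow> X = V" by blast
  have V: "subring_set V" "R \<subseteq> V" "inverse \<pi> \<notin> V" using VF by (auto simp: F_def)
  \<comment> \<open>For \<open>z\<close> outside \<open>V\<close> the ring generated by
    \<open>V\<close> and \<open>z\<close> is strictly larger, so by maximality it contains
    \<open>inverse \<pi>\<close>.\<close>
  have ext: "\<exists>p\<in>polys_over V. inverse \<pi> = poly p z" if z: "z \<notin> V" for z
  proof (rule ccontr)
    assume "\<not> ?thesis"
    then have nin: "inverse \<pi> \<notin> (\<lambda>p. poly p z) ` polys_over V" by auto
    have sub: "V \<subseteq> (\<lambda>p. poly p z) ` polys_over V"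
    proof
      fix c assume "c \<in> V"
      then have "[:c:] \<in> polys_over V" by (intro polys_over_pCons[OF V(1)] polys_over_0[OF V(1)])
      then show "c \<in> (\<lambda>p. poly p z) ` polys_over V" by (intro image_eqI[of _ _ "[:c:]"]) auto
    qed
    have "[:0, 1:] \<in> polys_over V"
      by (intro polys_over_pCons[OF V(1)] polys_over_0[OF V(1)] subring_set_closed[OF V(1)])
    then have zin: "z \<in> (\<lambda>p. poly p z) ` polys_over V" by (intro image_eqI[of _ _ "[:0, 1:]"]) auto
    have "(\<lambda>p. poly p z) ` polys_over V \<in> F"
      using nin sub V subring_set_poly_image[OF V(1), of z] by (auto simp: F_def)
    then have "(\<lambda>p. poly p z) ` polys_over V = V" using max sub by blast
    then show False using z zin by simp
  qed
  have "z \<in> V \<or> inverse z \<in> V" for z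
  proof (rule ccontr)
    assume *: "\<not> (z \<in> V \<or> inverse z \<in> V)"
    then have "z \<noteq> 0" using subring_set_zero[OF V(1)] by auto
    then show False using ext[of z] ext[of "inverse z"] * inverse_elimination[OF V(1) _ \<pi>(2) V(3), of z] \<pi> V
      by blast
  qed
  moreover have "K \<noteq> V" using V \<pi> subfield_set_inverse[OF K, of \<pi>] by auto
  moreover have "V \<noteq> UNIV" using V by auto
  ultimately have "valuation_ring K UNIV V" using V R by (auto simp: valuation_ring_def)
  then show ?thesis using V \<pi> by (auto simp: nonunits_def)
qed

section \<open>Finite fields\<close>

lemma finite_subfield_power_eq_1:
  fixes K :: "'a::field set"
  assumes K: "subfield_set K" "finite K" and a: "a \<in> K" "a \<noteq> 0"
  shows "a ^ (card K - 1) = 1"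
proof -
  note cl = subfield_set_closed[OF K(1)]
  have bij: "bij_betw ((*) a) (K - {0}) (K - {0})"
    by (rule bij_betw_byWitness[where f' = "(*) (inverse a)"]) (use a cl in auto)
  have "(\<Prod>b\<in>K - {0}. b) = (\<Prod>b\<in>K - {0}. a * b)"
    using prod.reindex_bij_betw[OF bij, of "\<lambda>b. b"] by simp
  also have "\<dots> = a ^ card (K - {0}) * (\<Prod>b\<in>K - {0}. b)" by (simp add: prod.distrib)
  finally have "a ^ card (K - {0}) = 1" using K(2) by simp
  then show ?thesis using K(2) cl(4) by (simp add: card_Diff_singleton)
qed

lemma card_roots_of_unity_le:
  fixes K :: "'a::field set"
  assumes "M > 0"
  shows "finite {a \<in> K. a ^ M = 1}" "card {a \<in> K. a ^ M = 1} \<le> M"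
proof -
  define p where "p = monom (1::'a) M - 1"
  have d: "degree p = M" unfolding p_def diff_conv_add_uminus using assms
    by (subst degree_add_eq_left) (auto simp: degree_monom_eq)
  have p: "p \<noteq> 0" using d assms by auto
  have sub: "{a \<in> K. a ^ M = 1} \<subseteq> {a. poly p a = 0}" by (auto simp: p_def poly_monom)
  show "finite {a \<in> K. a ^ M = 1}" using finite_subset[OF sub poly_roots_finite[OF p]] .
  have "card {a \<in> K. a ^ M = 1} \<le> card {a. poly p a = 0}" by (intro card_mono poly_roots_finite p sub)
  also have "\<dots> \<le> M" using card_poly_roots_bound[OF p] d by simp
  finally show "card {a \<in> K. a ^ M = 1} \<le> M" .
qed

text \<open>The cofactor of \<open>X\<^sup>M - 1\<close> in \<open>X\<^sup>M\<^sup>L - 1\<close> is too small to absorb further roots.\<close>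

lemma card_roots_of_unity:
  fixes K :: "'a::field set"
  assumes K: "subfield_set K" "finite K" and M: "card K - 1 = M * L" "M > 0" "L > 0"
  shows "card {a \<in> K. a ^ M = 1} = M"
proof (rule antisym)
  show "card {a \<in> K. a ^ M = 1} \<le> M" using card_roots_of_unity_le(2)[OF M(2)] .
  define g where "g = (\<Sum>i<L. monom (1::'a) (M * i))"
  have gv: "poly g a = (\<Sum>i<L. (a ^ M) ^ i)" for a by (simp add: g_def poly_sum poly_monom power_mult)
  have dg: "degree g \<le> M * (L - 1)" unfolding g_def
    by (intro degree_sum_le) (auto intro!: order_trans[OF degree_monom_le] mult_le_mono)
  have "poly g 0 = (\<Sum>i<L. 0 ^ i)" using M(2) by (simp add: gv zero_power)
  also have "\<dots> = 1" using M(3) by (subst sum.remove[of _ 0]) (auto simp: power_0_left)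
  finally have g: "g \<noteq> 0" by auto
  have sub: "K - {0} \<subseteq> {a \<in> K. a ^ M = 1} \<union> {a. poly g a = 0}"
  proof
    fix a assume a: "a \<in> K - {0}"
    have "(a ^ M) ^ L = 1" using finite_subfield_power_eq_1[OF K, of a] a M(1) by (simp add: power_mult)
    then have "(a ^ M - 1) * poly g a = 0" unfolding gv using power_diff_1_eq[of "a ^ M" L] by simp
    then show "a \<in> {a \<in> K. a ^ M = 1} \<union> {a. poly g a = 0}" using a by auto
  qed
  have "M * L = card (K - {0})" using M(1) K subfield_set_closed(4)[OF K(1)] by (simp add: card_Diff_singleton)
  also have "\<dots> \<le> card ({a \<in> K. a ^ M = 1} \<union> {a. poly g a = 0})"
    using card_roots_of_unity_le(1)[OF M(2)] poly_roots_finite[OF g] by (intro card_mono sub) auto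
  also have "\<dots> \<le> card {a \<in> K. a ^ M = 1} + card {a. poly g a = 0}" by (rule card_Un_le)
  also have "\<dots> \<le> card {a \<in> K. a ^ M = 1} + M * (L - 1)" using card_poly_roots_bound[OF g] dg by simp
  finally show "M \<le> card {a \<in> K. a ^ M = 1}" using M by (cases L) auto
qed

text \<open>Multiplication by a root of unity \<open>b\<close> with \<open>b ^ k \<noteq> 1\<close>
  permutes the summands and scales the sum by \<open>b ^ k\<close>. Such a \<open>b\<close> exists,
  since otherwise all \<open>M\<close> roots of unity would satisfy
  \<open>a ^ (k mod M) = 1\<close>, an equation of degree less than \<open>M\<close>.\<close>

lemma sum_roots_of_unity_power:
  fixes K :: "'a::field set"
  assumes K: "subfield_set K" and M: "card {a \<in> K. a ^ M = 1} = M" "M > 0" and k: "\<not> M dvd k"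
  shows "(\<Sum>a | a \<in> K \<and> a ^ M = 1. a ^ k) = 0"
proof -
  note cl = subfield_set_closed[OF K]
  define U where "U = {a \<in> K. a ^ M = 1}"
  have "\<exists>b\<in>U. b ^ k \<noteq> 1"
  proof (rule ccontr)
    assume H: "\<not> ?thesis"
    have "k mod M > 0" using k by (simp add: dvd_eq_mod_eq_0)
    have "a ^ (k mod M) = 1" if "a \<in> U" for a
    proof -
      have "a ^ k = (a ^ M) ^ (k div M) * a ^ (k mod M)"
        by (simp add: power_mult[symmetric] power_add[symmetric])
      then show ?thesis using H that by (auto simp: U_def)
    qed
    then have "U \<subseteq> {a \<in> K. a ^ (k mod M) = 1}" by (auto simp: U_def)
    then have "card U \<le> card {a \<in> K. a ^ (k mod M) = 1}"
      using \<open>k mod M > 0\<close> by (intro card_mono card_roots_of_unity_le(1))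
    also have "\<dots> \<le> k mod M" using \<open>k mod M > 0\<close> by (rule card_roots_of_unity_le(2))
    finally have "card U \<le> k mod M" .
    then show False using M mod_less_divisor[OF M(2), of k] by (simp add: U_def)
  qed
  then obtain b where b: "b \<in> U" "b ^ k \<noteq> 1" by blast
  have b0: "b \<noteq> 0" using b M by (auto simp: U_def zero_power)
  have bij: "bij_betw ((*) b) U U"
    by (rule bij_betw_byWitness[where f' = "(*) (inverse b)"])
      (use b b0 cl in \<open>auto simp: U_def power_mult_distrib power_inverse\<close>)
  have "(\<Sum>a\<in>U. a ^ k) = (\<Sum>a\<in>U. (b * a) ^ k)"
    using sum.reindex_bij_betw[OF bij, of "\<lambda>a. a ^ k"] by simp
  also have "\<dots> = b ^ k * (\<Sum>a\<in>U. a ^ k)" by (simp add: power_mult_distrib sum_distrib_left)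
  finally have "(1 - b ^ k) * (\<Sum>a\<in>U. a ^ k) = 0" by (simp add: algebra_simps)
  then show ?thesis using b by (simp add: U_def)
qed

text \<open>Adding 1 permutes \<open>K\<close>, yet it changes the sum of all elements by
  \<open>card K\<close>.\<close>

lemma of_nat_card_subfield:
  fixes K :: "'a::field set"
  assumes K: "subfield_set K" "finite K"
  shows "of_nat (card K) = (0::'a)"
proof -
  note cl = subfield_set_closed[OF K(1)]
  have bij: "bij_betw ((+) 1) K K"
    by (rule bij_betw_byWitness[where f' = "\<lambda>a. a - 1"]) (use cl in auto)
  have "sum id K = (\<Sum>a\<in>K. 1 + a)" using sum.reindex_bij_betw[OF bij, of id] by simp
  then show ?thesis by (simp add: sum.distrib)
qed

lemma CHAR_subfield:
  fixes K :: "'a::field set"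
  assumes K: "subfield_set K" "card K = q ^ d" and q: "q = p ^ e" "prime p" and pos: "e > 0" "d > 0"
  shows "CHAR('a) = p"
proof -
  have "card K > 0" using K(2) q pos by (simp add: prime_gt_0_nat)
  then have "finite K" by (simp add: card_gt_0_iff)
  then have "CHAR('a) dvd card K" using of_nat_card_subfield[OF K(1)] by (simp add: of_nat_eq_0_iff_char_dvd)
  then have dvd: "CHAR('a) dvd p ^ (e * d)" using K q by (simp add: power_mult)
  then have "CHAR('a) > 0" using q(2) by (intro Nat.gr0I) (auto simp: prime_gt_0_nat)
  then have "prime CHAR('a)" by (rule prime_CHAR_semidom)
  then show ?thesis using dvd q(2) by (metis prime_dvd_power primes_dvd_imp_eq)
qed

text \<open>The difference of the two polynomials has degree below \<open>card T\<close> and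
  vanishes on \<open>T\<close>.\<close>

lemma monic_eq_prod_roots:
  fixes p :: "'a::field poly"
  assumes T: "finite T" "\<And>c. c \<in> T \<Longrightarrow> poly p c = 0" and p: "degree p = card T" "lead_coeff p = 1"
  shows "p = (\<Prod>c\<in>T. [:- c, 1:])"
proof (rule ccontr)
  define g where "g = (\<Prod>c\<in>T. [:- c, 1:])"
  assume "p \<noteq> (\<Prod>c\<in>T. [:- c, 1:])"
  then have nz: "p - g \<noteq> 0" by (simp add: g_def)
  have dg: "degree g = card T" unfolding g_def by (subst degree_prod_sum_eq) auto
  have lg: "lead_coeff g = 1" unfolding g_def by (simp add: lead_coeff_prod)
  have le: "degree (p - g) \<le> card T" using p dg by (metis degree_diff_le order_refl)
  have "coeff (p - g) (card T) = 0" using p dg lg by simp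
  then have "degree (p - g) < card T" using le nz by (metis le_neq_implies_less leading_coeff_0_iff)
  moreover have "T \<subseteq> {c. poly (p - g) c = 0}" using T by (auto simp: g_def poly_prod)
  then have "card T \<le> card {c. poly (p - g) c = 0}" by (intro card_mono poly_roots_finite nz)
  ultimately show False using card_poly_roots_bound[OF nz] by simp
qed

text \<open>With \<open>g = X^q + X\<close> the Frobenius gives
  \<open>g^q - g = X^(q^2) - X\<close>, so \<open>g * (g^(q-1) - 1)\<close> is the product of all
  \<open>X - c\<close> with \<open>c\<close> in \<open>T\<close>. The roots of \<open>g\<close> make
  up \<open>A\<close>; hence the second factor has exactly the simple roots \<open>T - A\<close>,
  before the power \<open>q + 1\<close> is taken.\<close>

lemma GGS_polynomial_factorization:
  fixes K :: "'a::field set"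
  assumes K: "subfield_set K" "card K = q ^ (2 * n)" and q: "primepow q" and n: "n > 0"
    and A: "card {a \<in> K. a ^ q + a = 0} = q"
  defines "X \<equiv> [:0, 1:] :: 'a poly" and "A \<equiv> {a \<in> K. a ^ q + a = 0}" and "T \<equiv> {a \<in> K. a ^ (q ^ 2) = a}"
  shows "card T = q ^ 2" "A \<subseteq> T"
    "(X ^ q + X) * ((X ^ q + X) ^ (q - 1) - 1) ^ (q + 1) = (\<Prod>c\<in>T. [:- c, 1:] ^ (if c \<in> A then 1 else q + 1))"
proof -
  note cl = subfield_set_closed[OF K(1)]
  obtain p e where pe: "prime p" "e > 0" "q = p ^ e" using q by (auto simp: primepow_def)
  have q2: "q \<ge> 2" using primepow_gt_Suc_0[OF q] by simp
  have fin: "finite K" using K(2) q2 by (intro card_ge_0_finite) simp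
  have "CHAR('a) = p" using CHAR_subfield[OF K pe(3,1,2)] n by simp
  then have CH: "CHAR('a poly) = p" "prime p" using pe by auto
  have frob: "(a + b) ^ q = a ^ q + b ^ q" for a b :: "'a poly"
    by (rule freshmans_dream'[where n = e]) (simp_all add: CH pe(3) del: semiring_char_poly)
  define g where "g = X ^ q + X"
  have X: "X = monom 1 1" by (simp add: X_def monom_altdef)
  have Xk: "X ^ k = monom 1 k" for k by (simp add: X monom_power)
  have finA: "finite A" "finite T" using fin by (auto simp: A_def T_def)
  have qq: "q ^ 2 \<ge> 2" using q2 by (metis le_trans power2_nat_le_imp_le self_le_power zero_less_numeral one_le_numeral order.trans)
  have dg: "degree g = q" "lead_coeff g = 1"
  proof -
    have g: "g = monom 1 q + monom 1 1" unfolding g_def Xk using X by simp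
    show "degree g = q" unfolding g using q2
      by (subst degree_add_eq_left) (auto simp: degree_monom_eq)
    then show "lead_coeff g = 1" using q2 by (simp add: g)
  qed
  have gA: "g = (\<Prod>c\<in>A. [:- c, 1:])"
    using dg A finA by (intro monic_eq_prod_roots) (auto simp: A_def g_def X_def)
  define h where "h = X ^ (q ^ 2) - X"
  have hg: "g * (g ^ (q - 1) - 1) = h"
  proof -
    have "g * (g ^ (q - 1) - 1) = g ^ q - g" using q2
      by (cases q) (auto simp: algebra_simps)
    also have "g ^ q = X ^ (q ^ 2) + X ^ q" unfolding g_def frob
      by (simp add: power_mult[symmetric] power2_eq_square)
    finally show ?thesis by (simp add: g_def h_def)
  qed
  have dh: "degree h = q ^ 2" "lead_coeff h = 1"
  proof -
    have h: "h = monom 1 (q ^ 2) + - monom 1 1" unfolding h_def Xk using X by simp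
    show "degree h = q ^ 2" unfolding h using qq
      by (subst degree_add_eq_left) (auto simp: degree_monom_eq)
    then show "lead_coeff h = 1" using qq by (simp add: h)
  qed
  show cT: "card T = q ^ 2"
  proof -
    \<comment> \<open>Apart from 0, \<open>T\<close> consists of the roots of unity of order
      dividing \<open>q^2 - 1\<close>, and this divides
      \<open>card K - 1 = (q^2)^n - 1\<close>.\<close>
    define M where "M = q ^ 2 - 1"
    have M: "M > 0" using qq by (simp add: M_def)
    have "T = insert 0 {a \<in> K. a ^ M = 1}"
    proof -
      have "q ^ 2 = Suc M" using qq by (simp add: M_def)
      then have "a ^ (q ^ 2) = a * a ^ M" for a :: 'a by (metis power_Suc)
      then show ?thesis using cl(4) by (auto simp: T_def)
    qed
    moreover have "card {a \<in> K. a ^ M = 1} = M"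
    proof (rule card_roots_of_unity[OF K(1) fin _ M])
      have e: "card K = (q ^ 2) ^ n" using K(2) by (simp add: power_mult)
      have "int (card K - 1) = int (q ^ 2) ^ n - 1" unfolding e using qq by (simp add: of_nat_diff)
      also have "\<dots> = (int (q ^ 2) - 1) * (\<Sum>i<n. int (q ^ 2) ^ i)" by (rule power_diff_1_eq)
      also have "\<dots> = int (M * (\<Sum>i<n. (q ^ 2) ^ i))" using qq by (simp add: M_def of_nat_diff)
      finally show "card K - 1 = M * (\<Sum>i<n. (q ^ 2) ^ i)" using of_nat_eq_iff by blast
      show "(\<Sum>i<n. (q ^ 2) ^ i) > 0" using n q2 by (intro sum_pos) auto
    qed
    ultimately show ?thesis using M qq finA(2) by (simp add: M_def zero_power)
  qed
  have hT: "h = (\<Prod>c\<in>T. [:- c, 1:])"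
    using dh cT finA by (intro monic_eq_prod_roots) (auto simp: T_def h_def X_def)
  show AT: "A \<subseteq> T"
  proof
    fix c assume c: "c \<in> A"
    then have "poly g c = 0" by (auto simp: A_def g_def X_def)
    then have "poly h c = 0" unfolding hg[symmetric] by simp
    then show "c \<in> T" using c by (auto simp: A_def T_def h_def X_def)
  qed
  have "h = g * (\<Prod>c\<in>T - A. [:- c, 1:])" unfolding hT gA
    using prod.subset_diff[OF AT finA(2), of "\<lambda>c. [:- c, 1:]"] by (simp only: mult.commute)
  moreover have "g \<noteq> 0" using dg by auto
  ultimately have "g ^ (q - 1) - 1 = (\<Prod>c\<in>T - A. [:- c, 1:])"
    using hg mult_cancel_left[of g] by metis
  then have "g * (g ^ (q - 1) - 1) ^ (q + 1) = (\<Prod>c\<in>A. [:- c, 1:]) * (\<Prod>c\<in>T - A. [:- c, 1:] ^ (q + 1))"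
    unfolding gA[symmetric] by (simp only: prod_power_distrib)
  also have "\<dots> = (\<Prod>c\<in>A. [:- c, 1:] ^ (if c \<in> A then 1 else q + 1)) * (\<Prod>c\<in>T - A. [:- c, 1:] ^ (if c \<in> A then 1 else q + 1))"
    by (intro arg_cong2[where f = "(*)"] prod.cong) auto
  also have "\<dots> = (\<Prod>c\<in>T. [:- c, 1:] ^ (if c \<in> A then 1 else q + 1))"
    using prod.subset_diff[OF AT finA(2), of "\<lambda>c. [:- c, 1:] ^ (if c \<in> A then 1 else q + 1)"] by (simp only: mult.commute)
  finally show "(X ^ q + X) * ((X ^ q + X) ^ (q - 1) - 1) ^ (q + 1) =
      (\<Prod>c\<in>T. [:- c, 1:] ^ (if c \<in> A then 1 else q + 1))" by (simp only: g_def)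
qed

section \<open>The function field of the curve\<close>

locale GGS_curve =
  fixes K :: "'a::field set" and x y :: 'a and q n :: nat
  assumes q: "primepow q" and n: "n > 0"
    and K: "subfield_set K" "card K = q ^ (2 * n)"
    and x: "transcendental_over K x"
    and F: "adjoin K {x, y} = UNIV"
    and eq: "y ^ (q ^ n + 1) = (x ^ q + x) * ((x ^ q + x) ^ (q - 1) - 1) ^ (q + 1)"
    and card_roots: "card {a \<in> K. a ^ q + a = 0} = q"
begin

definition "Z = {a \<in> K. a ^ q + a = 0}"
definition "T = {a \<in> K. a ^ (q ^ 2) = a}"
text \<open>For \<open>c\<close> in \<open>T\<close>, the copy in \<open>K\<close> of the field with
  \<open>q^2\<close> elements, this is the multiplicity of \<open>x - c\<close> in the right-hand
  side of the curve equation.\<close>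

definition "e c = (if c \<in> Z then 1 else q + 1)" for c
definition "N = q ^ n + 1"
definition "t = inverse y"

abbreviation "k \<equiv> adjoin K {x}"

lemmas K_ring = subfield_setD[OF K(1)]
lemmas K_closed = subfield_set_closed[OF K(1)]
lemmas k_field = subfield_set_adjoin[of K "{x}"]
lemmas k_closed = subfield_set_closed[OF k_field]

lemma x_in_k: "x \<in> k" and K_sub_k: "K \<subseteq> k"
  using adjoin_subset[of K "{x}"] by auto

lemma q_ge_2: "q \<ge> 2" using primepow_gt_Suc_0[OF q] by simp

lemma finite_K: "finite K" using K(2) q_ge_2 by (intro card_ge_0_finite) simp

lemma N_pos: "N > 0" by (simp add: N_def)

lemma finite_T: "finite T" and T_sub: "T \<subseteq> K" and Z_sub_T: "Z \<subseteq> T" and card_T: "card T = q ^ 2"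
  and card_Z: "card Z = q"
  using GGS_polynomial_factorization(1,2)[OF K q n card_roots] finite_K card_roots
  by (auto simp: T_def Z_def)

lemma linear_polys_over: "c \<in> K \<Longrightarrow> [:- c, 1:] \<in> polys_over K"
  by (intro polys_over_pCons[OF K_ring] polys_over_0[OF K_ring] K_closed)

lemma poly_x_nonzero: "p \<in> polys_over K \<Longrightarrow> p \<noteq> 0 \<Longrightarrow> poly p x \<noteq> 0"
  using x by (auto simp: transcendental_over_def polys_over_def)

lemma x_minus_nonzero: "c \<in> K \<Longrightarrow> x - c \<noteq> 0"
  using poly_x_nonzero[OF linear_polys_over] by fastforce

lemma y_power: "y ^ N = (\<Prod>c\<in>T. (x - c) ^ e c)"
proof -
  have "y ^ N = poly (([:0, 1:] ^ q + [:0, 1:]) * (([:0, 1:] ^ q + [:0, 1:]) ^ (q - 1) - 1) ^ (q + 1)) x"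
    using eq by (simp add: N_def)
  also have "\<dots> = poly (\<Prod>c\<in>T. [:- c, 1:] ^ e c) x"
    unfolding GGS_polynomial_factorization(3)[OF K q n card_roots] T_def e_def Z_def by (rule refl)
  finally show ?thesis by (simp add: poly_prod)
qed

lemma y_nonzero: "y \<noteq> 0"
proof
  assume "y = 0"
  then have "(\<Prod>c\<in>T. (x - c) ^ e c) = 0" using y_power N_pos by (simp add: zero_power)
  then show False using x_minus_nonzero T_sub finite_T by (auto simp: subset_iff)
qed

lemma t_nonzero: "t \<noteq> 0" using y_nonzero by (simp add: t_def)

lemma t_power: "t ^ N \<in> k"
  unfolding t_def power_inverse y_power using x_in_k K_sub_k T_sub
  by (intro k_closed) auto

section \<open>The function field as a span of powers of \<open>t\<close> over K(x)\<close>

definition "span_t = {\<Sum>i<N. a i * t ^ i | a. \<forall>i. a i \<in> k}"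

lemma span_t_monomial: "a \<in> k \<Longrightarrow> a * t ^ m \<in> span_t"
proof -
  assume a: "a \<in> k"
  define c where "c i = (if i = m mod N then a * (t ^ N) ^ (m div N) else 0)" for i
  have "\<forall>i. c i \<in> k" using a t_power by (auto simp: c_def intro!: k_closed)
  moreover have "a * t ^ m = (\<Sum>i<N. c i * t ^ i)"
  proof -
    have "(\<Sum>i<N. c i * t ^ i) = (\<Sum>i\<in>{m mod N}. c i * t ^ i)"
      using N_pos by (intro sum.mono_neutral_right) (auto simp: c_def)
    also have "\<dots> = a * (t ^ (N * (m div N)) * t ^ (m mod N))" by (simp add: c_def power_mult mult.assoc)
    also have "t ^ (N * (m div N)) * t ^ (m mod N) = t ^ m" by (simp flip: power_add)
    finally show ?thesis ..
  qed
  ultimately show ?thesis unfolding span_t_def by blast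
qed

lemma span_t_minus: "z \<in> span_t \<Longrightarrow> w \<in> span_t \<Longrightarrow> z - w \<in> span_t"
proof -
  assume "z \<in> span_t" "w \<in> span_t"
  then obtain a b where ab: "\<forall>i. a i \<in> k" "\<forall>i. b i \<in> k" "z = (\<Sum>i<N. a i * t ^ i)" "w = (\<Sum>i<N. b i * t ^ i)"
    by (auto simp: span_t_def)
  have "z - w = (\<Sum>i<N. (a i - b i) * t ^ i)" by (simp add: ab left_diff_distrib sum_subtractf)
  moreover have "\<forall>i. a i - b i \<in> k" using ab by (auto intro!: k_closed)
  ultimately show ?thesis unfolding span_t_def by (intro CollectI exI[of _ "\<lambda>i. a i - b i"]) auto
qed

lemma span_t_subring: "subring_set span_t"
proof -
  have 0: "0 \<in> span_t" using span_t_monomial[of 0 0] k_closed(4) by simp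
  have add: "z + w \<in> span_t" if "z \<in> span_t" "w \<in> span_t" for z w
    using span_t_minus[OF that(1) span_t_minus[OF 0 that(2)]] by simp
  have sum: "sum f I \<in> span_t" if "\<And>i. i \<in> I \<Longrightarrow> f i \<in> span_t" for f and I :: "nat set"
    using that by (induction I rule: infinite_finite_induct) (auto simp: 0 add)
  have "z * w \<in> span_t" if "z \<in> span_t" "w \<in> span_t" for z w
  proof -
    obtain a b where ab: "\<forall>i. a i \<in> k" "\<forall>i. b i \<in> k" "z = (\<Sum>i<N. a i * t ^ i)" "w = (\<Sum>i<N. b i * t ^ i)"
      using \<open>z \<in> span_t\<close> \<open>w \<in> span_t\<close> by (auto simp: span_t_def)
    have "z * w = (\<Sum>i<N. \<Sum>j<N. (a i * b j) * t ^ (i + j))"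
      unfolding ab sum_product by (intro sum.cong refl) (simp add: power_add mult_ac)
    also have "\<dots> \<in> span_t" using ab by (intro sum span_t_monomial k_closed) auto
    finally show ?thesis .
  qed
  then show ?thesis using span_t_minus span_t_monomial[of 1 0] k_closed(3) by (auto simp: subring_set_def)
qed

text \<open>All powers of \<open>z\<close> lie in the span of \<open>N\<close> elements, so
  \<open>N + 1\<close> of them are dependent; the bound is the same for every
  \<open>z\<close>.\<close>

lemma span_t_algebraic: "z \<in> span_t \<Longrightarrow> algebraic_of_degree k N z"
proof -
  assume z: "z \<in> span_t"
  have "\<exists>c. (\<forall>i<N. c i \<in> k) \<and> z ^ j = (\<Sum>i<N. c i * t ^ i)" for j
    using subring_set_power[OF span_t_subring z, of j] by (auto simp: span_t_def)
  then show ?thesis unfolding algebraic_of_degree_def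
    using span_linear_dependence[OF k_field, of N "\<lambda>j. z ^ j" "\<lambda>i. t ^ i"] by blast
qed

text \<open>The algebraic relations put inverses into the ring \<open>span_t\<close>, which is thus
  a field containing \<open>x\<close> and \<open>y\<close>. Only spanning is obtained here;
  independence comes later, from orders.\<close>

lemma span_t_UNIV: "span_t = UNIV"
proof -
  have k_sub: "k \<subseteq> span_t" using span_t_monomial[of _ 0] by auto
  have "inverse z \<in> span_t" if z: "z \<in> span_t" for z
  proof (cases "z = 0")
    case False
    obtain l where "\<forall>j\<le>N. l j \<in> k" "\<exists>j\<le>N. l j \<noteq> 0" "(\<Sum>j\<le>N. l j * z ^ j) = 0"
      using span_t_algebraic[OF z] by (auto simp: algebraic_of_degree_def)
    then show ?thesis using inverse_in_of_relation[OF k_field span_t_subring k_sub z False] by blast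
  qed (use z in simp)
  then have fld: "subfield_set span_t" using span_t_subring by (auto simp: subfield_set_def)
  have "t \<in> span_t" using span_t_monomial[of 1 1] k_closed(3) by simp
  then have "y \<in> span_t" using subfield_set_inverse[OF fld, of t] by (simp add: t_def)
  then have "adjoin K {x, y} \<subseteq> span_t" using k_sub x_in_k K_sub_k
    by (intro adjoin_minimal fld) auto
  then show ?thesis using F by auto
qed

lemma decomposition: "\<exists>a. (\<forall>i. a i \<in> k) \<and> z = (\<Sum>i<N. a i * t ^ i)"
  using span_t_UNIV by (auto simp: span_t_def)

lemma discretely_valued: "valuation_ring K UNIV V \<Longrightarrow> discretely_valued_field K UNIV V"
proof -
  assume V: "valuation_ring K UNIV V"
  interpret valued_field K UNIV V using V K(1) subfield_set_UNIV by unfold_locales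
  have "\<exists>t. uniformizer UNIV V t"
    using span_t_algebraic span_t_UNIV by (intro algebraic_imp_uniformizer[of x N]) auto
  then show ?thesis by unfold_locales
qed

lemma discretely_valued_rational: "valuation_ring K k V \<Longrightarrow> discretely_valued_field K k V"
proof -
  assume V: "valuation_ring K k V"
  interpret valued_field K k V using V K(1) k_field by unfold_locales
  \<comment> \<open>Inside K(x) the relation \<open>- z + 1 * z = 0\<close> already has coefficients
    in the base field.\<close>
  have "algebraic_of_degree k 1 z" if "z \<in> k" for z unfolding algebraic_of_degree_def
    using that k_closed by (intro exI[of _ "\<lambda>j. if j = 0 then - z else 1"]) auto
  then have "\<exists>t. uniformizer k V t" using x_in_k by (intro algebraic_imp_uniformizer[of x 1]) auto
  then show ?thesis by unfold_locales
qed

section \<open>Existence of places and orders of rational functions in \<open>x\<close>\<close>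

abbreviation v :: "'a set \<Rightarrow> 'a \<Rightarrow> int" where "v V \<equiv> place_val K UNIV (nonunits V)"

text \<open>As \<open>u\<close> is transcendental, a nonconstant polynomial value is not invertible
  in \<open>K[u]\<close>, so \<open>exists_valuation_ring\<close> applies. Used for zeros of
  \<open>x - c\<close>, for zeros of a denominator and, with \<open>u = inverse x\<close>, for a
  pole of \<open>x\<close>.\<close>

lemma exists_valuation_ring_at:
  assumes u: "transcendental_over K u" and p: "p \<in> polys_over K" "degree p > 0"
  shows "\<exists>V. valuation_ring K UNIV V \<and> u \<in> V \<and> poly p u \<in> nonunits V"
proof -
  let ?R = "(\<lambda>p. poly p u) ` polys_over K"
  have R: "subring_set ?R" using subring_set_poly_image[OF K_ring] .
  have KR: "K \<subseteq> ?R"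
  proof
    fix c assume "c \<in> K"
    then have "[:c:] \<in> polys_over K" by (intro polys_over_pCons[OF K_ring] polys_over_0[OF K_ring])
    then show "c \<in> ?R" by (intro image_eqI[of _ _ "[:c:]"]) auto
  qed
  have "[:0, 1:] \<in> polys_over K" using linear_polys_over[of 0] K_closed(4) by simp
  then have uR: "u \<in> ?R" by (intro image_eqI[of _ _ "[:0, 1:]"]) auto
  have "p \<noteq> 0" using p(2) by auto
  then have pu: "poly p u \<noteq> 0" using u p by (auto simp: transcendental_over_def polys_over_def)
  have "inverse (poly p u) \<notin> ?R"
  proof
    assume "inverse (poly p u) \<in> ?R"
    then obtain r where r: "r \<in> polys_over K" "inverse (poly p u) = poly r u" by auto
    have "poly (p * r - 1) u = 0" using r(2) pu by (metis poly_diff poly_mult poly_1 right_inverse diff_self)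
    moreover have "p * r - 1 \<in> polys_over K"
      by (intro polys_over_minus[OF K_ring] polys_over_mult[OF K_ring] polys_over_1[OF K_ring] p r)
    moreover have "p * r - 1 \<noteq> 0"
    proof
      assume "p * r - 1 = 0"
      then have pr: "p * r = 1" by simp
      then have "degree (p * r) = 0" "p \<noteq> 0" "r \<noteq> 0" by auto
      then show False using p(2) by (simp add: degree_mult_eq)
    qed
    ultimately show False using u unfolding transcendental_over_def polys_over_def by blast
  qed
  then show ?thesis using exists_valuation_ring[OF K(1) R KR _ pu] p uR by blast
qed

lemma transcendental_inverse: "transcendental_over K (inverse x)"
  unfolding transcendental_over_def
proof (intro allI impI)
  fix p :: "'a poly" assume p: "p \<noteq> 0 \<and> (\<forall>i. coeff p i \<in> K)"
  have x0: "x \<noteq> 0" using x_minus_nonzero[of 0] K_closed(4) by simp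
  have "reflect_poly p \<in> polys_over K" using p K_closed(4) by (auto simp: polys_over_def coeff_reflect_poly)
  then have "poly (reflect_poly p) x \<noteq> 0" using p by (intro poly_x_nonzero) auto
  then show "poly p (inverse x) \<noteq> 0" using poly_reflect_poly_nz[OF x0, of p] by auto
qed

text \<open>The Bezout relation stays in the conclusion: at a zero of \<open>B\<close> where
  \<open>x\<close> is finite it makes \<open>A\<close> a unit, so the pole cannot be
  cancelled.\<close>

lemma rational_factorization:
  assumes c: "c \<in> k" "c \<noteq> 0"
  shows "\<exists>r :: 'a \<Rightarrow> int. \<exists>A\<in>polys_over K. \<exists>B\<in>polys_over K. \<exists>U\<in>polys_over K. \<exists>W\<in>polys_over K.
    c = (\<Prod>d\<in>T. (x - d) powi r d) * (poly A x / poly B x) \<and> U * A + W * B = 1 \<and> B \<noteq> 0 \<and> A \<noteq> 0 \<and>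
    (\<forall>d\<in>T. poly A d \<noteq> 0 \<and> poly B d \<noteq> 0)"
proof -
  obtain A0 B0 where 0: "A0 \<in> polys_over K" "B0 \<in> polys_over K" "poly B0 x \<noteq> 0" "c = poly A0 x / poly B0 x"
    using adjoin_rational_function[OF K(1) c(1)] .
  have "B0 \<noteq> 0" using 0 by auto
  then obtain A1 B1 U1 W1 where 1: "A1 \<in> polys_over K" "B1 \<in> polys_over K" "U1 \<in> polys_over K" "W1 \<in> polys_over K"
    "B1 \<noteq> 0" "U1 * A1 + W1 * B1 = 1" "A0 * B1 = A1 * B0"
    using polys_over_gcd[OF K(1) 0(1,2)] by metis
  have "poly A0 x * poly B1 x = poly A1 x * poly B0 x" using 1(7) by (metis poly_mult)
  then have c1: "c = poly A1 x / poly B1 x"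
    unfolding 0(4) using 0(3) poly_x_nonzero[OF 1(2,5)] by (simp add: frac_eq_eq)
  have A1: "A1 \<noteq> 0" using c c1 by auto
  obtain ra A where a: "A \<in> polys_over K" "A1 = (\<Prod>d\<in>T. [:- d, 1:] ^ ra d) * A" "\<forall>d\<in>T. poly A d \<noteq> 0"
    using polys_over_roots_factor[OF K(1) 1(1) A1 finite_T T_sub] by metis
  obtain rb B where b: "B \<in> polys_over K" "B1 = (\<Prod>d\<in>T. [:- d, 1:] ^ rb d) * B" "\<forall>d\<in>T. poly B d \<noteq> 0"
    using polys_over_roots_factor[OF K(1) 1(2,5) finite_T T_sub] by metis
  define Pa where "Pa = (\<Prod>d\<in>T. [:- d, 1:] ^ ra d)"
  define Pb where "Pb = (\<Prod>d\<in>T. [:- d, 1:] ^ rb d)"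
  have P: "Pa \<in> polys_over K" "Pb \<in> polys_over K" unfolding Pa_def Pb_def using T_sub
    by (auto intro!: polys_over_prod[OF K_ring] polys_over_power[OF K_ring] linear_polys_over)
  have "(U1 * Pa) * A + (W1 * Pb) * B = 1" using 1(6) unfolding a(2) b(2) Pa_def Pb_def by (simp only: mult.assoc)
  moreover have "U1 * Pa \<in> polys_over K" "W1 * Pb \<in> polys_over K" using P 1 polys_over_mult[OF K_ring] by auto
  moreover have "c = (\<Prod>d\<in>T. (x - d) powi (int (ra d) - int (rb d))) * (poly A x / poly B x)"
  proof -
    have "c = (\<Prod>d\<in>T. (x - d) ^ ra d) / (\<Prod>d\<in>T. (x - d) ^ rb d) * (poly A x / poly B x)"
      unfolding c1 a(2) b(2) by (simp add: poly_prod)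
    also have "(\<Prod>d\<in>T. (x - d) ^ ra d) / (\<Prod>d\<in>T. (x - d) ^ rb d) = (\<Prod>d\<in>T. (x - d) powi (int (ra d) - int (rb d)))"
      unfolding prod_dividef[symmetric] using x_minus_nonzero T_sub
      by (intro prod.cong refl) (auto simp: power_int_diff power_int_of_nat)
    finally show ?thesis .
  qed
  moreover have "A \<noteq> 0" "B \<noteq> 0" using A1 1(5) a(2) b(2) by auto
  ultimately show ?thesis using a b
    by (intro exI[of _ "\<lambda>d. int (ra d) - int (rb d)"] bexI[of _ A] bexI[of _ B] bexI[of _ "U1 * Pa"] bexI[of _ "W1 * Pb"]) auto
qed

lemma poly_unit_at:
  assumes V: "valuation_ring K UNIV V" and c: "c \<in> K" "x - c \<in> nonunits V"
    and p: "p \<in> polys_over K" "poly p c \<noteq> 0"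
  shows "unit_in V (poly p x)"
proof -
  interpret discretely_valued_field K UNIV V by (rule discretely_valued[OF V])
  have xV: "x \<in> V" using c K_sub_V V_closed(6)[of "x - c" c] by (auto simp: nonunits_def)
  have pc: "poly p c \<in> K" using poly_polys_over_in[OF K_ring p(1) order_refl K_ring c(1)] .
  have "p - [:poly p c:] \<in> polys_over K"
    by (intro polys_over_minus[OF K_ring] polys_over_pCons[OF K_ring] polys_over_0[OF K_ring] p pc)
  then obtain B where B: "B \<in> polys_over K" "p - [:poly p c:] = [:- c, 1:] * B"
    using polys_over_root_factor[OF K(1), of "p - [:poly p c:]" c] c by auto
  have "poly p x - poly p c = (x - c) * poly B x"
    using arg_cong[OF B(2), of "\<lambda>p. poly p x"] by (simp add: algebra_simps)
  then have "poly p x = poly p c + poly B x * (x - c)" by (simp add: algebra_simps)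
  then show ?thesis using unit_in_add_nonunit[OF unit_in_K[OF pc p(2)] nonunits_mult[OF poly_in_V[OF B(1) xV] c(2)]]
    by simp
qed

lemma val_x_minus_other:
  assumes V: "valuation_ring K UNIV V" and c: "c \<in> K" "x - c \<in> nonunits V" and d: "d \<in> K" "d \<noteq> c"
  shows "v V (x - d) = 0"
proof -
  interpret discretely_valued_field K UNIV V by (rule discretely_valued[OF V])
  have "unit_in V (poly [:- d, 1:] x)"
    using d by (intro poly_unit_at[OF V c] linear_polys_over) auto
  then show ?thesis using val_unit_iff[of "x - d"] x_minus_nonzero[OF d(1)] by simp
qed

text \<open>At a pole of \<open>x\<close> the leading term has the strictly smallest order.\<close>

lemma val_poly_at_infinity:
  assumes V: "valuation_ring K UNIV V" and xV: "x \<notin> V" and p: "p \<in> polys_over K" "p \<noteq> 0"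
  shows "v V (poly p x) = int (degree p) * v V x"
proof -
  interpret discretely_valued_field K UNIV V by (rule discretely_valued[OF V])
  have x0: "x \<noteq> 0" using xV V_closed(4) by auto
  have neg: "val x < 0" using val_nonneg_iff[of x] xV x0 by auto
  have vt: "val (coeff p i * x ^ i) = int i * val x" if "coeff p i \<noteq> 0" for i
    using that x0 val_const[of "coeff p i"] coeff_polys_over[OF p(1)] by (simp add: val_mult val_power)
  have "val (\<Sum>i\<le>degree p. coeff p i * x ^ i) = val (coeff p (degree p) * x ^ degree p)"
    using x0 p(2) vt neg by (intro val_sum_dominated) (auto simp: mult_less_cancel_right)
  then show ?thesis using vt[of "degree p"] p(2) by (simp add: poly_altdef)
qed

text \<open>Both sides carry the factor \<open>N\<close> because at an arbitrary place the curve
  equation gives \<open>N * v V y\<close> rather than \<open>v V y\<close>.\<close>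

lemma val_component:
  assumes V: "valuation_ring K UNIV V" and b: "b \<noteq> 0"
  shows "int N * v V ((\<Prod>d\<in>T. (x - d) powi r d) * b * t ^ i) =
    (\<Sum>d\<in>T. v V (x - d) * (int N * r d - int i * int (e d))) + int N * v V b"
proof -
  interpret discretely_valued_field K UNIV V by (rule discretely_valued[OF V])
  have nz: "x - d \<noteq> 0" if "d \<in> T" for d using x_minus_nonzero T_sub that by auto
  have pnz: "(\<Prod>d\<in>T. (x - d) powi r d) \<noteq> 0" using nz finite_T by auto
  have "int N * val y = val (y ^ N)" using y_nonzero by (simp add: val_power)
  also have "\<dots> = (\<Sum>d\<in>T. val (x - d) * int (e d))" unfolding y_power
    using nz by (subst val_prod) (auto simp: val_power mult.commute)
  finally have vy: "int N * val y = (\<Sum>d\<in>T. val (x - d) * int (e d))" .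
  have "val ((\<Prod>d\<in>T. (x - d) powi r d) * b * t ^ i) = (\<Sum>d\<in>T. val (x - d) * r d) + val b - int i * val y"
  proof -
    have "val (\<Prod>d\<in>T. (x - d) powi r d) = (\<Sum>d\<in>T. val (x - d) * r d)"
      using nz by (subst val_prod) (auto simp: val_powi mult.commute)
    moreover have "val (t ^ i) = - (int i * val y)" using y_nonzero by (simp add: t_def val_power val_inverse)
    ultimately show ?thesis using pnz b t_nonzero by (simp add: val_mult)
  qed
  then have "int N * val ((\<Prod>d\<in>T. (x - d) powi r d) * b * t ^ i) =
      int N * (\<Sum>d\<in>T. val (x - d) * r d) + int N * val b - int i * (int N * val y)"
    by (simp only:) (simp add: algebra_simps)
  also have "\<dots> = (\<Sum>d\<in>T. int N * (val (x - d) * r d)) + int N * val b - int i * (\<Sum>d\<in>T. val (x - d) * int (e d))"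
    unfolding vy by (simp only: sum_distrib_left)
  also have "\<dots> = (\<Sum>d\<in>T. val (x - d) * (int N * r d - int i * int (e d))) + int N * val b"
    by (simp add: sum_distrib_left sum_subtractf algebra_simps)
  finally show ?thesis .
qed


section \<open>Orders at the places over the roots of \<open>x^q + x\<close>\<close>

lemma Z_sub_K: "Z \<subseteq> K" using Z_sub_T T_sub by blast

lemma sum_T_at:
  assumes c: "c \<in> T" and V: "valuation_ring K UNIV V" "x - c \<in> nonunits V"
  shows "(\<Sum>d\<in>T. v V (x - d) * g d) = v V (x - c) * g c"
proof -
  have "(\<Sum>d\<in>T. v V (x - d) * g d) = (\<Sum>d\<in>{c}. v V (x - d) * g d)"
    using c finite_T T_sub val_x_minus_other[OF V(1) _ V(2)] by (intro sum.mono_neutral_right) auto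
  then show ?thesis by simp
qed

lemma val_x_minus_at:
  assumes \<alpha>: "\<alpha> \<in> Z" and VV: "valuation_ring K UNIV V" "x - \<alpha> \<in> nonunits V"
  shows "v V (x - \<alpha>) = int N * v V y" "v V y > 0"
proof -
  interpret discretely_valued_field K UNIV V by (rule discretely_valued[OF VV(1)])
  have \<alpha>T: "\<alpha> \<in> T" using \<alpha> Z_sub_T by auto
  \<comment> \<open>The component with \<open>r = 0\<close>, \<open>b = 1\<close> and
    \<open>i = 1\<close> is \<open>t\<close> itself; only \<open>d = \<alpha>\<close> contributes,
    and \<open>e \<alpha> = 1\<close>.\<close>
  have "int N * val (1 * 1 * t ^ 1) = - val (x - \<alpha>)"
    using val_component[OF VV(1), of 1 "\<lambda>_. 0" 1] sum_T_at[OF \<alpha>T VV, of "\<lambda>d. - int (e d)"] \<alpha>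
    by (simp add: e_def val_one)
  then show *: "val (x - \<alpha>) = int N * val y" using y_nonzero by (simp add: t_def val_inverse)
  have "int N * val y > 0" using * val_pos_iff[of "x - \<alpha>"] x_minus_nonzero[of \<alpha>] \<alpha> Z_sub_K VV(2) by auto
  then show "val y > 0" by (simp add: zero_less_mult_iff)
qed

lemma val_component_at:
  assumes \<alpha>: "\<alpha> \<in> Z" and V: "valuation_ring K UNIV V" "x - \<alpha> \<in> nonunits V"
    and b: "b \<noteq> 0" "v V b = 0"
  shows "v V ((\<Prod>d\<in>T. (x - d) powi r d) * b * t ^ i) = v V y * (int N * r \<alpha> - int i)"
proof -
  have "\<alpha> \<in> T" using \<alpha> Z_sub_T by auto
  then have "int N * v V ((\<Prod>d\<in>T. (x - d) powi r d) * b * t ^ i) = v V (x - \<alpha>) * (int N * r \<alpha> - int i)"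
    unfolding val_component[OF V(1) b(1)] b(2) using sum_T_at[OF _ V] \<alpha> by (simp add: e_def)
  also have "\<dots> = int N * (v V y * (int N * r \<alpha> - int i))"
    unfolding val_x_minus_at(1)[OF \<alpha> V] by (simp only: mult.assoc)
  finally show ?thesis using N_pos by simp
qed

lemma val_poly_quotient_at:
  assumes V: "valuation_ring K UNIV V" and c: "c \<in> K" "x - c \<in> nonunits V"
    and AB: "A \<in> polys_over K" "B \<in> polys_over K" "poly A c \<noteq> 0" "poly B c \<noteq> 0"
  shows "poly A x / poly B x \<noteq> 0" "v V (poly A x / poly B x) = 0"
proof -
  interpret discretely_valued_field K UNIV V by (rule discretely_valued[OF V])
  have "unit_in V (poly A x / poly B x)" using assms poly_unit_at by (intro unit_in_divide) auto
  then show "poly A x / poly B x \<noteq> 0" "val (poly A x / poly B x) = 0"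
    using val_unit_iff[of "poly A x / poly B x"] by (auto simp: unit_in_def)
qed

text \<open>The integer \<open>r\<close> is the multiplicity of \<open>x - \<alpha>\<close> in
  \<open>c\<close>. It is chosen before \<open>V\<close> and \<open>i\<close>, so orders at
  different places over \<open>\<alpha>\<close> can be compared.\<close>

lemma val_term_at:
  assumes \<alpha>: "\<alpha> \<in> Z" and c: "c \<in> k" "c \<noteq> 0"
  shows "\<exists>r. \<forall>V i. valuation_ring K UNIV V \<and> x - \<alpha> \<in> nonunits V \<longrightarrow>
    v V y > 0 \<and> v V (c * t ^ i) = v V y * (int N * r - int i)"
proof -
  obtain r A B where rf: "A \<in> polys_over K" "B \<in> polys_over K" "c = (\<Prod>d\<in>T. (x - d) powi r d) * (poly A x / poly B x)"
    "\<forall>d\<in>T. poly A d \<noteq> 0 \<and> poly B d \<noteq> 0"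
    using rational_factorization[OF c] by metis
  have "v V y > 0 \<and> v V (c * t ^ i) = v V y * (int N * r \<alpha> - int i)"
    if V: "valuation_ring K UNIV V" "x - \<alpha> \<in> nonunits V" for V i
  proof -
    have \<alpha>K: "\<alpha> \<in> K" "\<alpha> \<in> T" using \<alpha> Z_sub_T T_sub by auto
    have "poly A x / poly B x \<noteq> 0" "v V (poly A x / poly B x) = 0"
      using val_poly_quotient_at[OF V(1) \<alpha>K(1) V(2) rf(1,2)] rf(4) \<alpha>K(2) by auto
    then show ?thesis unfolding rf(3) using val_component_at[OF \<alpha> V] val_x_minus_at(2)[OF \<alpha> V] by blast
  qed
  then show ?thesis by blast
qed

text \<open>The orders of the terms are distinct modulo \<open>N\<close> in units of the order of \<open>y\<close>, so nothing cancels.\<close>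

lemma val_sum_at:
  assumes \<alpha>: "\<alpha> \<in> Z" and a: "\<forall>i. a i \<in> k" and j: "j < N" "a j \<noteq> 0"
  shows "\<exists>m. \<exists>i<N. a i \<noteq> 0 \<and> (\<forall>V. valuation_ring K UNIV V \<and> x - \<alpha> \<in> nonunits V \<longrightarrow>
    (\<Sum>i<N. a i * t ^ i) \<noteq> 0 \<and> v V y > 0 \<and> v V (\<Sum>i<N. a i * t ^ i) = v V y * m \<and>
    v V (a i * t ^ i) = v V y * m \<and> (\<forall>j<N. a j \<noteq> 0 \<longrightarrow> v V y * m \<le> v V (a j * t ^ j)))"
proof -
  define I where "I = {i. i < N \<and> a i \<noteq> 0}"
  have I: "finite I" "I \<noteq> {}" using j by (auto simp: I_def)
  have "\<exists>r. \<forall>i\<in>I. \<forall>V. valuation_ring K UNIV V \<and> x - \<alpha> \<in> nonunits V \<longrightarrow>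
    v V y > 0 \<and> v V (a i * t ^ i) = v V y * (int N * r i - int i)"
    using val_term_at[OF \<alpha>] a unfolding I_def by (intro bchoice) blast
  then obtain r where r: "\<And>i V. i \<in> I \<Longrightarrow> valuation_ring K UNIV V \<Longrightarrow> x - \<alpha> \<in> nonunits V \<Longrightarrow>
    v V y > 0 \<and> v V (a i * t ^ i) = v V y * (int N * r i - int i)" by blast
  define w where "w i = int N * r i - int i" for i
  \<comment> \<open>The minimum is taken over the integers \<open>w i\<close>, which do not involve
    \<open>V\<close>; as \<open>v V y\<close> is positive, the same index is minimal at every place
    over \<open>\<alpha>\<close>.\<close>
  obtain i where i: "i \<in> I" "\<And>j. j \<in> I \<Longrightarrow> w i \<le> w j"
    using arg_min_if_finite[OF I, of w] by (metis linorder_not_less)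
  have strict: "w i < w j" if "j \<in> I" "j \<noteq> i" for j
  proof (rule ccontr)
    assume "\<not> w i < w j"
    then have "w i = w j" using i(2)[OF that(1)] by simp
    then have "int N * (r i - r j) = int i - int j" by (simp add: w_def algebra_simps)
    then have "int N dvd int i - int j" by (metis dvd_triv_left)
    then have "int i mod int N = int j mod int N" by (simp add: mod_eq_dvd_iff)
    then show False using that i(1) by (simp add: I_def flip: of_nat_mod)
  qed
  have "(\<Sum>i<N. a i * t ^ i) \<noteq> 0 \<and> v V y > 0 \<and> v V (\<Sum>i<N. a i * t ^ i) = v V y * w i \<and>
    v V (a i * t ^ i) = v V y * w i \<and> (\<forall>j<N. a j \<noteq> 0 \<longrightarrow> v V y * w i \<le> v V (a j * t ^ j))"
    if VV: "valuation_ring K UNIV V" "x - \<alpha> \<in> nonunits V" for V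
  proof -
    interpret discretely_valued_field K UNIV V by (rule discretely_valued[OF VV(1)])
    have pos: "val y > 0" and vt: "\<And>j. j \<in> I \<Longrightarrow> val (a j * t ^ j) = val y * w j"
      using r[OF _ VV] i(1) by (auto simp: w_def)
    have i': "i \<in> {..<N}" "a i * t ^ i \<noteq> 0" using i(1) t_nonzero by (auto simp: I_def)
    have lt: "val (a i * t ^ i) < val (a j * t ^ j)" if "j < N" "j \<noteq> i" "a j * t ^ j \<noteq> 0" for j
      using vt[of j] vt[OF i(1)] strict[of j] pos that by (simp add: I_def)
    have "(\<Sum>i<N. a i * t ^ i) \<noteq> 0" "val (\<Sum>i<N. a i * t ^ i) = val (a i * t ^ i)"
      using val_sum_dominated[of "{..<N}" i "\<lambda>i. a i * t ^ i"] i' lt by auto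
    moreover have "val y * w i \<le> val (a j * t ^ j)" if "j < N" "a j \<noteq> 0" for j
      using vt[of j] i(2)[of j] pos that by (simp add: I_def)
    ultimately show ?thesis using pos vt[OF i(1)] by auto
  qed
  then show ?thesis using i(1) unfolding I_def by blast
qed

section \<open>Independence of the powers of \<open>t\<close>, total ramification, uniqueness of the
  places\<close>

lemma Z_nonempty: "Z \<noteq> {}" using card_Z q_ge_2 by auto

lemma exists_valuation_ring_over:
  assumes "c \<in> K"
  shows "\<exists>V. valuation_ring K UNIV V \<and> x - c \<in> nonunits V"
  using exists_valuation_ring_at[OF x linear_polys_over[OF assms]] by auto

text \<open>A nonzero difference of coefficients would make the difference of the sums nonzero, as
  seen at a place over any root in \<open>Z\<close>.\<close>

lemma coefficients_unique:
  assumes a: "\<forall>i. a i \<in> k" and b: "\<forall>i. b i \<in> k" and eq: "(\<Sum>i<N. a i * t ^ i) = (\<Sum>i<N. b i * t ^ i)"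
    and i: "i < N"
  shows "a i = b i"
proof (rule ccontr)
  assume ne: "a i \<noteq> b i"
  obtain \<alpha> where \<alpha>: "\<alpha> \<in> Z" using Z_nonempty by auto
  obtain V where V: "valuation_ring K UNIV V" "x - \<alpha> \<in> nonunits V"
    using exists_valuation_ring_over \<alpha> Z_sub_K by blast
  have "\<forall>i. a i - b i \<in> k" using a b k_closed(1) by auto
  then have "(\<Sum>i<N. (a i - b i) * t ^ i) \<noteq> 0"
    using val_sum_at[OF \<alpha>, of "\<lambda>i. a i - b i" i] V i ne by auto
  then show False using eq by (simp add: left_diff_distrib sum_subtractf)
qed

text \<open>Only the values at \<open>i < N\<close> are determined by \<open>z\<close>.\<close>

definition coord :: "'a \<Rightarrow> nat \<Rightarrow> 'a" where
  "coord z = (SOME a. (\<forall>i. a i \<in> k) \<and> z = (\<Sum>i<N. a i * t ^ i))"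

lemma coord: "coord z i \<in> k" "(\<Sum>i<N. coord z i * t ^ i) = z"
  using someI_ex[OF decomposition[of z]] unfolding coord_def by auto

lemma coord_eqI: "\<forall>i. a i \<in> k \<Longrightarrow> z = (\<Sum>i<N. a i * t ^ i) \<Longrightarrow> i < N \<Longrightarrow> coord z i = a i"
  using coefficients_unique[of "coord z" a i] coord by auto

lemma coord_nonzero: "z \<noteq> 0 \<Longrightarrow> \<exists>i<N. coord z i \<noteq> 0"
  using coord(2)[of z] by (metis (no_types, lifting) lessThan_iff mult_zero_left sum.neutral)

text \<open>Every order is a multiple of \<open>v V y\<close>, and the normalized order takes the
  value 1. With \<open>val_x_minus_at\<close> this is total ramification.\<close>

lemma val_y_at:
  assumes \<alpha>: "\<alpha> \<in> Z" and VV: "valuation_ring K UNIV V" "x - \<alpha> \<in> nonunits V"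
  shows "v V y = 1"
proof -
  interpret discretely_valued_field K UNIV V by (rule discretely_valued[OF VV(1)])
  obtain z where z: "z \<noteq> 0" "val z = 1" using ex_val_1 by auto
  obtain j where j: "j < N" "coord z j \<noteq> 0" using coord_nonzero[OF z(1)] by blast
  have "\<forall>i. coord z i \<in> k" using coord by blast
  then obtain m where "val y > 0" "val z = val y * m"
    using val_sum_at[where a = "coord z", OF \<alpha> _ j] VV unfolding coord(2) by blast
  then show ?thesis using z(2) by (simp add: pos_zmult_eq_1_iff)
qed

lemma val_monomial_at:
  assumes \<alpha>: "\<alpha> \<in> Z" and V: "valuation_ring K UNIV V" "x - \<alpha> \<in> nonunits V" and c: "c \<in> k" "c \<noteq> 0"
  shows "\<exists>r. v V (c * t ^ i) = int N * r - int i"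
  using val_term_at[OF \<alpha> c] V val_y_at[OF \<alpha> V] by fastforce

lemma val_decomposition_at:
  assumes \<alpha>: "\<alpha> \<in> Z" and z: "z \<noteq> 0"
  shows "\<exists>m. \<exists>i<N. coord z i \<noteq> 0 \<and> (\<forall>V. valuation_ring K UNIV V \<and> x - \<alpha> \<in> nonunits V \<longrightarrow>
    v V z = m \<and> v V (coord z i * t ^ i) = m \<and> (\<forall>j<N. coord z j \<noteq> 0 \<longrightarrow> m \<le> v V (coord z j * t ^ j)))"
proof -
  obtain j where j: "j < N" "coord z j \<noteq> 0" using coord_nonzero[OF z] by blast
  have ck: "\<forall>i. coord z i \<in> k" using coord by blast
  obtain m i where mi: "i < N" "coord z i \<noteq> 0"
    "\<And>V. valuation_ring K UNIV V \<Longrightarrow> x - \<alpha> \<in> nonunits V \<Longrightarrow> v V z = v V y * m \<and>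
      v V (coord z i * t ^ i) = v V y * m \<and> (\<forall>j<N. coord z j \<noteq> 0 \<longrightarrow> v V y * m \<le> v V (coord z j * t ^ j))"
    using val_sum_at[where a = "coord z", OF \<alpha> ck j] unfolding coord(2) by blast
  show ?thesis using mi val_y_at[OF \<alpha>] by (intro exI[of _ m] exI[of _ i]) simp
qed

text \<open>The order of \<open>z\<close> is the integer \<open>m\<close> of
  \<open>val_decomposition_at\<close>, fixed before the ring is chosen; so both rings consist of the
  same functions.\<close>

lemma valuation_ring_over_unique:
  assumes \<alpha>: "\<alpha> \<in> Z" and V: "valuation_ring K UNIV V" "x - \<alpha> \<in> nonunits V"
    and W: "valuation_ring K UNIV W" "x - \<alpha> \<in> nonunits W"
  shows "V = W"
proof -
  interpret V: discretely_valued_field K UNIV V by (rule discretely_valued[OF V(1)])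
  interpret W: discretely_valued_field K UNIV W by (rule discretely_valued[OF W(1)])
  have "z \<in> V \<longleftrightarrow> z \<in> W" for z
  proof (cases "z = 0")
    case True
    then show ?thesis using V.V_closed(4) W.V_closed(4) by simp
  next
    case False
    then have "v V z = v W z" using val_decomposition_at[OF \<alpha> False] V W by metis
    then show ?thesis using V.val_nonneg_iff[of z] W.val_nonneg_iff[of z] False by auto
  qed
  then show ?thesis by blast
qed

section \<open>Regular functions and their homogeneous components\<close>

text \<open>A place over an element of \<open>Z\<close> is unique, so for \<open>B \<subseteq> Z\<close> the condition on \<open>V\<close> excludes one place for each
  element of \<open>B\<close>.\<close>

definition regular :: "'a set \<Rightarrow> 'a \<Rightarrow> bool" where
  "regular B z \<longleftrightarrow> (\<forall>V. valuation_ring K UNIV V \<and> (\<forall>\<alpha>\<in>B. x - \<alpha> \<notin> nonunits V) \<longrightarrow> z \<in> V)"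

text \<open>The automorphism over \<open>k\<close> with \<open>t \<mapsto> \<zeta> t\<close>, when \<open>\<zeta>\<^sup>N = 1\<close>.\<close>

definition conj :: "'a \<Rightarrow> 'a \<Rightarrow> 'a" where
  "conj \<zeta> z = (\<Sum>i<N. coord z i * \<zeta> ^ i * t ^ i)"

lemma conj_span: "\<forall>i. a i \<in> k \<Longrightarrow> conj \<zeta> (\<Sum>i<N. a i * t ^ i) = (\<Sum>i<N. a i * \<zeta> ^ i * t ^ i)"
  unfolding conj_def using coord_eqI[of a] by (intro sum.cong) auto

lemma conj_add: "conj \<zeta> (z + w) = conj \<zeta> z + conj \<zeta> w"
proof -
  have "conj \<zeta> (z + w) = conj \<zeta> (\<Sum>i<N. (coord z i + coord w i) * t ^ i)"
    by (simp add: distrib_right sum.distrib coord)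
  also have "\<dots> = conj \<zeta> z + conj \<zeta> w" using k_closed(6) coord
    by (subst conj_span) (auto simp: conj_def distrib_right sum.distrib)
  finally show ?thesis .
qed

lemma conj_0: "conj \<zeta> 0 = 0"
  using conj_add[of \<zeta> 0 0] by (metis add.right_neutral add_left_cancel)

lemma conj_sum: "conj \<zeta> (sum f I) = (\<Sum>i\<in>I. conj \<zeta> (f i))"
  by (induction I rule: infinite_finite_induct) (auto simp: conj_0 conj_add)

lemma conj_uminus: "conj \<zeta> (- z) = - conj \<zeta> z"
  using conj_add[of \<zeta> z "- z"] by (simp add: conj_0 add_eq_0_iff)

lemma conj_diff: "conj \<zeta> (z - w) = conj \<zeta> z - conj \<zeta> w"
  using conj_add[of \<zeta> z "- w"] by (simp add: conj_uminus)

context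
  fixes \<zeta> assumes \<zeta>: "\<zeta> \<in> K" "\<zeta> ^ N = 1"
begin

text \<open>Exponents beyond \<open>N\<close> are reduced through \<open>t ^ N\<close>, which lies
  in \<open>k\<close>; \<open>\<zeta> ^ N = 1\<close> makes the factor \<open>\<zeta> ^ m\<close>
  compatible with the reduction. Multiplicativity of \<open>conj\<close> rests on this.\<close>

lemma conj_monomial:
  assumes a: "a \<in> k"
  shows "conj \<zeta> (a * t ^ m) = a * \<zeta> ^ m * t ^ m"
proof -
  define b where "b = a * (t ^ N) ^ (m div N)"
  have b: "b \<in> k" unfolding b_def by (rule k_closed(2)[OF a k_closed(7)[OF t_power]])
  have eq: "a * t ^ m = b * t ^ (m mod N)"
    unfolding b_def mult.assoc by (simp flip: power_mult power_add)
  have \<zeta>m: "\<zeta> ^ m = \<zeta> ^ (m mod N)"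
  proof -
    have "\<zeta> ^ m = (\<zeta> ^ N) ^ (m div N) * \<zeta> ^ (m mod N)" by (simp flip: power_mult power_add)
    then show ?thesis using \<zeta>(2) by simp
  qed
  define c where "c i = (if i = m mod N then b else 0)" for i
  have c: "\<forall>i. c i \<in> k" using b k_closed(4) by (auto simp: c_def)
  have pick: "(\<Sum>i<N. c i * g i) = b * g (m mod N)" for g
  proof -
    have "(\<Sum>i<N. c i * g i) = (\<Sum>i\<in>{m mod N}. c i * g i)"
      using N_pos by (intro sum.mono_neutral_right) (auto simp: c_def)
    then show ?thesis by (simp add: c_def)
  qed
  have "conj \<zeta> (a * t ^ m) = conj \<zeta> (\<Sum>i<N. c i * t ^ i)" by (simp only: eq pick)
  also have "\<dots> = (\<Sum>i<N. c i * (\<zeta> ^ i * t ^ i))" by (simp only: conj_span[OF c] mult.assoc)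
  also have "\<dots> = \<zeta> ^ m * (b * t ^ (m mod N))" by (simp only: pick \<zeta>m mult_ac)
  finally show ?thesis by (simp add: eq[symmetric] mult_ac)
qed

lemma conj_mult: "conj \<zeta> (z * w) = conj \<zeta> z * conj \<zeta> w"
proof -
  have "z * w = (\<Sum>i<N. coord z i * t ^ i) * (\<Sum>i<N. coord w i * t ^ i)" by (simp only: coord(2))
  also have "\<dots> = (\<Sum>i<N. \<Sum>j<N. (coord z i * coord w j) * t ^ (i + j))"
    unfolding sum_product by (intro sum.cong refl) (simp only: power_add mult_ac)
  finally have "z * w = (\<Sum>i<N. \<Sum>j<N. (coord z i * coord w j) * t ^ (i + j))" .
  then have "conj \<zeta> (z * w) = (\<Sum>i<N. \<Sum>j<N. conj \<zeta> ((coord z i * coord w j) * t ^ (i + j)))"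
    by (simp only: conj_sum)
  also have "\<dots> = (\<Sum>i<N. \<Sum>j<N. (coord z i * coord w j) * \<zeta> ^ (i + j) * t ^ (i + j))"
    using coord(1) k_closed(2) by (simp only: conj_monomial)
  also have "\<dots> = conj \<zeta> z * conj \<zeta> w"
    unfolding conj_def sum_product by (intro sum.cong refl) (simp add: power_add mult_ac)
  finally show ?thesis .
qed

lemma conj_k: "c \<in> k \<Longrightarrow> conj \<zeta> c = c"
  using conj_monomial[of c 0] by simp

lemma conj_inverse: "conj \<zeta> (inverse z) = inverse (conj \<zeta> z)"
proof (cases "z = 0")
  case False
  then have "conj \<zeta> z * conj \<zeta> (inverse z) = 1"
    using conj_mult[of z "inverse z"] conj_k[OF k_closed(3)] by simp
  then show ?thesis by (metis inverse_unique)
qed (simp add: conj_0)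

lemma conj_cancel: "conj \<zeta> (conj (inverse \<zeta>) z) = z"
proof -
  have \<zeta>0: "\<zeta> \<noteq> 0" using \<zeta>(2) N_pos by (auto simp: zero_power)
  have "\<forall>i. coord z i * inverse \<zeta> ^ i \<in> k" using \<zeta> K_sub_k coord by (auto intro!: k_closed)
  then have "conj \<zeta> (conj (inverse \<zeta>) z) = (\<Sum>i<N. coord z i * inverse \<zeta> ^ i * \<zeta> ^ i * t ^ i)"
    unfolding conj_def[of "inverse \<zeta>"] by (rule conj_span)
  also have "\<dots> = (\<Sum>i<N. coord z i * t ^ i)"
  proof (intro sum.cong refl)
    fix i
    have "inverse \<zeta> ^ i * \<zeta> ^ i = 1" using \<zeta>0 by (simp flip: power_mult_distrib)
    then show "coord z i * inverse \<zeta> ^ i * \<zeta> ^ i * t ^ i = coord z i * t ^ i" by (simp add: mult.assoc)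
  qed
  finally show ?thesis by (simp add: coord)
qed

lemma conj_vimage_valuation_ring:
  assumes V: "valuation_ring K UNIV V"
  shows "valuation_ring K UNIV (conj \<zeta> -` V)"
proof -
  interpret discretely_valued_field K UNIV V by (rule discretely_valued[OF V])
  have "subring_set (conj \<zeta> -` V)"
    using V_closed conj_k[OF k_closed(3)] by (auto simp: subring_set_def conj_diff conj_mult)
  moreover have KV: "K \<subseteq> conj \<zeta> -` V" using K_sub_V K_sub_k conj_k by auto
  moreover have "conj \<zeta> -` V \<noteq> K"
  proof
    assume eq: "conj \<zeta> -` V = K"
    obtain w where w: "w \<in> V" "w \<notin> K" using V by (auto simp: valuation_ring_def)
    then have "conj (inverse \<zeta>) w \<in> K" using eq conj_cancel[of w] by auto
    then have "conj \<zeta> (conj (inverse \<zeta>) w) \<in> K" using conj_k K_sub_k by auto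
    then show False using w conj_cancel by simp
  qed
  moreover obtain w where "w \<notin> V" using V_neq_L by auto
  then have "conj (inverse \<zeta>) w \<notin> conj \<zeta> -` V" using conj_cancel by simp
  then have "conj \<zeta> -` V \<noteq> UNIV" by blast
  moreover have "z \<in> conj \<zeta> -` V \<or> inverse z \<in> conj \<zeta> -` V" for z
    using V_cases[of "conj \<zeta> z"] by (simp add: conj_inverse)
  ultimately show ?thesis unfolding valuation_ring_def by blast
qed

lemma conj_vimage_nonunits: "c \<in> k \<Longrightarrow> c \<in> nonunits (conj \<zeta> -` V) \<longleftrightarrow> c \<in> nonunits V"
  using k_closed(8) by (auto simp: nonunits_def conj_k)

text \<open>The preimage of \<open>V\<close> under \<open>conj \<zeta>\<close> is again a valuation
  ring, and it treats \<open>x - \<alpha>\<close> as \<open>V\<close> does because \<open>k\<close>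
  is fixed. The allowed poles are thus preserved without tracking how other places are
  permuted.\<close>

lemma regular_conj: "B \<subseteq> K \<Longrightarrow> regular B z \<Longrightarrow> regular B (conj \<zeta> z)"
  unfolding regular_def
proof (intro allI impI)
  fix V assume B: "B \<subseteq> K" and z: "\<forall>V. valuation_ring K UNIV V \<and> (\<forall>\<alpha>\<in>B. x - \<alpha> \<notin> nonunits V) \<longrightarrow> z \<in> V"
    and V: "valuation_ring K UNIV V \<and> (\<forall>\<alpha>\<in>B. x - \<alpha> \<notin> nonunits V)"
  have "x - \<alpha> \<in> k" if "\<alpha> \<in> B" for \<alpha> using that B K_sub_k x_in_k k_closed(1) by auto
  then have "\<forall>\<alpha>\<in>B. x - \<alpha> \<notin> nonunits (conj \<zeta> -` V)" using V conj_vimage_nonunits by blast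
  then have "z \<in> conj \<zeta> -` V" using z V conj_vimage_valuation_ring by blast
  then show "conj \<zeta> z \<in> V" by simp
qed

end

text \<open>\<open>card K - 1\<close> factors as \<open>(q^n + 1) * (q^n - 1)\<close>.\<close>

lemma card_unity: "card {\<zeta> \<in> K. \<zeta> ^ N = 1} = N"
proof (rule card_roots_of_unity[OF K(1) finite_K _ N_pos])
  have "q ^ n \<ge> 2" using q_ge_2 n by (metis One_nat_def Suc_leI le_trans power_increasing power_one_right numeral_le_one_iff one_le_numeral order.trans)
  then show "q ^ n - 1 > 0" by simp
  have "card K = q ^ n * q ^ n" using K(2) by (simp add: mult_2 power_add)
  then have "int (card K - 1) = int (q ^ n) * int (q ^ n) - 1" using \<open>q ^ n \<ge> 2\<close> by (simp add: of_nat_diff)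
  also have "\<dots> = int (N * (q ^ n - 1))" using \<open>q ^ n \<ge> 2\<close> by (simp add: N_def of_nat_diff algebra_simps)
  finally show "card K - 1 = N * (q ^ n - 1)" using of_nat_eq_iff by blast
qed

lemma of_nat_N: "of_nat N = (1 :: 'a)"
proof -
  obtain p f where pf: "prime p" "f > 0" "q = p ^ f" using q by (auto simp: primepow_def)
  have "CHAR('a) = p" using CHAR_subfield[OF K pf(3,1,2)] n by simp
  then have "of_nat p = (0 :: 'a)" using of_nat_CHAR[where ?'a = 'a] by metis
  then have "of_nat q = (0 :: 'a)" using pf by (simp add: zero_power)
  then show ?thesis using n by (simp add: N_def zero_power)
qed

text \<open>There is no factor \<open>1 / N\<close> because \<open>N = 1\<close> in characteristic \<open>p\<close>.\<close>

lemma component_eq_sum_conj: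
  assumes i: "i < N"
  shows "coord z i * t ^ i = (\<Sum>\<zeta> | \<zeta> \<in> K \<and> \<zeta> ^ N = 1. \<zeta> ^ (N - i) * conj \<zeta> z)"
proof -
  let ?U = "{\<zeta> \<in> K. \<zeta> ^ N = 1}"
  \<comment> \<open>Orthogonality of characters, with \<open>N - i\<close> in place of the exponent
    \<open>- i\<close>. As \<open>N - i + j\<close> lies strictly between 0 and
    \<open>2 * N\<close>, it is divisible by \<open>N\<close> only for \<open>j = i\<close>.\<close>
  have S: "(\<Sum>\<zeta>\<in>?U. \<zeta> ^ (N - i + j)) = (if j = i then 1 else 0)" if j: "j < N" for j
  proof (cases "j = i")
    case True
    then have "N - i + j = N" using i by simp
    then have "(\<Sum>\<zeta>\<in>?U. \<zeta> ^ (N - i + j)) = (\<Sum>\<zeta>\<in>?U. 1)" by (intro sum.cong) auto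
    then show ?thesis using True card_unity of_nat_N by simp
  next
    case False
    have "\<not> N dvd N - i + j"
    proof
      assume "N dvd N - i + j"
      then obtain m where m: "N - i + j = N * m" by (auto simp: dvd_def)
      moreover have "0 < N - i + j" "N - i + j < N * 2" using i j by auto
      ultimately have "0 < m" "m < 2" using N_pos by (metis mult_0_right not_gr_zero less_irrefl, metis nat_mult_less_cancel1)
      then have "m = 1" by simp
      then show False using m i False by simp
    qed
    then show ?thesis using sum_roots_of_unity_power[OF K(1) card_unity N_pos] False by simp
  qed
  have "(\<Sum>\<zeta>\<in>?U. \<zeta> ^ (N - i) * conj \<zeta> z) = (\<Sum>\<zeta>\<in>?U. \<Sum>j<N. coord z j * t ^ j * \<zeta> ^ (N - i + j))"
    unfolding conj_def sum_distrib_left by (intro sum.cong refl) (simp add: power_add mult_ac)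
  also have "\<dots> = (\<Sum>j<N. coord z j * t ^ j * (\<Sum>\<zeta>\<in>?U. \<zeta> ^ (N - i + j)))"
    by (subst sum.swap) (simp add: sum_distrib_left)
  also have "\<dots> = (\<Sum>j<N. if j = i then coord z i * t ^ i else 0)"
    by (intro sum.cong refl) (simp add: S)
  also have "\<dots> = coord z i * t ^ i" using i by simp
  finally show ?thesis by simp
qed

text \<open>The component is a combination over \<open>K\<close> of conjugates of \<open>z\<close>,
  all of them regular.\<close>

lemma regular_component:
  assumes B: "B \<subseteq> K" and z: "regular B z" and i: "i < N"
  shows "regular B (coord z i * t ^ i)"
  unfolding regular_def
proof (intro allI impI)
  fix V assume VV: "valuation_ring K UNIV V \<and> (\<forall>\<alpha>\<in>B. x - \<alpha> \<notin> nonunits V)"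
  then interpret discretely_valued_field K UNIV V by (intro discretely_valued) simp
  have "conj \<zeta> z \<in> V" if "\<zeta> \<in> K" "\<zeta> ^ N = 1" for \<zeta>
    using regular_conj[OF that B z] VV by (auto simp: regular_def)
  then show "coord z i * t ^ i \<in> V" unfolding component_eq_sum_conj[OF i]
    using K_sub_V by (intro V_closed) auto
qed


section \<open>Regularity of a component in terms of its exponents at \<open>T\<close>\<close>

text \<open>The degree in \<open>x\<close> of the right-hand side of the curve equation:
  \<open>q + (q^2 - q) * (q + 1)\<close>. This is the origin of \<open>q^3\<close> in the
  statement.\<close>

lemma sum_e: "(\<Sum>d\<in>T. int (e d)) = int q ^ 3"
proof -
  have "(\<Sum>d\<in>T. int (e d)) = (\<Sum>d\<in>T - Z. int (e d)) + (\<Sum>d\<in>Z. int (e d))"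
    by (intro sum.subset_diff Z_sub_T finite_T)
  also have "(\<Sum>d\<in>Z. int (e d)) = int q" using card_Z by (simp add: e_def)
  also have "(\<Sum>d\<in>T - Z. int (e d)) = (\<Sum>d\<in>T - Z. int q + 1)" by (intro sum.cong) (auto simp: e_def)
  also have "\<dots> = int (card (T - Z)) * (int q + 1)" by simp
  also have "card (T - Z) = q ^ 2 - q"
    using card_T card_Z Z_sub_T finite_subset[OF Z_sub_T finite_T] by (simp add: card_Diff_subset)
  also have "int (q ^ 2 - q) = int q ^ 2 - int q" using q_ge_2 by (simp add: of_nat_diff power2_eq_square)
  finally show ?thesis by (simp add: algebra_simps power2_eq_square power3_eq_cube)
qed

lemma val_x_minus_at_infinity:
  assumes V: "valuation_ring K UNIV V" "x \<notin> V" and d: "d \<in> K"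
  shows "v V (x - d) = v V x"
  using val_poly_at_infinity[OF V linear_polys_over[OF d]] by simp

lemma val_x_neg:
  assumes V: "valuation_ring K UNIV V" "x \<notin> V"
  shows "v V x < 0"
proof -
  interpret discretely_valued_field K UNIV V by (rule discretely_valued[OF V(1)])
  have "x \<noteq> 0" using x_minus_nonzero[of 0] K_closed(4) by simp
  then show ?thesis using val_nonneg_iff[of x] assms by auto
qed

lemma val_monomial_at_infinity:
  assumes VV: "valuation_ring K UNIV V" "x \<notin> V" and b: "b \<noteq> 0" "v V b = int l * v V x"
  shows "int N * v V ((\<Prod>d\<in>T. (x - d) powi r d) * b * t ^ i) =
    v V x * (int N * ((\<Sum>d\<in>T. r d) + int l) - int i * int q ^ 3)"
proof -
  have "(\<Sum>d\<in>T. v V (x - d) * (int N * r d - int i * int (e d)))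
      = (\<Sum>d\<in>T. v V x * (int N * r d - int i * int (e d)))"
    using val_x_minus_at_infinity[OF VV] T_sub by (intro sum.cong) auto
  also have "\<dots> = v V x * (int N * (\<Sum>d\<in>T. r d) - int i * int q ^ 3)"
    by (simp add: sum_e[symmetric] sum_distrib_left sum_subtractf algebra_simps)
  finally show ?thesis unfolding val_component[OF VV(1) b(1)] b(2) by (simp add: algebra_simps)
qed

text \<open>Where \<open>x\<close> is finite, each \<open>x - d\<close> contributes nonnegatively:
  it is a unit for \<open>d\<close> in \<open>B\<close>, and its exponent is nonnegative otherwise.
  At a pole of \<open>x\<close> only the total degree counts.\<close>

lemma regular_monomial:
  assumes B: "B \<subseteq> T" and r: "\<And>d. d \<in> T - B \<Longrightarrow> int N * r d \<ge> int i * int (e d)"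
    and deg: "int N * (\<Sum>d\<in>T. r d) \<le> int i * int q ^ 3"
  shows "regular B ((\<Prod>d\<in>T. (x - d) powi r d) * t ^ i)"
  unfolding regular_def
proof (intro allI impI)
  let ?w = "(\<Prod>d\<in>T. (x - d) powi r d) * t ^ i"
  fix V assume VV: "valuation_ring K UNIV V \<and> (\<forall>\<alpha>\<in>B. x - \<alpha> \<notin> nonunits V)"
  then interpret discretely_valued_field K UNIV V by (intro discretely_valued) simp
  have nz: "x - d \<noteq> 0" if "d \<in> T" for d using that x_minus_nonzero T_sub by auto
  have w: "?w \<noteq> 0" using nz finite_T t_nonzero by auto
  have "int N * val ?w \<ge> 0"
  proof (cases "x \<in> V")
    case True
    have "0 \<le> val (x - d) * (int N * r d - int i * int (e d))" if d: "d \<in> T" for d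
    proof -
      have xd: "x - d \<in> V" using True d T_sub K_sub_V by (intro V_closed) auto
      show ?thesis
      proof (cases "d \<in> B")
        case True
        then have "unit_in V (x - d)" using VV xd by (auto simp: nonunits_iff)
        then show ?thesis using val_unit_iff[of "x - d"] nz[OF d] by simp
      next
        case False
        then show ?thesis using val_nonneg_iff[of "x - d"] nz[OF d] xd r[of d] d by simp
      qed
    qed
    then show ?thesis using val_component[of V 1 r i] VV by (simp add: val_one sum_nonneg)
  next
    case False
    then show ?thesis using val_monomial_at_infinity[of V 1 0 r i] VV deg val_x_neg[of V]
      by (simp add: val_one mult_nonpos_nonpos)
  qed
  then have "val ?w \<ge> 0" using N_pos by (simp add: zero_le_mult_iff)
  then show "?w \<in> V" using val_nonneg_iff[of ?w] w by simp
qed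

text \<open>Regularity is tested at three kinds of places: over each \<open>d\<close> in
  \<open>T - B\<close>, at a zero of the denominator \<open>D\<close>, which forces \<open>D\<close>
  to be constant, and at infinity.\<close>

lemma regular_monomial_constraints:
  assumes B: "B \<subseteq> Z" and c: "c \<in> k" "c \<noteq> 0" and reg: "regular B (c * t ^ i)"
  shows "\<exists>r. (\<forall>\<alpha>\<in>Z. \<forall>V. valuation_ring K UNIV V \<and> x - \<alpha> \<in> nonunits V \<longrightarrow> v V (c * t ^ i) = int N * r \<alpha> - int i) \<and>
    (\<forall>d\<in>T - B. int N * r d \<ge> int i * int (e d)) \<and> int N * (\<Sum>d\<in>T. r d) \<le> int i * int q ^ 3"
proof -
  obtain r A D U W where rf: "A \<in> polys_over K" "D \<in> polys_over K" "U \<in> polys_over K" "W \<in> polys_over K"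
    "c = (\<Prod>d\<in>T. (x - d) powi r d) * (poly A x / poly D x)"
    "U * A + W * D = 1" "A \<noteq> 0" "D \<noteq> 0" "\<forall>d\<in>T. poly A d \<noteq> 0 \<and> poly D d \<noteq> 0"
    using rational_factorization[OF c] by (elim exE bexE conjE) (rule that; assumption)
  have BT: "B \<subseteq> T" using B Z_sub_T by auto
  have nz: "poly A x \<noteq> 0" "poly D x \<noteq> 0" using rf poly_x_nonzero by auto
  have w: "c * t ^ i \<noteq> 0" using c t_nonzero by simp
  have reg_val: "v V (c * t ^ i) \<ge> 0" if VV: "valuation_ring K UNIV V" "\<forall>\<alpha>\<in>B. x - \<alpha> \<notin> nonunits V" for V
  proof -
    interpret discretely_valued_field K UNIV V by (rule discretely_valued[OF VV(1)])
    have "c * t ^ i \<in> V" using reg VV unfolding regular_def by blast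
    then show ?thesis using val_nonneg_iff w by simp
  qed
  have quot: "poly A x / poly D x \<noteq> 0" "v V (poly A x / poly D x) = 0"
    if "valuation_ring K UNIV V" "x - d \<in> nonunits V" "d \<in> T" for V d
    using val_poly_quotient_at[OF that(1) _ that(2) rf(1,2)] rf(9) that(3) T_sub by auto
  have "v V (c * t ^ i) = int N * r \<alpha> - int i"
    if \<alpha>: "\<alpha> \<in> Z" and V: "valuation_ring K UNIV V" "x - \<alpha> \<in> nonunits V" for \<alpha> V
    using val_component_at[OF \<alpha> V quot[OF V], of r i] \<alpha> Z_sub_T val_y_at[OF \<alpha> V] rf(5) by auto
  moreover have "int N * r d \<ge> int i * int (e d)" if d: "d \<in> T - B" for d
  proof -
    have dK: "d \<in> K" using d T_sub by auto
    obtain V where VV: "valuation_ring K UNIV V" "x - d \<in> nonunits V"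
      using exists_valuation_ring_over[OF dK] by blast
    interpret discretely_valued_field K UNIV V by (rule discretely_valued[OF VV(1)])
    have "x - b \<notin> nonunits V" if b: "b \<in> B" for b
    proof -
      have "b \<in> K" "b \<noteq> d" using b d BT T_sub by auto
      then show ?thesis using val_x_minus_other[OF VV(1) dK VV(2)] val_pos_iff[of "x - b"] x_minus_nonzero by auto
    qed
    then have "int N * val (c * t ^ i) \<ge> 0" using reg_val[OF VV(1)] by simp
    moreover have "int N * val (c * t ^ i) = val (x - d) * (int N * r d - int i * int (e d))"
      unfolding rf(5) using quot[OF VV] d val_component[OF VV(1), of "poly A x / poly D x" r i] sum_T_at[OF _ VV] by simp
    moreover have "val (x - d) > 0" using VV val_pos_iff[of "x - d"] x_minus_nonzero[OF dK] by simp
    ultimately show ?thesis by (simp add: zero_le_mult_iff)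
  qed
  \<comment> \<open>A nonconstant \<open>D\<close> vanishes at some place. There every
    \<open>x - d\<close> with \<open>d\<close> in \<open>T\<close> is a unit, and so is
    \<open>A\<close> by the Bezout relation; the component would have a pole at a place that is not
    excluded.\<close>
  moreover have degD: "degree D = 0"
  proof (rule ccontr)
    assume "degree D \<noteq> 0"
    then obtain V where VV: "valuation_ring K UNIV V" "x \<in> V" "poly D x \<in> nonunits V"
      using exists_valuation_ring_at[OF x rf(2)] by auto
    interpret discretely_valued_field K UNIV V by (rule discretely_valued[OF VV(1)])
    have unit: "unit_in V (x - d)" if d: "d \<in> T" for d
    proof (rule ccontr)
      assume "\<not> unit_in V (x - d)"
      moreover have "x - d \<in> V" using d VV T_sub K_sub_V by (intro V_closed) auto
      ultimately have "x - d \<in> nonunits V" by (simp add: nonunits_iff)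
      then have "unit_in V (poly D x)" using poly_unit_at[OF VV(1) _ _ rf(2)] d T_sub rf(9) by auto
      then show False using VV(3) by (simp add: nonunits_iff)
    qed
    have "poly U x * poly A x + poly W x * poly D x = 1"
      using arg_cong[OF rf(6), of "\<lambda>p. poly p x"] by simp
    moreover have "poly W x * poly D x \<in> nonunits V" by (intro nonunits_mult poly_in_V rf VV)
    ultimately have "poly U x * poly A x \<notin> nonunits V"
      using nonunits_add one_notin_nonunits by metis
    then have "poly A x \<notin> nonunits V" using nonunits_mult poly_in_V[OF rf(3) VV(2)] by blast
    then have "unit_in V (poly A x)" using poly_in_V[OF rf(1) VV(2)] by (simp add: nonunits_iff)
    then have vA: "val (poly A x) = 0" using val_unit_iff nz by simp
    have vT: "val (x - d) = 0" if "d \<in> T" for d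
      using unit[OF that] val_unit_iff[of "x - d"] x_minus_nonzero T_sub that by auto
    have "val (poly D x) > 0" using VV(3) val_pos_iff nz by simp
    then have "int N * val (c * t ^ i) < 0"
      unfolding rf(5) using val_component[OF VV(1), of "poly A x / poly D x" r i] nz vT vA N_pos
      by (simp add: val_divide)
    moreover have "\<forall>\<alpha>\<in>B. x - \<alpha> \<notin> nonunits V" using unit BT by (auto simp: nonunits_iff)
    then have "val (c * t ^ i) \<ge> 0" using reg_val[OF VV(1)] by blast
    ultimately show False by (simp add: mult_less_0_iff)
  qed
  moreover have "int N * (\<Sum>d\<in>T. r d) \<le> int i * int q ^ 3"
  proof -
    \<comment> \<open>A place where \<open>inverse x\<close> is a nonunit, that is, a pole of
      \<open>x\<close>.\<close>
    obtain V where VV: "valuation_ring K UNIV V" "poly [:0, 1:] (inverse x) \<in> nonunits V"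
      using exists_valuation_ring_at[OF transcendental_inverse, of "[:0, 1:]"] linear_polys_over[of 0] K_closed(4)
      by auto
    interpret discretely_valued_field K UNIV V by (rule discretely_valued[OF VV(1)])
    have x0: "x \<noteq> 0" using x_minus_nonzero[of 0] K_closed(4) by simp
    have xV: "x \<notin> V" using VV(2) x0 by (auto simp: nonunits_def)
    have "val (poly A x / poly D x) = int (degree A) * val x"
      using val_poly_at_infinity[OF VV(1) xV rf(1,7)] val_poly_at_infinity[OF VV(1) xV rf(2,8)] degD nz
      by (simp add: val_divide)
    then have "int N * val (c * t ^ i) = val x * (int N * ((\<Sum>d\<in>T. r d) + int (degree A)) - int i * int q ^ 3)"
      unfolding rf(5) using nz by (intro val_monomial_at_infinity[OF VV(1) xV]) auto
    moreover have "x - b \<notin> nonunits V" if "b \<in> B" for b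
    proof
      have bK: "b \<in> K" using that BT T_sub by auto
      assume "x - b \<in> nonunits V"
      then have "(x - b) + b \<in> V" using bK K_sub_V by (intro V_closed(6)) (auto simp: nonunits_def)
      then show False using xV by simp
    qed
    then have "int N * val (c * t ^ i) \<ge> 0" using reg_val[OF VV(1)] by simp
    ultimately have "int N * ((\<Sum>d\<in>T. r d) + int (degree A)) \<le> int i * int q ^ 3"
      using val_x_neg[OF VV(1) xV] by (simp add: zero_le_mult_iff)
    \<comment> \<open>The numerator can only tighten the condition at infinity, so its degree is
      dropped.\<close>
    moreover have "int N * int (degree A) \<ge> 0" by simp
    ultimately show ?thesis unfolding distrib_left by linarith
  qed
  ultimately show ?thesis by blast
qed

end

section \<open>Pole vectors at the chosen places\<close>

locale GGS_places = GGS_curve +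
  fixes s :: nat and \<alpha> :: "nat \<Rightarrow> 'a" and R :: "nat \<Rightarrow> 'a set"
  assumes \<alpha>: "inj_on \<alpha> {1..s}" "\<alpha> ` {1..s} \<subseteq> Z"
    and R: "\<And>l. l \<in> {1..s} \<Longrightarrow> valuation_ring K UNIV (R l)" "\<And>l. l \<in> {1..s} \<Longrightarrow> x - \<alpha> l \<in> nonunits (R l)"
    and s: "2 \<le> s"
begin

definition "B = \<alpha> ` {1..s}"
definition "w l z = v (R l) z"

text \<open>\<open>zero_order i\<close> and \<open>deg_bound i\<close> are \<open>\<lceil>i / m\<rceil>\<close> and \<open>\<lfloor>i q\<^sup>3 / (q\<^sup>n + 1)\<rfloor>\<close>: the order at a root in \<open>T - Z\<close> that
  cancels the poles of \<open>t\<^sup>i\<close>, and the largest degree of \<open>a\<close> for which \<open>a t\<^sup>i\<close> is regular at infinity.\<close>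

definition "zero_order i = \<lceil>real i / ((real q ^ n + 1) / (real q + 1))\<rceil>"
definition "deg_bound i = \<lfloor>real i * real q ^ 3 / (real q ^ n + 1)\<rfloor>"
text \<open>The least possible sum of the \<open>j\<close>. The degree is at most
  \<open>deg_bound i\<close>, but one zero is required at each of the \<open>q - s\<close> roots in
  \<open>Z - B\<close> and \<open>zero_order i\<close> zeros at each of the \<open>q^2 - q\<close>
  elements of \<open>T - Z\<close>; the difference must be made up by poles at the chosen
  places.\<close>

definition "bound i = int q - int s + (int q ^ 2 - int q) * zero_order i - deg_bound i"

lemma \<alpha>_Z: "l \<in> {1..s} \<Longrightarrow> \<alpha> l \<in> Z" using \<alpha> by auto

lemma B_sub_Z: "B \<subseteq> Z" using \<alpha> by (auto simp: B_def)

lemma card_B: "card B = s" using \<alpha> by (simp add: B_def card_image)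

lemma real_N: "real N = real q ^ n + 1" by (simp add: N_def)

lemma zero_order_le_iff: "zero_order i \<le> r \<longleftrightarrow> int i * (int q + 1) \<le> int N * r"
proof -
  have "zero_order i \<le> r \<longleftrightarrow> real i / (real N / (real q + 1)) \<le> real_of_int r"
    unfolding zero_order_def real_N[symmetric] by (rule ceiling_le_iff)
  also have "\<dots> \<longleftrightarrow> real i * (real q + 1) \<le> real N * real_of_int r"
    using N_pos by (simp add: field_simps)
  also have "\<dots> \<longleftrightarrow> real_of_int (int i * (int q + 1)) \<le> real_of_int (int N * r)" by simp
  finally show ?thesis by (simp only: of_int_le_iff)
qed

lemma le_deg_bound_iff: "r \<le> deg_bound i \<longleftrightarrow> int N * r \<le> int i * int q ^ 3"
proof -
  have "r \<le> deg_bound i \<longleftrightarrow> real_of_int r \<le> real i * real q ^ 3 / real N"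
    unfolding deg_bound_def real_N[symmetric] by (rule le_floor_iff)
  also have "\<dots> \<longleftrightarrow> real N * real_of_int r \<le> real i * real q ^ 3"
    using N_pos by (simp add: field_simps)
  also have "\<dots> \<longleftrightarrow> real_of_int (int N * r) \<le> real_of_int (int i * int q ^ 3)" by simp
  finally show ?thesis by (simp only: of_int_le_iff)
qed

lemma sum_T_split:
  fixes r :: "'a \<Rightarrow> int"
  shows "(\<Sum>d\<in>T. r d) = (\<Sum>l=1..s. r (\<alpha> l)) + (\<Sum>d\<in>Z - B. r d) + (\<Sum>d\<in>T - Z. r d)"
    "int (card (Z - B)) = int q - int s" "int (card (T - Z)) = int q ^ 2 - int q"
proof -
  have fin: "finite Z" "finite B" using finite_subset[OF Z_sub_T finite_T] by (auto simp: B_def)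
  have "(\<Sum>d\<in>T. r d) = (\<Sum>d\<in>T - Z. r d) + ((\<Sum>d\<in>Z - B. r d) + (\<Sum>d\<in>B. r d))"
    using sum.subset_diff[OF Z_sub_T finite_T, of r] sum.subset_diff[OF B_sub_Z fin(1), of r] by simp
  also have "(\<Sum>d\<in>B. r d) = (\<Sum>l=1..s. r (\<alpha> l))" unfolding B_def using \<alpha>(1) by (simp add: sum.reindex)
  finally show "(\<Sum>d\<in>T. r d) = (\<Sum>l=1..s. r (\<alpha> l)) + (\<Sum>d\<in>Z - B. r d) + (\<Sum>d\<in>T - Z. r d)" by simp
  have "s \<le> q" using card_mono[OF fin(1) B_sub_Z] card_B card_Z by simp
  then show "int (card (Z - B)) = int q - int s"
    using card_Diff_subset[OF fin(2) B_sub_Z] card_B card_Z by simp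
  have "q \<le> q ^ 2" using q_ge_2 by (simp add: power2_eq_square)
  then show "int (card (T - Z)) = int q ^ 2 - int q"
    using card_Diff_subset[OF fin(1) Z_sub_T] card_T card_Z by (simp add: of_nat_diff)
qed

text \<open>\<open>j l\<close> is minus the exponent at \<open>\<alpha> l\<close>. It may be
  negative, since a regular component need not have a pole at every chosen place.\<close>

lemma pole_orders_of_monomial:
  assumes c: "c \<in> k" "c \<noteq> 0" and i: "1 \<le> i" and reg: "regular B (c * t ^ i)"
  shows "\<exists>j. (\<forall>l\<in>{1..s}. w l (c * t ^ i) = - (int N * j l + int i)) \<and> bound i \<le> (\<Sum>l=1..s. j l)"
proof -
  obtain r where r: "\<forall>\<alpha>\<in>Z. \<forall>V. valuation_ring K UNIV V \<and> x - \<alpha> \<in> nonunits V \<longrightarrow> v V (c * t ^ i) = int N * r \<alpha> - int i"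
    "\<forall>d\<in>T - B. int N * r d \<ge> int i * int (e d)" "int N * (\<Sum>d\<in>T. r d) \<le> int i * int q ^ 3"
    using regular_monomial_constraints[OF B_sub_Z c reg] by blast
  \<comment> \<open>Because \<open>i \<ge> 1\<close>, the pole of \<open>t ^ i\<close> over
    \<open>d\<close> has to be cancelled.\<close>
  have "1 \<le> r d" if d: "d \<in> Z - B" for d
  proof -
    have "int N * r d \<ge> int i * int (e d)" using r(2) d Z_sub_T by blast
    then have "int N * r d \<ge> int i" using d by (simp add: e_def)
    then have "0 < int N * r d" using i by linarith
    then show ?thesis by (simp add: zero_less_mult_iff)
  qed
  then have "(\<Sum>d\<in>Z - B. 1) \<le> (\<Sum>d\<in>Z - B. r d)" by (intro sum_mono) auto
  then have 1: "int q - int s \<le> (\<Sum>d\<in>Z - B. r d)" using sum_T_split(2) by simp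
  have "zero_order i \<le> r d" if d: "d \<in> T - Z" for d
  proof -
    have "int i * (int q + 1) = int i * int (e d)" using d by (simp add: e_def)
    then show ?thesis unfolding zero_order_le_iff using r(2) d B_sub_Z by auto
  qed
  then have "(\<Sum>d\<in>T - Z. zero_order i) \<le> (\<Sum>d\<in>T - Z. r d)" by (intro sum_mono) auto
  then have 2: "(int q ^ 2 - int q) * zero_order i \<le> (\<Sum>d\<in>T - Z. r d)" using sum_T_split(3) by simp
  have 3: "(\<Sum>d\<in>T. r d) \<le> deg_bound i" unfolding le_deg_bound_iff by (rule r(3))
  have "bound i \<le> - (\<Sum>l=1..s. r (\<alpha> l))" using 1 2 3 unfolding bound_def sum_T_split(1)[of r] by linarith
  moreover have "w l (c * t ^ i) = - (int N * (- r (\<alpha> l)) + int i)" if "l \<in> {1..s}" for l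
    using r(1) \<alpha>_Z[OF that] R that by (simp add: w_def)
  ultimately show ?thesis by (intro exI[of _ "\<lambda>l. - r (\<alpha> l)"]) (auto simp: sum_negf)
qed

lemma exists_monomial:
  fixes r :: "'a \<Rightarrow> int"
  assumes "\<And>d. d \<in> T - B \<Longrightarrow> int N * r d \<ge> int i * int (e d)" "int N * (\<Sum>d\<in>T. r d) \<le> int i * int q ^ 3"
  shows "\<exists>z. z \<noteq> 0 \<and> regular B z \<and> (\<forall>l\<in>{1..s}. w l z = int N * r (\<alpha> l) - int i)"
proof (intro exI conjI ballI)
  \<comment> \<open>The factor 1 takes the place of \<open>b\<close> in
    \<open>val_component_at\<close>.\<close>
  let ?z = "(\<Prod>d\<in>T. (x - d) powi r d) * 1 * t ^ i"
  show "?z \<noteq> 0" using x_minus_nonzero T_sub finite_T t_nonzero by auto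
  show "regular B ?z" using regular_monomial[OF _ assms] B_sub_Z Z_sub_T by auto
  fix l assume l: "l \<in> {1..s}"
  interpret discretely_valued_field K UNIV "R l" by (rule discretely_valued[OF R(1)[OF l]])
  show "w l ?z = int N * r (\<alpha> l) - int i"
    unfolding w_def using val_component_at[OF \<alpha>_Z R one_neq_zero val_one, OF l l l]
    by (simp only: val_y_at[OF \<alpha>_Z R, OF l l l] mult_1_left)
qed

lemma exists_function_with_poles:
  assumes j: "bound i \<le> (\<Sum>l=1..s. j l)" and i: "1 \<le> i" "i < N"
  shows "\<exists>z. z \<noteq> 0 \<and> regular B z \<and> (\<forall>l\<in>{1..s}. w l z = - (int N * j l + int i))"
proof -
  \<comment> \<open>Extremal exponents: the prescribed poles on \<open>B\<close> and the least
    admissible zeros on the rest of \<open>T\<close>. Order 1 suffices on \<open>Z - B\<close>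
    because \<open>i < N\<close>. The degree condition then is the hypothesis on
    \<open>j\<close>.\<close>
  define r where "r d = (if d \<in> B then - j (the_inv_into {1..s} \<alpha> d) else if d \<in> Z then 1 else zero_order i)" for d
  have r\<alpha>: "r (\<alpha> l) = - j l" if "l \<in> {1..s}" for l
    using that the_inv_into_f_f[OF \<alpha>(1) that] by (auto simp: r_def B_def)
  have "(\<Sum>l=1..s. r (\<alpha> l)) = - (\<Sum>l=1..s. j l)" using r\<alpha> by (simp add: sum_negf)
  moreover have "(\<Sum>d\<in>Z - B. r d) = int q - int s"
  proof -
    have "(\<Sum>d\<in>Z - B. r d) = (\<Sum>d\<in>Z - B. 1)" by (intro sum.cong) (auto simp: r_def)
    then show ?thesis using sum_T_split(2) by simp
  qed
  moreover have "(\<Sum>d\<in>T - Z. r d) = (int q ^ 2 - int q) * zero_order i"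
  proof -
    have "(\<Sum>d\<in>T - Z. r d) = (\<Sum>d\<in>T - Z. zero_order i)" using B_sub_Z by (intro sum.cong) (auto simp: r_def)
    then show ?thesis using sum_T_split(3) by simp
  qed
  ultimately have "(\<Sum>d\<in>T. r d) \<le> deg_bound i" using j unfolding sum_T_split(1)[of r] bound_def by linarith
  then have "int N * (\<Sum>d\<in>T. r d) \<le> int i * int q ^ 3" by (simp only: le_deg_bound_iff)
  moreover have "int N * r d \<ge> int i * int (e d)" if d: "d \<in> T - B" for d
  proof (cases "d \<in> Z")
    case True
    then show ?thesis using d i by (simp add: r_def e_def)
  next
    case False
    then have "r d = zero_order i" "int (e d) = int q + 1" using d by (auto simp: r_def e_def)
    then show ?thesis using zero_order_le_iff[of i "zero_order i"] by simp
  qed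
  ultimately obtain z where z: "z \<noteq> 0" "regular B z" "\<forall>l\<in>{1..s}. w l z = int N * r (\<alpha> l) - int i"
    using exists_monomial[of i r] by blast
  moreover have "w l z = - (int N * j l + int i)" if "l \<in> {1..s}" for l using z(3) that r\<alpha> by simp
  ultimately show ?thesis by blast
qed

text \<open>The case \<open>i = 0\<close> of \<open>exists_monomial\<close>, a power of
  \<open>x - \<alpha> l0\<close>. It serves to exclude multiples of \<open>N\<close> as entries of a
  minimal vector.\<close>

lemma exists_function_with_single_pole:
  assumes l0: "l0 \<in> {1..s}"
  shows "\<exists>z. z \<noteq> 0 \<and> regular B z \<and> w l0 z = - (int N * int j) \<and> (\<forall>l\<in>{1..s} - {l0}. w l z = 0)"
proof -
  define r where "r d = (if d = \<alpha> l0 then - int j else 0)" for d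
  have "\<alpha> l0 \<in> T" using \<alpha>_Z[OF l0] Z_sub_T by auto
  then have "(\<Sum>d\<in>T. r d) = - int j" using finite_T by (simp add: r_def)
  moreover have "r d = 0" if "d \<in> T - B" for d using that l0 by (auto simp: r_def B_def)
  ultimately obtain z where z: "z \<noteq> 0" "regular B z" "\<forall>l\<in>{1..s}. w l z = int N * r (\<alpha> l) - int 0"
    using exists_monomial[of 0 r] by auto
  have "w l0 z = - (int N * int j)" using z l0 by (simp add: r_def)
  moreover have "w l z = 0" if "l \<in> {1..s} - {l0}" for l
  proof -
    have "\<alpha> l \<noteq> \<alpha> l0" using inj_on_contraD[OF \<alpha>(1), of l l0] that l0 by blast
    then show ?thesis using z(3) that by (simp add: r_def)
  qed
  ultimately show ?thesis using z by blast
qed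

text \<open>At each chosen place the order of \<open>z\<close> is the minimum of the orders of its
  components. The component attaining it at \<open>l0\<close> keeps the pole there and has no worse
  pole elsewhere.\<close>

lemma dominating_component:
  assumes z: "z \<noteq> 0" "regular B z" and l0: "l0 \<in> {1..s}"
  shows "\<exists>c i. c \<in> k \<and> c \<noteq> 0 \<and> i < N \<and> regular B (c * t ^ i) \<and> w l0 (c * t ^ i) = w l0 z \<and>
    (\<forall>l\<in>{1..s}. w l z \<le> w l (c * t ^ i))"
proof -
  obtain m i where i: "i < N" "coord z i \<noteq> 0" "\<And>V. valuation_ring K UNIV V \<Longrightarrow> x - \<alpha> l0 \<in> nonunits V \<Longrightarrow>
      v V z = m \<and> v V (coord z i * t ^ i) = m"
    using val_decomposition_at[OF \<alpha>_Z[OF l0] z(1)] by blast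
  have "w l z \<le> w l (coord z i * t ^ i)" if l: "l \<in> {1..s}" for l
    using val_decomposition_at[OF \<alpha>_Z[OF l] z(1)] R[OF l] i(1,2) unfolding w_def by blast
  moreover have "w l0 (coord z i * t ^ i) = w l0 z" using i(3)[OF R[OF l0 ]] l0 by (simp add: w_def)
  moreover have "regular B (coord z i * t ^ i)" using B_sub_Z Z_sub_K z i by (intro regular_component) auto
  ultimately show ?thesis using i coord by blast
qed

lemma monomial_order: "c \<in> k \<Longrightarrow> c \<noteq> 0 \<Longrightarrow> l \<in> {1..s} \<Longrightarrow> \<exists>r. w l (c * t ^ i) = int N * r - int i"
  unfolding w_def by (intro val_monomial_at[OF \<alpha>_Z R])

section \<open>Minimal pole vectors\<close>

definition pole_vector :: "'a \<Rightarrow> nat \<Rightarrow> nat" where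
  "pole_vector z l = nat (- w l z)"

text \<open>\<open>minimal_in\<close> for functions on \<open>{1..s}\<close>, with the members of
  the semigroup given by the functions that have these poles; lists enter only at the end.\<close>

definition minimal_vector :: "(nat \<Rightarrow> nat) \<Rightarrow> nat \<Rightarrow> bool" where
  "minimal_vector a l0 \<longleftrightarrow>
     (\<exists>z. z \<noteq> 0 \<and> regular B z \<and> (\<forall>l\<in>{1..s}. pole_vector z l = a l)) \<and>
     (\<forall>z. z \<noteq> 0 \<and> regular B z \<and> pole_vector z l0 = a l0 \<and> (\<forall>l\<in>{1..s}. pole_vector z l \<le> a l) \<longrightarrow>
        (\<forall>l\<in>{1..s}. pole_vector z l = a l))"

lemma minimal_vector_imp:
  assumes pos: "\<And>l. l \<in> {1..s} \<Longrightarrow> 1 \<le> a l" and l0: "l0 \<in> {1..s}" and min: "minimal_vector a l0"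
  shows "\<exists>i j. 1 \<le> i \<and> i < N \<and> int (\<Sum>l=1..s. j l) = bound i \<and> (\<forall>l\<in>{1..s}. a l = N * j l + i)"
proof -
  have minD: "pole_vector z l = a l" if "z \<noteq> 0" "regular B z" "pole_vector z l0 = a l0"
    "\<And>l. l \<in> {1..s} \<Longrightarrow> pole_vector z l \<le> a l" "l \<in> {1..s}" for z l
    using min that unfolding minimal_vector_def by blast
  obtain z where z: "z \<noteq> 0" "regular B z" "\<And>l. l \<in> {1..s} \<Longrightarrow> pole_vector z l = a l"
    using min unfolding minimal_vector_def by blast
  obtain c i where c: "c \<in> k" "c \<noteq> 0" "i < N" "regular B (c * t ^ i)" "w l0 (c * t ^ i) = w l0 z"
    "\<And>l. l \<in> {1..s} \<Longrightarrow> w l z \<le> w l (c * t ^ i)"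
    using dominating_component[OF z(1,2) l0] by blast
  \<comment> \<open>By minimality a single component already realises the whole vector.\<close>
  have "pole_vector (c * t ^ i) l = a l" if "l \<in> {1..s}" for l
  proof (rule minD[OF _ c(4) _ _ that])
    show "c * t ^ i \<noteq> 0" using c t_nonzero by simp
    show "pole_vector (c * t ^ i) l0 = a l0" using z(3)[OF l0] c(5) by (simp add: pole_vector_def)
    show "pole_vector (c * t ^ i) l \<le> a l" if "l \<in> {1..s}" for l
      using z(3)[OF that] c(6)[OF that] by (simp add: pole_vector_def)
  qed
  then have wa: "w l (c * t ^ i) = - int (a l)" if "l \<in> {1..s}" for l
    using pos[OF that] that unfolding pole_vector_def by fastforce
  \<comment> \<open>A second index, available as \<open>s \<ge> 2\<close>: there an entry can be
    lowered without touching the one at \<open>l0\<close>.\<close>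
  define l1 where "l1 = (if l0 = 1 then 2 else 1 :: nat)"
  have l1: "l1 \<in> {1..s}" "l1 \<noteq> l0" using s by (auto simp: l1_def)
  \<comment> \<open>For \<open>i = 0\<close> the entry at \<open>l0\<close> is a multiple of
    \<open>N\<close>, and a function with that pole alone gives a smaller vector, with entry 0 at
    \<open>l1\<close>.\<close>
  have i: "1 \<le> i"
  proof (rule ccontr)
    assume "\<not> 1 \<le> i"
    then have i0: "i = 0" by simp
    obtain r where "w l0 (c * t ^ i) = int N * r - int i" using monomial_order[OF c(1,2) l0] by blast
    then have "w l0 (c * t ^ i) = int N * r" using i0 by simp
    then have r: "int (a l0) = int N * (- r)" using wa[OF l0] by simp
    then have "int N * (- r) > 0" using pos[OF l0] by linarith
    then have "- r > 0" by (simp add: mult_less_0_iff)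
    then have r': "int (a l0) = int N * int (nat (- r))" using r by simp
    obtain u where u: "u \<noteq> 0" "regular B u" "w l0 u = - (int N * int (nat (- r)))" "\<forall>l\<in>{1..s} - {l0}. w l u = 0"
      using exists_function_with_single_pole[OF l0] by blast
    have "pole_vector u l1 = a l1"
    proof (rule minD[OF u(1,2) _ _ l1(1)])
      show eq: "pole_vector u l0 = a l0" using u(3) unfolding r'[symmetric] by (simp add: pole_vector_def)
      show "pole_vector u l \<le> a l" if "l \<in> {1..s}" for l
        using eq u(4) that by (cases "l = l0") (auto simp: pole_vector_def)
    qed
    then show False using u(4) l1 pos[OF l1(1)] by (simp add: pole_vector_def)
  qed
  obtain j where j: "\<And>l. l \<in> {1..s} \<Longrightarrow> w l (c * t ^ i) = - (int N * j l + int i)" "bound i \<le> (\<Sum>l=1..s. j l)"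
    using pole_orders_of_monomial[OF c(1,2) i c(4)] by blast
  have aj: "int (a l) = int N * j l + int i" if "l \<in> {1..s}" for l using wa[OF that] j(1)[OF that] by simp
  have jpos: "j l \<ge> 0" if l: "l \<in> {1..s}" for l
  proof (rule ccontr)
    assume "\<not> j l \<ge> 0"
    \<comment> \<open>Otherwise \<open>a l \<le> i - N < 0\<close>.\<close>
    then have "int N * j l \<le> int N * (- 1)" by (intro mult_left_mono) auto
    then show False using aj[OF l] pos[OF l] c(3) by linarith
  qed
  have "\<not> bound i < (\<Sum>l=1..s. j l)"
  proof
    assume lt: "bound i < (\<Sum>l=1..s. j l)"
    \<comment> \<open>If the bound is not attained, \<open>j\<close> can be lowered by one at
      \<open>l1\<close>. The entry there drops even if the new exponent is negative, when there is
      no pole at all.\<close>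
    define j' where "j' = j(l1 := j l1 - 1)"
    have "(\<Sum>l=1..s. j' l) = (\<Sum>l=1..s. j l - (if l = l1 then 1 else 0))"
      by (intro sum.cong) (auto simp: j'_def)
    also have "\<dots> = (\<Sum>l=1..s. j l) - 1" using l1(1) by (simp add: sum_subtractf)
    finally have "(\<Sum>l=1..s. j' l) = (\<Sum>l=1..s. j l) - 1" .
    then obtain u where u: "u \<noteq> 0" "regular B u" "\<forall>l\<in>{1..s}. w l u = - (int N * j' l + int i)"
      using exists_function_with_poles[of i j'] lt i c(3) by auto
    have u': "pole_vector u l = a l" if "l \<in> {1..s}" "l \<noteq> l1" for l
      using u(3) that aj[OF that(1)] by (simp add: pole_vector_def j'_def)
    have lt1: "pole_vector u l1 < a l1"
    proof -
      have "w l1 u = - (int N * (j l1 - 1) + int i)" using u(3) l1(1) by (simp add: j'_def)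
      then have "- w l1 u = int (a l1) - int N" using aj[OF l1(1)] by (simp add: algebra_simps)
      then show ?thesis using pos[OF l1(1)] N_pos unfolding pole_vector_def by linarith
    qed
    have "pole_vector u l1 = a l1"
    proof (rule minD[OF u(1,2) _ _ l1(1)])
      show "pole_vector u l0 = a l0" using u' l0 l1 by simp
      show "pole_vector u l \<le> a l" if "l \<in> {1..s}" for l using u'[OF that] lt1 by (cases "l = l1") auto
    qed
    then show False using lt1 by simp
  qed
  then have sum: "(\<Sum>l=1..s. j l) = bound i" using j(2) by simp
  have "int (\<Sum>l=1..s. nat (j l)) = bound i" using sum jpos by simp
  moreover have "a l = N * nat (j l) + i" if "l \<in> {1..s}" for l
  proof -
    have "int (a l) = int (N * nat (j l) + i)" using aj[OF that] jpos[OF that] by simp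
    then show ?thesis using of_nat_eq_iff by blast
  qed
  ultimately show ?thesis using i c(3) by (intro exI[of _ i] exI[of _ "\<lambda>l. nat (j l)"]) auto
qed

text \<open>A competitor is replaced by its dominating component at \<open>l0\<close>. The entry at
  \<open>l0\<close> fixes the residue \<open>i\<close> modulo \<open>N\<close>; the exponents of the
  component are at most those of \<open>j\<close>, while their sum is at least
  \<open>bound i\<close>, the sum of \<open>j\<close>. So they agree.\<close>

lemma minimal_vectorI:
  assumes i: "1 \<le> i" "i < N" and j: "int (\<Sum>l=1..s. j l) = bound i"
    and a: "\<And>l. l \<in> {1..s} \<Longrightarrow> a l = N * j l + i" and l0: "l0 \<in> {1..s}"
  shows "minimal_vector a l0"
  unfolding minimal_vector_def
proof (intro conjI allI impI)
  obtain z where "z \<noteq> 0" "regular B z" "\<forall>l\<in>{1..s}. w l z = - (int N * int (j l) + int i)"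
    using exists_function_with_poles[of i "\<lambda>l. int (j l)"] j i by auto
  moreover from this have "\<forall>l\<in>{1..s}. pole_vector z l = a l"
    using a by (auto simp: pole_vector_def simp flip: of_nat_mult of_nat_add)
  ultimately show "\<exists>z. z \<noteq> 0 \<and> regular B z \<and> (\<forall>l\<in>{1..s}. pole_vector z l = a l)" by blast
next
  fix z assume z: "z \<noteq> 0 \<and> regular B z \<and> pole_vector z l0 = a l0 \<and> (\<forall>l\<in>{1..s}. pole_vector z l \<le> a l)"
  obtain c i' where c: "c \<in> k" "c \<noteq> 0" "i' < N" "regular B (c * t ^ i')" "w l0 (c * t ^ i') = w l0 z"
    "\<And>l. l \<in> {1..s} \<Longrightarrow> w l z \<le> w l (c * t ^ i')"
    using dominating_component[of z l0] z l0 by blast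
  \<comment> \<open>The entry at \<open>l0\<close> is positive because \<open>i \<ge> 1\<close>, so
    truncation by \<open>nat\<close> loses nothing.\<close>
  have wz: "w l0 z = - (int N * int (j l0) + int i)"
  proof -
    have "int (nat (- w l0 z)) = int N * int (j l0) + int i" using z a[OF l0] by (simp add: pole_vector_def)
    moreover have "int N * int (j l0) \<ge> 0" by simp
    ultimately show ?thesis using i by linarith
  qed
  obtain r where r: "w l0 (c * t ^ i') = int N * r - int i'" using monomial_order[OF c(1,2) l0] by blast
  have "int i' - int i = int N * (r + int (j l0))" using r c(5) wz by (simp add: algebra_simps)
  then have "int i' mod int N = int i mod int N" by (simp add: mod_eq_dvd_iff)
  then have ii: "i' = i" using c(3) i by (simp flip: of_nat_mod)
  obtain j' where j': "\<And>l. l \<in> {1..s} \<Longrightarrow> w l (c * t ^ i) = - (int N * j' l + int i)" "bound i \<le> (\<Sum>l=1..s. j' l)"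
    using pole_orders_of_monomial[OF c(1,2) i(1)] c(4) unfolding ii by blast
  have le: "int N * j' l + int i \<le> int (pole_vector z l)" if "l \<in> {1..s}" for l
    using j'(1)[OF that] c(6)[OF that] unfolding ii pole_vector_def by linarith
  have jj: "j' l \<le> int (j l)" if l: "l \<in> {1..s}" for l
  proof -
    have "pole_vector z l \<le> N * j l + i" using z a[OF l] l by metis
    then have "int (pole_vector z l) \<le> int (N * j l + i)" by (rule of_nat_mono)
    then have "int N * j' l \<le> int N * int (j l)" using le[OF l] by simp
    then show ?thesis using N_pos by simp
  qed
  have eq: "j' l = int (j l)" if l: "l \<in> {1..s}" for l
  proof (rule ccontr)
    assume "j' l \<noteq> int (j l)"
    then have "(\<Sum>l=1..s. j' l) < (\<Sum>l=1..s. int (j l))" using jj l by (intro sum_strict_mono_ex1) force+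
    then show False using j j'(2) by simp
  qed
  show "\<forall>l\<in>{1..s}. pole_vector z l = a l"
  proof
    fix l assume l: "l \<in> {1..s}"
    have "int (N * j l + i) \<le> int (pole_vector z l)" using le[OF l] eq[OF l] by simp
    then show "pole_vector z l = a l" using z a[OF l] l by (metis le_antisym of_nat_le_iff)
  qed
qed

section \<open>Translation to divisors, lists and the generating set\<close>

abbreviation "Q l \<equiv> nonunits (R l)"

lemma Q_eq_iff: "valuation_ring K UNIV V \<Longrightarrow> l \<in> {1..s} \<Longrightarrow> nonunits V = Q l \<longleftrightarrow> x - \<alpha> l \<in> nonunits V"
  using valuation_ring_over_unique[OF \<alpha>_Z _ _ R] R by metis

lemma Q_inj: "l \<in> {1..s} \<Longrightarrow> l' \<in> {1..s} \<Longrightarrow> Q l = Q l' \<Longrightarrow> l = l'"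
proof (rule ccontr)
  assume l: "l \<in> {1..s}" "l' \<in> {1..s}" and eq: "Q l = Q l'" and ne: "l \<noteq> l'"
  interpret discretely_valued_field K UNIV "R l" by (rule discretely_valued[OF R(1)[OF l(1)]])
  have \<alpha>K: "\<alpha> l \<in> K" "\<alpha> l' \<in> K" using \<alpha>_Z l Z_sub_K by auto
  have ne: "\<alpha> l' \<noteq> \<alpha> l" using inj_on_contraD[OF \<alpha>(1) ne l] by simp
  have "val (x - \<alpha> l') > 0" using R(2)[OF l(2)] eq x_minus_nonzero[OF \<alpha>K(2)] val_pos_iff by simp
  then show False using val_x_minus_other[OF R(1)[OF l(1)] \<alpha>K(1) R(2)[OF l(1)] \<alpha>K(2) ne] by simp
qed

lemma place_Q: "l \<in> {1..s} \<Longrightarrow> place K UNIV (Q l)"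
proof -
  assume l: "l \<in> {1..s}"
  interpret discretely_valued_field K UNIV "R l" by (rule discretely_valued[OF R(1)[OF l]])
  show ?thesis by (rule place_nonunits)
qed

lemma pole_divisor_eq_iff:
  assumes z: "z \<noteq> 0"
  shows "pole_divisor K UNIV z = divisor_sum (map Q [1..<Suc s]) (map a [1..<Suc s]) \<longleftrightarrow>
    regular B z \<and> (\<forall>l\<in>{1..s}. pole_vector z l = a l)"
proof -
  have dsum: "divisor_sum (map Q [1..<Suc s]) (map a [1..<Suc s]) P = (\<Sum>l=1..s. if P = Q l then a l else 0)" for P
  proof -
    \<comment> \<open>List positions start at 0, the indices of \<open>Q\<close> and
      \<open>a\<close> at 1.\<close>
    have "divisor_sum (map Q [1..<Suc s]) (map a [1..<Suc s]) P = (\<Sum>i<s. if P = Q (Suc i) then a (Suc i) else 0)"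
      unfolding divisor_sum_def by (intro sum.cong) (auto simp del: upt_Suc)
    also have "\<dots> = (\<Sum>l\<in>Suc ` {..<s}. if P = Q l then a l else 0)" by (simp add: sum.reindex)
    also have "Suc ` {..<s} = {1..s}" by (simp add: image_Suc_lessThan)
    finally show ?thesis .
  qed
  have dQ: "divisor_sum (map Q [1..<Suc s]) (map a [1..<Suc s]) (Q l) = a l" if l: "l \<in> {1..s}" for l
  proof -
    have "(\<Sum>l'=1..s. if Q l = Q l' then a l' else 0) = (\<Sum>l'=1..s. if l = l' then a l' else 0)"
      using Q_inj[OF l] by (intro sum.cong) auto
    then show ?thesis unfolding dsum using l by simp
  qed
  have pQ: "pole_divisor K UNIV z (Q l) = pole_vector z l" if "l \<in> {1..s}" for l
    using z place_Q[OF that] by (simp add: pole_divisor_def pole_vector_def w_def)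
  have d0: "divisor_sum (map Q [1..<Suc s]) (map a [1..<Suc s]) P = 0" if "P \<notin> Q ` {1..s}" for P
    unfolding dsum using that by (intro sum.neutral) auto
  have reg: "regular B z \<longleftrightarrow> (\<forall>P. P \<notin> Q ` {1..s} \<longrightarrow> pole_divisor K UNIV z P = 0)"
  proof
    assume reg: "regular B z"
    show "\<forall>P. P \<notin> Q ` {1..s} \<longrightarrow> pole_divisor K UNIV z P = 0"
    proof (intro allI impI)
      fix P assume P: "P \<notin> Q ` {1..s}"
      show "pole_divisor K UNIV z P = 0"
      proof (cases "place K UNIV P")
        case True
        then obtain V where V: "valued_field K UNIV V" "P = nonunits V"
          using place_cases[OF K(1) subfield_set_UNIV] by blast
        then have VV: "valuation_ring K UNIV V" by (simp add: valued_field.V)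
        interpret discretely_valued_field K UNIV V by (rule discretely_valued[OF VV])
        have "x - \<alpha> l \<notin> nonunits V" if "l \<in> {1..s}" for l
          using P Q_eq_iff[OF VV that] that unfolding \<open>P = nonunits V\<close> by blast
        then have "\<forall>\<alpha>\<in>B. x - \<alpha> \<notin> nonunits V" by (auto simp: B_def)
        then have "z \<in> V" using reg VV unfolding regular_def by blast
        then show ?thesis using val_nonneg_iff[of z] z \<open>P = nonunits V\<close> by (simp add: pole_divisor_def)
      qed (simp add: pole_divisor_def)
    qed
  next
    assume H: "\<forall>P. P \<notin> Q ` {1..s} \<longrightarrow> pole_divisor K UNIV z P = 0"
    show "regular B z" unfolding regular_def
    proof (intro allI impI)
      fix V assume VV: "valuation_ring K UNIV V \<and> (\<forall>\<alpha>\<in>B. x - \<alpha> \<notin> nonunits V)"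
      then interpret discretely_valued_field K UNIV V by (intro discretely_valued) simp
      have "nonunits V \<noteq> Q l" if "l \<in> {1..s}" for l
        using VV Q_eq_iff[OF _ that, of V] that by (auto simp: B_def)
      then have "nonunits V \<notin> Q ` {1..s}" by blast
      then have "pole_divisor K UNIV z (nonunits V) = 0" using H by blast
      then have "val z \<ge> 0" using place_nonunits z by (simp add: pole_divisor_def)
      then show "z \<in> V" using val_nonneg_iff[of z] z by simp
    qed
  qed
  show ?thesis
  proof
    assume eq: "pole_divisor K UNIV z = divisor_sum (map Q [1..<Suc s]) (map a [1..<Suc s])"
    show "regular B z \<and> (\<forall>l\<in>{1..s}. pole_vector z l = a l)"
      unfolding reg using eq d0 dQ pQ by metis
  next
    assume "regular B z \<and> (\<forall>l\<in>{1..s}. pole_vector z l = a l)"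
    then have "pole_divisor K UNIV z P = divisor_sum (map Q [1..<Suc s]) (map a [1..<Suc s]) P" for P
      using reg d0 dQ pQ by (cases "P \<in> Q ` {1..s}") auto
    then show "pole_divisor K UNIV z = divisor_sum (map Q [1..<Suc s]) (map a [1..<Suc s])" by blast
  qed
qed

text \<open>The semigroup admits \<open>z = 0\<close>; its pole divisor is that of 1, so a nonzero
  function can be taken instead.\<close>

lemma weierstrass_semigroup_iff:
  "map a [1..<Suc s] \<in> weierstrass_semigroup K UNIV (map Q [1..<Suc s]) \<longleftrightarrow>
    (\<exists>z. z \<noteq> 0 \<and> regular B z \<and> (\<forall>l\<in>{1..s}. pole_vector z l = a l))"
proof -
  have "pole_divisor K UNIV 0 = pole_divisor K UNIV 1"
  proof
    fix P
    show "pole_divisor K UNIV 0 P = pole_divisor K UNIV 1 P"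
    proof (cases "place K UNIV P")
      case True
      then obtain V where V: "valued_field K UNIV V" "P = nonunits V"
        using place_cases[OF K(1) subfield_set_UNIV] by blast
      then interpret discretely_valued_field K UNIV V by (intro discretely_valued) (simp add: valued_field.V)
      show ?thesis using \<open>P = nonunits V\<close> val_one by (simp add: pole_divisor_def)
    qed (simp add: pole_divisor_def)
  qed
  then have "(\<exists>z\<in>UNIV. pole_divisor K UNIV z = d) \<longleftrightarrow> (\<exists>z. z \<noteq> 0 \<and> pole_divisor K UNIV z = d)" for d
    by (metis UNIV_I one_neq_zero)
  then show ?thesis unfolding weierstrass_semigroup_def using pole_divisor_eq_iff[of _ a]
    by (auto simp del: upt_Suc)
qed

lemma map_nth_Suc: "length ns = s \<Longrightarrow> map (\<lambda>l. ns ! (l - 1)) [1..<Suc s] = ns"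
  by (rule nth_equalityI) (auto simp del: upt_Suc)

text \<open>\<open>l0\<close> is a list position and therefore corresponds to the index
  \<open>Suc l0\<close>.\<close>

lemma minimal_in_iff:
  assumes l0: "l0 < s"
  shows "minimal_in {ns \<in> weierstrass_semigroup K UNIV (map Q [1..<Suc s]). ns ! l0 = map a [1..<Suc s] ! l0}
      (map a [1..<Suc s]) \<longleftrightarrow> minimal_vector a (Suc l0)"
proof -
  let ?H = "weierstrass_semigroup K UNIV (map Q [1..<Suc s])"
  have eq: "map b [1..<Suc s] = map a [1..<Suc s] \<longleftrightarrow> (\<forall>l\<in>{1..s}. b l = a l)" for b
    by (auto simp del: upt_Suc)
  have nth: "map b [1..<Suc s] ! l0 = b (Suc l0)" for b :: "nat \<Rightarrow> nat" using l0 by (simp del: upt_Suc)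
  have le: "list_all2 (\<le>) (map b [1..<Suc s]) (map a [1..<Suc s]) \<longleftrightarrow> (\<forall>l\<in>{1..s}. b l \<le> a l)" for b
  proof -
    have "list_all2 (\<le>) (map b [1..<Suc s]) (map a [1..<Suc s]) \<longleftrightarrow> (\<forall>l\<in>set [1..<Suc s]. b l \<le> a l)"
      by (simp add: list_all2_map1 list_all2_map2 list_all2_same del: upt_Suc set_upt)
    also have "set [1..<Suc s] = {1..s}" by auto
    finally show ?thesis .
  qed
  have all: "(\<forall>ns\<in>?H. P ns) \<longleftrightarrow> (\<forall>z. z \<noteq> 0 \<and> regular B z \<longrightarrow> P (map (pole_vector z) [1..<Suc s]))" for P
  proof
    assume "\<forall>ns\<in>?H. P ns"
    then show "\<forall>z. z \<noteq> 0 \<and> regular B z \<longrightarrow> P (map (pole_vector z) [1..<Suc s])"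
      using weierstrass_semigroup_iff by blast
  next
    assume H: "\<forall>z. z \<noteq> 0 \<and> regular B z \<longrightarrow> P (map (pole_vector z) [1..<Suc s])"
    show "\<forall>ns\<in>?H. P ns"
    proof
      fix ns assume ns: "ns \<in> ?H"
      define b where "b l = ns ! (l - 1)" for l
      have "length ns = s" using ns by (simp add: weierstrass_semigroup_def)
      then have nsb: "ns = map b [1..<Suc s]" unfolding b_def by (rule map_nth_Suc[symmetric])
      then obtain z where z: "z \<noteq> 0" "regular B z" "\<forall>l\<in>{1..s}. pole_vector z l = b l"
        using ns weierstrass_semigroup_iff by blast
      then have "map (pole_vector z) [1..<Suc s] = ns" unfolding nsb by (auto simp del: upt_Suc)
      then show "P ns" using H z by metis
    qed
  qed
  have "minimal_in {ns \<in> ?H. ns ! l0 = map a [1..<Suc s] ! l0} (map a [1..<Suc s]) \<longleftrightarrow>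
    map a [1..<Suc s] \<in> ?H \<and> (\<forall>ns\<in>?H. ns ! l0 = map a [1..<Suc s] ! l0 \<and>
      list_all2 (\<le>) ns (map a [1..<Suc s]) \<longrightarrow> ns = map a [1..<Suc s])"
    unfolding minimal_in_def by blast
  then show ?thesis unfolding minimal_vector_def weierstrass_semigroup_iff all eq nth le by blast
qed

lemma minimal_generating_set_eq:
  "minimal_generating_set K UNIV (map Q [1..<Suc s]) =
    {map (\<lambda>l. N * j l + i) [1..<Suc s] | i j. 1 \<le> i \<and> i < N \<and> int (\<Sum>l=1..s. j l) = bound i}" (is "?L = ?R")
proof (intro equalityI subsetI)
  fix ns assume ns: "ns \<in> ?L"
  define a where "a l = ns ! (l - 1)" for l
  have "length ns = s" using ns by (simp add: minimal_generating_set_def)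
  then have nsa: "ns = map a [1..<Suc s]" unfolding a_def by (rule map_nth_Suc[symmetric])
  obtain l0 where l0: "l0 < s" and min: "minimal_vector a (Suc l0)"
    using ns minimal_in_iff unfolding nsa minimal_generating_set_def by (auto simp del: upt_Suc)
  have pos: "1 \<le> a l" if "l \<in> {1..s}" for l
  proof -
    have "\<forall>i<s. 1 \<le> ns ! i" using ns by (simp add: minimal_generating_set_def)
    moreover have "l - 1 < s" using that by auto
    ultimately show ?thesis unfolding a_def by blast
  qed
  have "Suc l0 \<in> {1..s}" using l0 by simp
  then obtain i j where ij: "1 \<le> i" "i < N" "int (\<Sum>l=1..s. j l) = bound i" "\<forall>l\<in>{1..s}. a l = N * j l + i"
    using minimal_vector_imp[OF pos _ min] by blast
  have "ns = map (\<lambda>l. N * j l + i) [1..<Suc s]" unfolding nsa using ij(4) by (auto simp del: upt_Suc)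
  then show "ns \<in> ?R" using ij by blast
next
  fix ns assume "ns \<in> ?R"
  then obtain i j where ij: "ns = map (\<lambda>l. N * j l + i) [1..<Suc s]" "1 \<le> i" "i < N" "int (\<Sum>l=1..s. j l) = bound i"
    by blast
  \<comment> \<open>Every position witnesses minimality; the first one is taken.\<close>
  have "minimal_vector (\<lambda>l. N * j l + i) (Suc 0)" using s by (intro minimal_vectorI[OF ij(2-4)]) auto
  then have "minimal_in {ms \<in> weierstrass_semigroup K UNIV (map Q [1..<Suc s]). ms ! 0 = ns ! 0} ns"
    unfolding ij(1) using s by (intro minimal_in_iff[THEN iffD2]) auto
  moreover have "0 < length (map Q [1..<Suc s])" using s by simp
  moreover have "length ns = length (map Q [1..<Suc s])" by (simp add: ij(1))
  moreover have "\<forall>l<length (map Q [1..<Suc s]). 1 \<le> ns ! l" using ij(2) by (simp add: ij(1) del: upt_Suc)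
  ultimately show "ns \<in> ?L" unfolding minimal_generating_set_def by blast
qed

end

text \<open>\<open>is_zero_of\<close> refers to the order in K(x), so discreteness is used for that
  field as well; it puts \<open>x - c\<close> into \<open>P\<close> and hence into
  \<open>Q\<close>.\<close>

lemma (in GGS_curve) lies_over_zeroD:
  assumes c: "c \<in> K" and P: "is_zero_of K k P (x - c)" "lies_over K k UNIV Q P"
  shows "\<exists>V. valuation_ring K UNIV V \<and> Q = nonunits V \<and> x - c \<in> nonunits V"
proof -
  have pl: "place K k P" "place K UNIV Q" "P \<subseteq> Q" using P(2) by (auto simp: lies_over_def)
  obtain V0 where V0: "valued_field K k V0" "P = nonunits V0" using place_cases[OF K(1) k_field pl(1)] .
  then interpret V0: discretely_valued_field K k V0
    by (intro discretely_valued_rational) (simp add: valued_field.V)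
  have "x - c \<in> k" "x - c \<noteq> 0" using x_in_k c K_sub_k k_closed(1) x_minus_nonzero by auto
  then have "x - c \<in> P" using P(1) V0.val_pos_iff V0(2) by (simp add: is_zero_of_def)
  moreover obtain V where "valued_field K UNIV V" "Q = nonunits V"
    using place_cases[OF K(1) subfield_set_UNIV pl(2)] .
  ultimately show ?thesis using pl(3) valued_field.V by blast
qed

theorem proposition5p6:
  fixes K :: "'a::field set" and x y :: 'a and q n s :: nat and m :: real
    and \<alpha> :: "nat \<Rightarrow> 'a" and Q :: "nat \<Rightarrow> 'a set"
  assumes q: "primepow q"
    and n: "n \<ge> 3" "odd n"
    and K: "subfield_set K" "card K = q ^ (2 * n)"
    and x: "transcendental_over K x"
    and F: "adjoin K {x, y} = (UNIV :: 'a set)"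
    and eq: "y ^ (q ^ n + 1) = (x ^ q + x) * ((x ^ q + x) ^ (q - 1) - 1) ^ (q + 1)"
    and \<alpha>: "bij_betw \<alpha> {1..q} {a \<in> K. a ^ q + a = 0}"
    and Q: "\<And>k. k \<in> {1..q} \<Longrightarrow>
      \<exists>P. is_zero_of K (adjoin K {x}) P (x - \<alpha> k) \<and> lies_over K (adjoin K {x}) UNIV (Q k) P"
    and m: "m = (real q ^ n + 1) / (real q + 1)"
    and s: "2 \<le> s"
      "int s \<le> min (int q)
        (Max ((\<lambda>i::nat. int q + (int q ^ 2 - int q) * \<lceil>real i / m\<rceil>
                        - \<lfloor>real i * real q ^ 3 / (real q ^ n + 1)\<rfloor>) ` {1..q ^ n}))"
  shows "minimal_generating_set K UNIV (map Q [1..<Suc s]) =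
    {map (\<lambda>k. (q ^ n + 1) * j k + i) [1..<Suc s] | (i :: nat) (j :: nat \<Rightarrow> nat).
       1 \<le> i \<and> i \<le> q ^ n \<and>
       int (\<Sum>k = 1..s. j k) =
         int q - int s + (int q ^ 2 - int q) * \<lceil>real i / m\<rceil>
           - \<lfloor>real i * real q ^ 3 / (real q ^ n + 1)\<rfloor>}"
proof -
  have sq: "{1..s} \<subseteq> {1..q}" using s(2) by auto
  have "card {a \<in> K. a ^ q + a = 0} = q" using bij_betw_same_card[OF \<alpha>] by simp
  then interpret GGS_curve K x y q n using q n K x F eq by unfold_locales auto
  have \<alpha>Z: "inj_on \<alpha> {1..s}" "\<alpha> ` {1..s} \<subseteq> Z"
    using \<alpha> sq inj_on_subset[OF _ sq] unfolding bij_betw_def Z_def by blast+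
  have "\<forall>l\<in>{1..s}. \<exists>V. valuation_ring K UNIV V \<and> Q l = nonunits V \<and> x - \<alpha> l \<in> nonunits V"
  proof
    fix l assume l: "l \<in> {1..s}"
    then have "\<alpha> l \<in> K" using \<alpha>Z(2) Z_sub_K by blast
    moreover have "l \<in> {1..q}" using l sq by blast
    ultimately show "\<exists>V. valuation_ring K UNIV V \<and> Q l = nonunits V \<and> x - \<alpha> l \<in> nonunits V"
      using lies_over_zeroD Q by blast
  qed
  then obtain R where RQ: "\<And>l. l \<in> {1..s} \<Longrightarrow> valuation_ring K UNIV (R l) \<and> Q l = nonunits (R l) \<and> x - \<alpha> l \<in> nonunits (R l)"
    by (metis bchoice)
  interpret GGS_places K x y q n s \<alpha> R using \<alpha>Z RQ s(1) by unfold_locales auto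
  have "map Q [1..<Suc s] = map (\<lambda>l. nonunits (R l)) [1..<Suc s]"
    using RQ by (intro map_cong refl) auto
  \<comment> \<open>The range \<open>i < N\<close> of residues becomes
    \<open>i \<le> q ^ n\<close>.\<close>
  then show ?thesis
    using minimal_generating_set_eq
    unfolding bound_def zero_order_def deg_bound_def m N_def by (simp only: less_Suc_eq_le Suc_eq_plus1[symmetric])
qed

end
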